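(* Let $E$ and $F$ be sc-Banach spaces, let $U$ be a relatively open subset of a partial quadrant $C$ in $E$, and let $k\ge 0$ be an integer. If the map $f:U\to F$ is $\mathrm{sc}^k$, then the induced map $f:U_{m+l}\to F_m$ is of class $C^l$ for every $0\le l\le k$ and every $m\ge 0$.
   Context: $\mathbb N_0=\{0,1,2,\dots\}$. An sc-structure on a Banach space $E$ is a nested sequence $E=E_0\supset E_1\supset\cdots$ of Banach spaces such that every inclusion $E_{m+1}\to E_m$ is compact and $E_\infty:=\bigcap_m E_m$ is dense in every $E_m$; $E$ is then an sc-Banach space. Finite-dimensional spaces carry the constant structure. $|\cdot|_m$ is the norm of $E_m$. $E\oplus F$ has levels $E_m\oplus F_m$; $E^k$ is $E_k$ with levels $(E^k)_m=E_{k+m}$. A linear map $T:E\to F$ is an sc-operator if it maps $E_m$ continuously into $F_m$ for all $m$; a linear sc-isomorphism is a bijective sc-operator whose inverse is an sc-operator. A partial quadrant in $E$ is a closed subset $C\subset E$ for which there are an sc-Banach space $W$, an integer $k\ge 0$ and a linear sc-isomorphism $T:E\to\mathbb R^k\oplus W$ with $T(C)=[0,\infty)^k\oplus W$. A relatively open $U\subset C$ has levels $U_m=U\cap E_m$ (with the topology of $E_m$); $U^k$ is $U_k$ with levels $U_{k+m}$; its tangent is $TU=U^1\oplus E$, a relatively open subset of the partial quadrant $C^1\oplus E$ of $E^1\oplus E$. A map $f:U\to V$ between relatively open subsets of partial quadrants in sc-Banach spaces $E$ and $F$ is $\mathrm{sc}^0$ if $f(U_m)\subset V_m$ and $f:U_m\to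 V_m$ is continuous for all $m$. An $\mathrm{sc}^0$-map $f$ is $\mathrm{sc}^1$ if for every $x\in U_1$ there is a bounded linear operator $Df(x):E_0\to F_0$ such that (1) $\lim_{|h|_1\to0}\frac1{|h|_1}|f(x+h)-f(x)-Df(x)h|_0=0$, where $h\in E_1$ and $x+h\in C$; (2) the tangent map $Tf:TU\to TV$, $(x,h)\mapsto(f(x),Df(x)h)$, is $\mathrm{sc}^0$. Inductively, $f$ is $\mathrm{sc}^{k+1}$ if it is $\mathrm{sc}^1$ and $Tf$ is $\mathrm{sc}^k$; $f$ is sc-smooth ($\mathrm{sc}^\infty$) if it is $\mathrm{sc}^k$ for all $k$. *)

theory Defs
  imports "HOL-Analysis.Analysis" "HOL-Library.Function_Algebras"
begin

section \<open>Normed spaces carried by subspaces\<close>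

text \<open>
  The levels of an sc-Banach space are different norms on different subspaces of one vector
  space, so a normed space is a subspace of an ambient real vector space together with a norm.
  The values of \<open>nrm V\<close> outside \<open>car V\<close> carry no meaning.
\<close>

record 'a nspace =
  car :: "'a set"
  nrm :: "'a \<Rightarrow> real"

definition ndist :: "'a::real_vector nspace \<Rightarrow> 'a \<Rightarrow> 'a \<Rightarrow> real" where
  "ndist V x y = (if x \<in> car V \<and> y \<in> car V then nrm V (x - y) else 0)"

abbreviation ntop :: "'a::real_vector nspace \<Rightarrow> 'a topology" where
  "ntop V \<equiv> Metric_space.mtopology (car V) (ndist V)"

definition normed :: "'a::real_vector nspace \<Rightarrow> bool" where
  "normed V \<longleftrightarrow> subspace (car V) \<and>
     (\<forall>x\<in>car V. 0 \<le> nrm V x \<and> (nrm V x = 0 \<longleftrightarrow> x = 0)) \<and>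
     (\<forall>c. \<forall>x\<in>car V. nrm V (c *\<^sub>R x) = \<bar>c\<bar> * nrm V x) \<and>
     (\<forall>x\<in>car V. \<forall>y\<in>car V. nrm V (x + y) \<le> nrm V x + nrm V y)"

definition banach_space :: "'a::real_vector nspace \<Rightarrow> bool" where
  "banach_space V \<longleftrightarrow> normed V \<and> Metric_space.mcomplete (car V) (ndist V)"

definition lin_map :: "'a::real_vector nspace \<Rightarrow> 'b::real_vector nspace \<Rightarrow> ('a \<Rightarrow> 'b) \<Rightarrow> bool" where
  "lin_map V W A \<longleftrightarrow> A \<in> car V \<rightarrow> car W \<and>
     (\<forall>x\<in>car V. \<forall>y\<in>car V. A (x + y) = A x + A y) \<and>
     (\<forall>c. \<forall>x\<in>car V. A (c *\<^sub>R x) = c *\<^sub>R A x)"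

definition bounded_lin_map :: "'a::real_vector nspace \<Rightarrow> 'b::real_vector nspace \<Rightarrow> ('a \<Rightarrow> 'b) \<Rightarrow> bool" where
  "bounded_lin_map V W A \<longleftrightarrow> lin_map V W A \<and> (\<exists>K. \<forall>x\<in>car V. nrm W (A x) \<le> K * nrm V x)"

definition compact_lin_map :: "'a::real_vector nspace \<Rightarrow> 'b::real_vector nspace \<Rightarrow> ('a \<Rightarrow> 'b) \<Rightarrow> bool" where
  "compact_lin_map V W A \<longleftrightarrow> lin_map V W A \<and>
     compactin (ntop W) (ntop W closure_of (A ` {x \<in> car V. nrm V x \<le> 1}))"

definition nsum :: "'a nspace \<Rightarrow> 'b nspace \<Rightarrow> ('a \<times> 'b) nspace" where
  "nsum V W = \<lparr>car = car V \<times> car W, nrm = (\<lambda>(x, y). nrm V x + nrm W y)\<rparr>"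

text \<open>Transport of a normed space along an injective linear map.\<close>

definition nimage :: "('a \<Rightarrow> 'b) \<Rightarrow> 'a nspace \<Rightarrow> 'b nspace" where
  "nimage \<phi> V = \<lparr>car = \<phi> ` car V, nrm = (\<lambda>y. nrm V (inv_into (car V) \<phi> y))\<rparr>"

text \<open>
  The remainder condition \<open>\<parallel>f (x + h) - f x - A h\<parallel> / \<parallel>h\<parallel> \<rightarrow> 0\<close> as \<open>h \<rightarrow> 0\<close> in \<open>V\<close>, where
  \<open>x + h\<close> stays in the domain \<open>U\<close> of \<open>f\<close>. If \<open>U\<close> is relatively open in \<open>C\<close>, then \<open>x + h \<in> U\<close>
  and \<open>x + h \<in> C\<close> agree for small \<open>h\<close>, and the values of \<open>f\<close> outside \<open>U\<close> are meaningless.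
\<close>

definition first_order_at ::
  "'a::real_vector nspace \<Rightarrow> 'b::real_vector nspace \<Rightarrow> 'a set \<Rightarrow> ('a \<Rightarrow> 'b) \<Rightarrow> 'a \<Rightarrow> ('a \<Rightarrow> 'b) \<Rightarrow> bool" where
  "first_order_at V W U f x A \<longleftrightarrow>
     ((\<lambda>h. nrm W (f (x + h) - f x - A h) / nrm V h) \<longlongrightarrow> 0) (atin_within (ntop V) 0 {h. x + h \<in> U})"

text \<open>Pointwise vector space structure on functions.\<close>

instantiation "fun" :: (type, real_vector) real_vector
begin

definition scaleR_fun :: "real \<Rightarrow> ('a \<Rightarrow> 'b) \<Rightarrow> 'a \<Rightarrow> 'b" where
  "scaleR_fun c f = (\<lambda>x. c *\<^sub>R f x)"

instance
  by standard (auto simp: scaleR_fun_def plus_fun_def algebra_simps)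

end


section \<open>sc-Banach spaces\<close>

type_synonym 'a sc_space = "nat \<Rightarrow> 'a nspace"

definition sc_banach :: "'a::real_vector sc_space \<Rightarrow> bool" where
  "sc_banach E \<longleftrightarrow> (\<forall>m. banach_space (E m)) \<and>
     (\<forall>m. car (E (Suc m)) \<subseteq> car (E m)) \<and>
     (\<forall>m. compact_lin_map (E (Suc m)) (E m) (\<lambda>x. x)) \<and>
     (\<forall>m. ntop (E m) closure_of (\<Inter>j. car (E j)) = car (E m))"

definition sc_sum :: "'a sc_space \<Rightarrow> 'b sc_space \<Rightarrow> ('a \<times> 'b) sc_space" where
  "sc_sum E F = (\<lambda>m. nsum (E m) (F m))"

definition sc_shift :: "nat \<Rightarrow> 'a sc_space \<Rightarrow> 'a sc_space" where
  "sc_shift k E = (\<lambda>m. E (k + m))"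

definition sc_operator :: "'a::real_vector sc_space \<Rightarrow> 'b::real_vector sc_space \<Rightarrow> ('a \<Rightarrow> 'b) \<Rightarrow> bool" where
  "sc_operator E F T \<longleftrightarrow> lin_map (E 0) (F 0) T \<and> (\<forall>m. continuous_map (ntop (E m)) (ntop (F m)) T)"

definition sc_iso :: "'a::real_vector sc_space \<Rightarrow> 'b::real_vector sc_space \<Rightarrow> ('a \<Rightarrow> 'b) \<Rightarrow> bool" where
  "sc_iso E F T \<longleftrightarrow> bij_betw T (car (E 0)) (car (F 0)) \<and> sc_operator E F T \<and>
     sc_operator F E (inv_into (car (E 0)) T)"

definition sc_Rn :: "nat \<Rightarrow> (nat \<Rightarrow> real) sc_space" where
  "sc_Rn n = (\<lambda>m. \<lparr>car = {v. \<forall>i\<ge>n. v i = 0}, nrm = (\<lambda>v. L2_set v {..<n})\<rparr>)"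

text \<open>
  The complement \<open>W\<close> may be taken inside the ambient vector space of \<open>E\<close>: via \<open>T\<close>, any
  sc-Banach space \<open>W\<close> as required is linearly sc-isomorphic to the preimage of \<open>0 \<oplus> W\<close> with the
  norms of \<open>E\<close>.
\<close>

definition partial_quadrant :: "'a::real_vector sc_space \<Rightarrow> 'a set \<Rightarrow> bool" where
  "partial_quadrant E C \<longleftrightarrow> closedin (ntop (E 0)) C \<and>
     (\<exists>(W :: 'a sc_space) n T. sc_banach W \<and> sc_iso E (sc_sum (sc_Rn n) W) T \<and>
        T ` C = {v \<in> car (sc_Rn n 0). \<forall>i. 0 \<le> v i} \<times> car (W 0))"


section \<open>Maps of class sc-k\<close>

text \<open>The level \<open>U\<^sub>m\<close> is \<open>U \<inter> car (E m)\<close> with the topology of \<open>E m\<close>.\<close>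

definition sc0_map ::
  "'a::real_vector sc_space \<Rightarrow> 'a set \<Rightarrow> 'b::real_vector sc_space \<Rightarrow> ('a \<Rightarrow> 'b) \<Rightarrow> bool" where
  "sc0_map E U F f \<longleftrightarrow> (\<forall>m. continuous_map (subtopology (ntop (E m)) U) (ntop (F m)) f)"

definition sc_derivative ::
  "'a::real_vector sc_space \<Rightarrow> 'a set \<Rightarrow> 'b::real_vector sc_space \<Rightarrow> ('a \<Rightarrow> 'b) \<Rightarrow> ('a \<Rightarrow> 'a \<Rightarrow> 'b) \<Rightarrow> bool" where
  "sc_derivative E U F f Df \<longleftrightarrow>
     (\<forall>x\<in>U \<inter> car (E 1). bounded_lin_map (E 0) (F 0) (Df x) \<and> first_order_at (E 1) (F 0) U f x (Df x))"

definition tangent :: "'a sc_space \<Rightarrow> ('a \<times> 'a) sc_space" where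
  "tangent E = sc_sum (sc_shift 1 E) E"

definition tangent_set :: "'a sc_space \<Rightarrow> 'a set \<Rightarrow> ('a \<times> 'a) set" where
  "tangent_set E U = (U \<inter> car (E 1)) \<times> car (E 0)"

definition tangent_map :: "('a \<Rightarrow> 'b) \<Rightarrow> ('a \<Rightarrow> 'a \<Rightarrow> 'b) \<Rightarrow> 'a \<times> 'a \<Rightarrow> 'b \<times> 'b" where
  "tangent_map f Df = (\<lambda>(x, h). (f x, Df x h))"

text \<open>
  The inductive definition passes from \<open>E\<close> to \<open>TE\<close>, that is, from the type \<open>'a\<close> to \<open>'a \<times> 'a\<close>,
  which recursion in HOL does not allow. Iterated tangent spaces are therefore coded in the single
  type \<open>bool list \<Rightarrow> 'a\<close>: \<open>leaf\<close> embeds \<open>'a\<close>, and \<open>node\<close> is a linear coding of pairs with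
  inverse \<open>unnode\<close>. That the tangent map is sc-0, as required of an sc-1 map, is part of it being of
  class sc-k. The lemmas \<open>sc_map_0\<close> and \<open>sc_map_Suc\<close> below state the inductive definition
  without any coding.
\<close>

definition leaf :: "'a::zero \<Rightarrow> 'i list \<Rightarrow> 'a" where
  "leaf x = (\<lambda>w. if w = [] then x else 0)"

definition unleaf :: "('i list \<Rightarrow> 'a) \<Rightarrow> 'a" where
  "unleaf z = z []"

definition node :: "(bool list \<Rightarrow> 'a::zero) \<times> (bool list \<Rightarrow> 'a) \<Rightarrow> bool list \<Rightarrow> 'a" where
  "node p = (\<lambda>w. case w of [] \<Rightarrow> 0 | b # v \<Rightarrow> if b then snd p v else fst p v)"

definition unnode :: "(bool list \<Rightarrow> 'a) \<Rightarrow> (bool list \<Rightarrow> 'a) \<times> (bool list \<Rightarrow> 'a)" where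
  "unnode z = (\<lambda>v. z (False # v), \<lambda>v. z (True # v))"

primrec sc_map_coded ::
  "nat \<Rightarrow> (bool list \<Rightarrow> 'a::real_vector) sc_space \<Rightarrow> (bool list \<Rightarrow> 'a) set \<Rightarrow>
   (bool list \<Rightarrow> 'b::real_vector) sc_space \<Rightarrow> ((bool list \<Rightarrow> 'a) \<Rightarrow> bool list \<Rightarrow> 'b) \<Rightarrow> bool" where
  "sc_map_coded 0 E U F f = sc0_map E U F f"
| "sc_map_coded (Suc k) E U F f =
     (sc0_map E U F f \<and> (\<exists>Df. sc_derivative E U F f Df \<and>
        sc_map_coded k (nimage node \<circ> tangent E) (node ` tangent_set E U) (nimage node \<circ> tangent F)
          (node \<circ> tangent_map f Df \<circ> unnode)))"

definition sc_map ::
  "nat \<Rightarrow> 'a::real_vector sc_space \<Rightarrow> 'a set \<Rightarrow> 'b::real_vector sc_space \<Rightarrow> ('a \<Rightarrow> 'b) \<Rightarrow> bool" where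
  "sc_map k E U F f = sc_map_coded k (nimage leaf \<circ> E) (leaf ` U) (nimage leaf \<circ> F) (leaf \<circ> f \<circ> unleaf)"


section \<open>Maps of class C-l between normed spaces\<close>

text \<open>
  The space of bounded linear operators with the operator norm; an operator is represented by the
  function which vanishes outside \<open>car V\<close>.
\<close>

definition op_space :: "'a::real_vector nspace \<Rightarrow> 'b::real_vector nspace \<Rightarrow> ('a \<Rightarrow> 'b) nspace" where
  "op_space V W = \<lparr>car = {A. bounded_lin_map V W A \<and> (\<forall>x. x \<notin> car V \<longrightarrow> A x = 0)},
     nrm = (\<lambda>A. SUP x\<in>{x \<in> car V. nrm V x \<le> 1}. nrm W (A x))\<rparr>"

definition c0_map ::
  "'a::real_vector nspace \<Rightarrow> 'a set \<Rightarrow> 'b::real_vector nspace \<Rightarrow> ('a \<Rightarrow> 'b) \<Rightarrow> bool" where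
  "c0_map V U W f \<longleftrightarrow> continuous_map (subtopology (ntop V) U) (ntop W) f"

definition frechet_derivative_on ::
  "'a::real_vector nspace \<Rightarrow> 'a set \<Rightarrow> 'b::real_vector nspace \<Rightarrow> ('a \<Rightarrow> 'b) \<Rightarrow> ('a \<Rightarrow> 'a \<Rightarrow> 'b) \<Rightarrow> bool" where
  "frechet_derivative_on V U W f Df \<longleftrightarrow>
     (\<forall>x\<in>U. Df x \<in> car (op_space V W) \<and> first_order_at V W U f x (Df x))"

text \<open>
  \<open>f\<close> is of class \<open>C\<^sup>l\<^sup>+\<^sup>1\<close> if it has a derivative \<open>U \<rightarrow> L(V, W)\<close> of class \<open>C\<^sup>l\<close>. Since the type
  of the target changes, the spaces \<open>L(V, L(V, \<dots>))\<close> are coded in the type \<open>'a list \<Rightarrow> 'b\<close>; see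
  \<open>c_map_0\<close> and \<open>c_map_Suc\<close> below for the definition without coding.
\<close>

definition uncurry_op :: "('a \<Rightarrow> 'a list \<Rightarrow> 'b::zero) \<Rightarrow> 'a list \<Rightarrow> 'b" where
  "uncurry_op A = (\<lambda>w. case w of [] \<Rightarrow> 0 | h # v \<Rightarrow> A h v)"

primrec c_map_coded ::
  "nat \<Rightarrow> 'a::real_vector nspace \<Rightarrow> 'a set \<Rightarrow> ('a list \<Rightarrow> 'b::real_vector) nspace \<Rightarrow>
   ('a \<Rightarrow> 'a list \<Rightarrow> 'b) \<Rightarrow> bool" where
  "c_map_coded 0 V U G f = c0_map V U G f"
| "c_map_coded (Suc l) V U G f =
     (c0_map V U G f \<and> (\<exists>Df. frechet_derivative_on V U G f Df \<and>
        c_map_coded l V U (nimage uncurry_op (op_space V G)) (uncurry_op \<circ> Df)))"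

definition c_map ::
  "nat \<Rightarrow> 'a::real_vector nspace \<Rightarrow> 'a set \<Rightarrow> 'b::real_vector nspace \<Rightarrow> ('a \<Rightarrow> 'b) \<Rightarrow> bool" where
  "c_map l V U W f = c_map_coded l V U (nimage leaf W) (leaf \<circ> f)"


section \<open>The inductive definitions without coding\<close>

text \<open>
  The codings do not affect the notions defined above: being of class sc-k or C-l is invariant
  under linear isometries of source and target, which gives the recursion equations \<open>sc_map_Suc\<close>
  and \<open>c_map_Suc\<close> on the original types.
\<close>

lemma normedD:
  assumes "normed V"
  shows "0 \<in> car V" "x \<in> car V \<Longrightarrow> y \<in> car V \<Longrightarrow> x + y \<in> car V"
    "x \<in> car V \<Longrightarrow> y \<in> car V \<Longrightarrow> x - y \<in> car V"
    "x \<in> car V \<Longrightarrow> c *\<^sub>R x \<in> car V"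
    "x \<in> car V \<Longrightarrow> 0 \<le> nrm V x"
    "x \<in> car V \<Longrightarrow> nrm V x = 0 \<longleftrightarrow> x = 0"
    "x \<in> car V \<Longrightarrow> nrm V (c *\<^sub>R x) = \<bar>c\<bar> * nrm V x"
    "x \<in> car V \<Longrightarrow> y \<in> car V \<Longrightarrow> nrm V (x + y) \<le> nrm V x + nrm V y"
  using assms by (auto simp: normed_def subspace_0 subspace_add subspace_diff subspace_scale)

lemma metric_normed:
  assumes "normed V" shows "Metric_space (car V) (ndist V)"
proof
  note n = normedD[OF assms]
  show "0 \<le> ndist V x y" for x y using n(3,5) by (simp add: ndist_def)
  show "ndist V x y = ndist V y x" for x y
    using n(7)[OF n(3)[of x y], of "-1"] by (simp add: ndist_def)
  show "ndist V x y = 0 \<longleftrightarrow> x = y" if "x \<in> car V" "y \<in> car V" for x y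
    using n(6)[OF n(3)[OF that]] that by (simp add: ndist_def)
  show "ndist V x z \<le> ndist V x y + ndist V y z" if "x \<in> car V" "y \<in> car V" "z \<in> car V" for x y z
    using n(8)[OF n(3)[OF that(1,2)] n(3)[OF that(2,3)]] that by (simp add: ndist_def)
qed

lemma topspace_ntop: "normed V \<Longrightarrow> topspace (ntop V) = car V"
  by (simp add: metric_normed Metric_space.topspace_mtopology)

definition lin_isometry :: "'a::real_vector nspace \<Rightarrow> 'b::real_vector nspace \<Rightarrow> ('a \<Rightarrow> 'b) \<Rightarrow> bool" where
  "lin_isometry V W \<phi> \<longleftrightarrow> lin_map V W \<phi> \<and> bij_betw \<phi> (car V) (car W) \<and> (\<forall>x\<in>car V. nrm W (\<phi> x) = nrm V x)"

lemma lin_mapD: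
  assumes "lin_map V W A"
  shows "x \<in> car V \<Longrightarrow> A x \<in> car W"
    and "x \<in> car V \<Longrightarrow> y \<in> car V \<Longrightarrow> A (x + y) = A x + A y"
    and "x \<in> car V \<Longrightarrow> A (c *\<^sub>R x) = c *\<^sub>R A x"
  using assms by (auto simp: lin_map_def)

lemma lin_map_diff:
  assumes "lin_map V W A" "normed V" "x \<in> car V" "y \<in> car V"
  shows "A (x - y) = A x - A y"
  using lin_mapD(2)[OF assms(1) normedD(3)[OF assms(2-4)] assms(4)]
  by simp

lemma lin_map_0:
  assumes "lin_map V W A" "normed V"
  shows "A 0 = 0"
  using lin_map_diff[OF assms, of 0 0] normedD(1)[OF assms(2)] by simp

lemma lin_isometry_normed:
  assumes i: "lin_isometry V W \<phi>" and n: "normed V"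
  shows "normed W"
proof -
  have l: "lin_map V W \<phi>" and im: "car W = \<phi> ` car V" and inj: "inj_on \<phi> (car V)"
    and nr: "\<And>x. x \<in> car V \<Longrightarrow> nrm W (\<phi> x) = nrm V x"
    using i by (auto simp: lin_isometry_def bij_betw_def)
  note ad = lin_mapD(2,3)[OF l, symmetric]
  have z: "\<phi> 0 = 0" using lin_map_0[OF l n] .
  have s: "subspace (car W)"
    unfolding subspace_def im
    using normedD(1,2,4)[OF n] z by (auto simp: ad intro: image_eqI[of _ \<phi> 0])
  have e: "\<phi> x = 0 \<longleftrightarrow> x = 0" if "x \<in> car V" for x
    using inj_onD[OF inj, of x 0] that normedD(1)[OF n] z by auto
  show ?thesis
    unfolding normed_def
  proof (intro conjI s; (intro allI ballI conjI)?)
    fix y assume "y \<in> car W"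
    then obtain x where x: "x \<in> car V" "y = \<phi> x" using im by auto
    show "0 \<le> nrm W y" using x nr normedD(5)[OF n] by simp
    show "nrm W y = 0 \<longleftrightarrow> y = 0" using x nr e normedD(6)[OF n] by simp
    show "nrm W (c *\<^sub>R y) = \<bar>c\<bar> * nrm W y" for c using x nr normedD(4,7)[OF n] by (simp add: ad)
    fix y' assume "y' \<in> car W"
    then obtain x' where x': "x' \<in> car V" "y' = \<phi> x'" using im by auto
    show "nrm W (y + y') \<le> nrm W y + nrm W y'"
      using x x' nr normedD(2,8)[OF n] by (simp add: ad)
  qed
qed

lemma lin_isometry_homeo:
  assumes i: "lin_isometry V W \<phi>" and n: "normed V"
  shows "homeomorphic_map (ntop V) (ntop W) \<phi>"
proof -
  interpret Metric_space12 "car V" "ndist V" "car W" "ndist W"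
    by (intro Metric_space12.intro metric_normed n lin_isometry_normed[OF i n])
  have l: "lin_map V W \<phi>" and im: "\<phi> ` car V = car W"
    and nr: "\<And>x. x \<in> car V \<Longrightarrow> nrm W (\<phi> x) = nrm V x"
    using i by (auto simp: lin_isometry_def bij_betw_def)
  show ?thesis
  proof (rule isometry_imp_homeomorphic_map[OF im])
    fix x y assume xy: "x \<in> car V" "y \<in> car V"
    then show "ndist W (\<phi> x) (\<phi> y) = ndist V x y"
      using nr[of "x - y"] lin_mapD(1)[OF l] normedD(3)[OF n]
      by (simp add: ndist_def lin_map_diff[OF l n, symmetric])
  qed
qed

lemma lin_isometry_inv:
  assumes i: "lin_isometry V W \<phi>" and n: "normed V"
  shows "lin_isometry W V (inv_into (car V) \<phi>)"
proof -
  have l: "lin_map V W \<phi>" and im: "car W = \<phi> ` car V" and inj: "inj_on \<phi> (car V)"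
    and bij: "bij_betw \<phi> (car V) (car W)"
    and nr: "\<And>x. x \<in> car V \<Longrightarrow> nrm W (\<phi> x) = nrm V x"
    using i by (auto simp: lin_isometry_def bij_betw_def)
  note ad = lin_mapD(2,3)[OF l, symmetric]
  have inv: "inv_into (car V) \<phi> (\<phi> x) = x" if "x \<in> car V" for x
    using inv_into_f_f[OF inj that] .
  have b: "bij_betw (inv_into (car V) \<phi>) (\<phi> ` car V) (car V)"
    using bij_betw_inv_into[OF bij] im by simp
  show ?thesis
    unfolding lin_isometry_def lin_map_def im
    using normedD(2,4)[OF n] by (auto simp: b ad inv nr)
qed

lemma lin_isometry_comp:
  assumes "lin_isometry V W \<phi>" "lin_isometry W Z \<psi>"
  shows "lin_isometry V Z (\<psi> \<circ> \<phi>)"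
proof -
  have "bij_betw (\<psi> \<circ> \<phi>) (car V) (car Z)"
    using assms bij_betw_trans unfolding lin_isometry_def by blast
  then show ?thesis
    using assms unfolding lin_isometry_def lin_map_def by (simp add: Pi_iff)
qed

lemma lin_isometry_nimage:
  assumes "linear \<phi>" "inj \<phi>"
  shows "lin_isometry V (nimage \<phi> V) \<phi>"
  using assms unfolding lin_isometry_def lin_map_def nimage_def
  by (auto simp: linear_add linear_scale bij_betw_def inj_on_subset[OF assms(2) subset_UNIV] inv_into_f_f[OF inj_on_subset[OF assms(2) subset_UNIV]])

lemma lin_isometry_nsum:
  assumes "lin_isometry V V' \<phi>" "lin_isometry W W' \<psi>"
  shows "lin_isometry (nsum V W) (nsum V' W') (map_prod \<phi> \<psi>)"
  using assms unfolding lin_isometry_def lin_map_def nsum_def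
  by (auto simp: bij_betw_map_prod scaleR_prod_def bij_betw_def map_prod_inj_on map_prod_surj_on)

lemma normed_nsum:
  assumes V: "normed V" and W: "normed W" shows "normed (nsum V W)"
proof -
  have "subspace (car V \<times> car W)" using assms by (simp add: normed_def subspace_Times)
  moreover have "0 \<le> nrm V x + nrm W y \<and> (nrm V x + nrm W y = 0 \<longleftrightarrow> x = 0 \<and> y = 0)"
    if "x \<in> car V" "y \<in> car W" for x y
    using normedD(5,6)[OF V that(1)] normedD(5,6)[OF W that(2)] by linarith
  moreover have "nrm V (c *\<^sub>R x) + nrm W (c *\<^sub>R y) = \<bar>c\<bar> * (nrm V x + nrm W y)"
    if "x \<in> car V" "y \<in> car W" for x y c
    using normedD(7)[OF V that(1)] normedD(7)[OF W that(2)] by (simp add: algebra_simps)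
  moreover have "nrm V (x + x') + nrm W (y + y') \<le> (nrm V x + nrm W y) + (nrm V x' + nrm W y')"
    if "x \<in> car V" "y \<in> car W" "x' \<in> car V" "y' \<in> car W" for x y x' y'
    using normedD(8)[OF V that(1,3)] normedD(8)[OF W that(2,4)] by linarith
  ultimately show ?thesis
    unfolding normed_def nsum_def by (simp add: zero_prod_def split_paired_all)
qed

lemma linear_leaf: "linear leaf" and inj_leaf: "inj leaf"
  by (auto simp: linear_iff leaf_def fun_eq_iff scaleR_fun_def inj_def)

lemma unleaf_leaf [simp]: "unleaf (leaf x) = x"
  by (simp add: leaf_def unleaf_def)

lemma linear_node: "linear node"
    by (auto simp: linear_iff node_def fun_eq_iff scaleR_fun_def split: list.splits)

lemma inj_node: "inj node"
proof (rule injI)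
  fix p q :: "(bool list \<Rightarrow> 'a) \<times> (bool list \<Rightarrow> 'a)" assume "node p = node q"
  then have "node p (b # v) = node q (b # v)" for b v by simp
  from this[of True] this[of False] show "p = q" by (simp add: node_def prod_eq_iff fun_eq_iff)
qed

lemma unnode_node [simp]: "unnode (node p) = p"
  by (simp add: node_def unnode_def)

lemma linear_uncurry_op: "linear uncurry_op"
    by (auto simp: linear_iff uncurry_op_def fun_eq_iff scaleR_fun_def split: list.splits)

lemma inj_uncurry_op: "inj uncurry_op"
proof (rule injI)
  fix p q :: "'a \<Rightarrow> 'a list \<Rightarrow> 'b" assume "uncurry_op p = uncurry_op q"
  then have "uncurry_op p (b # v) = uncurry_op q (b # v)" for b v by simp
  then show "p = q" by (simp add: uncurry_op_def fun_eq_iff)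
qed

lemma first_order_at_iff:
  assumes "normed V"
  shows "first_order_at V W U f x A \<longleftrightarrow>
    (\<forall>e>0. \<exists>d>0. \<forall>h\<in>car V. h \<noteq> 0 \<and> nrm V h < d \<and> x + h \<in> U \<longrightarrow>
        \<bar>nrm W (f (x + h) - f x - A h) / nrm V h\<bar> < e)"
proof -
  have 0: "ndist V h 0 = nrm V h" if "h \<in> car V" for h
    using that normedD(1)[OF assms] by (simp add: ndist_def)
  have 1: "0 < nrm V h \<longleftrightarrow> h \<noteq> 0" if "h \<in> car V" for h
    using normedD(5,6)[OF assms that] by linarith
  have 2: "(h \<in> car V \<and> h \<in> {h. x + h \<in> U} \<and> 0 < ndist V h 0 \<and> ndist V h 0 < d \<longrightarrow> P) \<longleftrightarrow>
      (h \<in> car V \<longrightarrow> h \<noteq> 0 \<and> nrm V h < d \<and> x + h \<in> U \<longrightarrow> P)" for h d P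
    using 0 1 by auto
  show ?thesis
    unfolding first_order_at_def tendsto_iff dist_real_def
      Metric_space.eventually_atin_within_metric[OF metric_normed[OF assms]] 2
    using normedD(1)[OF assms] by (simp add: Ball_def)
qed

lemma lin_isometry_nimage_inv:
  assumes "linear \<phi>" "linear \<theta>" "\<And>x. \<theta> (\<phi> x) = x"
  shows "lin_isometry (nimage \<phi> V) V \<theta>"
proof -
  have "inj_on \<phi> (car V)" by (metis assms(3) inj_onI)
  then have 1: "inv_into (car V) \<phi> (\<phi> x) = x" if "x \<in> car V" for x using that by simp
  have 2: "\<theta> (a + b) = \<theta> a + \<theta> b" "\<theta> (c *\<^sub>R a) = c *\<^sub>R \<theta> a" for a b c
    using assms(2) by (auto simp: linear_add linear_scale)
  have "bij_betw \<theta> (\<phi> ` car V) (car V)"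
    by (rule bij_betw_byWitness[where f' = \<phi>]) (auto simp: assms(3))
  then show ?thesis
    unfolding lin_isometry_def lin_map_def nimage_def by (auto simp: 1 2 assms(3))
qed

lemma unnode_linear: "linear unnode"
  by (auto simp: linear_iff unnode_def fun_eq_iff scaleR_fun_def)

lemma unleaf_linear: "linear unleaf"
  by (auto simp: linear_iff unleaf_def scaleR_fun_def)

lemma lin_isometry_first_order_at:
  assumes E: "lin_isometry E0 E0' \<phi>" "lin_isometry E1 E1' \<phi>" "car E1 \<subseteq> car E0" "normed E0" "normed E1"
    and F: "lin_isometry F0 F0' \<psi>" "normed F0"
    and U: "U \<subseteq> car E0" "x \<in> U" "f \<in> U \<rightarrow> car F0" "A \<in> car E0 \<rightarrow> car F0"
    and f': "\<And>u. u \<in> U \<Longrightarrow> f' (\<phi> u) = \<psi> (f u)"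
    and A': "\<And>h. h \<in> car E0 \<Longrightarrow> A' (\<phi> h) = \<psi> (A h)"
    and fo: "first_order_at E1 F0 U f x A"
  shows "first_order_at E1' F0' (\<phi> ` U) f' (\<phi> x) A'"
proof -
  have l: "lin_map E0 E0' \<phi>" and inj: "inj_on \<phi> (car E0)" using E(1) by (auto simp: lin_isometry_def bij_betw_def)
  have c1: "car E1' = \<phi> ` car E1" and n1: "\<And>h. h \<in> car E1 \<Longrightarrow> nrm E1' (\<phi> h) = nrm E1 h"
    using E(2) by (auto simp: lin_isometry_def bij_betw_def)
  have lF: "lin_map F0 F0' \<psi>" and nF: "\<And>h. h \<in> car F0 \<Longrightarrow> nrm F0' (\<psi> h) = nrm F0 h"
    using F(1) by (auto simp: lin_isometry_def)
  have x0: "x \<in> car E0" using U by auto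
  have key: "h \<noteq> 0 \<and> x + h \<in> U \<and> nrm E1' (\<phi> h) = nrm E1 h \<and>
     nrm F0' (f' (\<phi> x + \<phi> h) - f' (\<phi> x) - A' (\<phi> h)) = nrm F0 (f (x + h) - f x - A h)"
    if h: "h \<in> car E1" "\<phi> h \<noteq> 0" "\<phi> x + \<phi> h \<in> \<phi> ` U" for h
  proof -
    have h0: "h \<in> car E0" using h E(3) by auto
    have s: "\<phi> x + \<phi> h = \<phi> (x + h)" using lin_mapD(2)[OF l x0 h0] by simp
    obtain u where u: "u \<in> U" "\<phi> (x + h) = \<phi> u" using h(3) s by auto
    have "x + h = u"
      using inj_onD[OF inj u(2)] normedD(2)[OF E(4) x0 h0] u(1) U(1) by blast
    then have xh: "x + h \<in> U" using u by simp
    have m: "f (x + h) \<in> car F0" "f x \<in> car F0" "A h \<in> car F0" using U xh h0 by auto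
    have "f' (\<phi> x + \<phi> h) - f' (\<phi> x) - A' (\<phi> h) = \<psi> (f (x + h) - f x - A h)"
      unfolding s f'[OF xh] f'[OF U(2)] A'[OF h0]
      using lin_map_diff[OF lF F(2)] normedD(3)[OF F(2)] m by simp
    moreover have "h \<noteq> 0" using h(2) lin_map_0[OF l E(4)] by auto
    ultimately show ?thesis
      using xh n1[OF h(1)] nF normedD(3)[OF F(2)] m by simp
  qed
  show ?thesis
    unfolding first_order_at_iff[OF lin_isometry_normed[OF E(2,5)]]
  proof (intro allI impI)
    fix e :: real assume "e > 0"
    then obtain d where d: "d > 0" "\<forall>h\<in>car E1. h \<noteq> 0 \<and> nrm E1 h < d \<and> x + h \<in> U \<longrightarrow>
        \<bar>nrm F0 (f (x + h) - f x - A h) / nrm E1 h\<bar> < e"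
      using fo unfolding first_order_at_iff[OF E(5)] by blast
    show "\<exists>d>0. \<forall>h\<in>car E1'. h \<noteq> 0 \<and> nrm E1' h < d \<and> \<phi> x + h \<in> \<phi> ` U \<longrightarrow>
        \<bar>nrm F0' (f' (\<phi> x + h) - f' (\<phi> x) - A' h) / nrm E1' h\<bar> < e"
    proof (intro exI conjI ballI impI)
      show "d > 0" by fact
      fix k assume k: "k \<in> car E1'" "k \<noteq> 0 \<and> nrm E1' k < d \<and> \<phi> x + k \<in> \<phi> ` U"
      then obtain h where h: "h \<in> car E1" "k = \<phi> h" using c1 by auto
      show "\<bar>nrm F0' (f' (\<phi> x + k) - f' (\<phi> x) - A' k) / nrm E1' k\<bar> < e"
        using key[OF h(1)] k d(2) h by simp
    qed
  qed
qed

definition sc_normed :: "'a::real_vector sc_space \<Rightarrow> bool" where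
  "sc_normed E \<longleftrightarrow> (\<forall>m. normed (E m) \<and> car (E (Suc m)) \<subseteq> car (E m))"

definition sc_isometry :: "'a::real_vector sc_space \<Rightarrow> 'b::real_vector sc_space \<Rightarrow> ('a \<Rightarrow> 'b) \<Rightarrow> bool" where
  "sc_isometry E E' \<phi> \<longleftrightarrow> (\<forall>m. lin_isometry (E m) (E' m) \<phi>)"

lemma sc_normed_car: "sc_normed E \<Longrightarrow> car (E m) \<subseteq> car (E 0)"
  by (induction m) (auto simp: sc_normed_def)

lemma sc_normed_tangent: "sc_normed E \<Longrightarrow> sc_normed (tangent E)"
  unfolding sc_normed_def tangent_def sc_sum_def sc_shift_def
  by (auto intro: normed_nsum) (auto simp: nsum_def)

lemma sc_isometry_tangent: "sc_isometry E E' \<phi> \<Longrightarrow> sc_isometry (tangent E) (tangent E') (map_prod \<phi> \<phi>)"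
  unfolding sc_isometry_def tangent_def sc_sum_def sc_shift_def by (simp add: lin_isometry_nsum)

lemma sc_isometry_comp: "sc_isometry E F \<phi> \<Longrightarrow> sc_isometry F G \<psi> \<Longrightarrow> sc_isometry E G (\<psi> \<circ> \<phi>)"
  unfolding sc_isometry_def using lin_isometry_comp by blast

lemma sc_isometry_leaf: "sc_isometry E (nimage leaf \<circ> E) leaf"
  and sc_isometry_unleaf: "sc_isometry (nimage leaf \<circ> E) E unleaf"
  by (simp_all add: sc_isometry_def lin_isometry_nimage lin_isometry_nimage_inv
        linear_leaf inj_leaf unleaf_linear)

lemma sc_isometry_node: "sc_isometry E (nimage node \<circ> E) node"
  and sc_isometry_unnode: "sc_isometry (nimage node \<circ> E) E unnode"
  by (simp_all add: sc_isometry_def lin_isometry_nimage lin_isometry_nimage_inv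
        linear_node inj_node unnode_linear)

lemma sc_isometry_inj: "sc_isometry E E' \<phi> \<Longrightarrow> inj_on \<phi> (car (E 0))"
  by (auto simp: sc_isometry_def lin_isometry_def bij_betw_def)

lemma sc_isometry_car: "sc_isometry E E' \<phi> \<Longrightarrow> car (E' m) = \<phi> ` car (E m)"
  by (auto simp: sc_isometry_def lin_isometry_def bij_betw_def)

lemma sc_normed_isometry:
  assumes i: "sc_isometry E E' \<phi>" and n: "sc_normed E" shows "sc_normed E'"
  unfolding sc_normed_def
proof (intro allI conjI)
  fix m
  show "normed (E' m)" using i n lin_isometry_normed unfolding sc_normed_def sc_isometry_def by blast
  show "car (E' (Suc m)) \<subseteq> car (E' m)"
    unfolding sc_isometry_car[OF i] using n by (auto simp: sc_normed_def)
qed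

lemma sc_isometry_sc0_map:
  assumes i: "sc_isometry E E' \<phi>" "sc_isometry F F' \<psi>" and n: "sc_normed E" "sc_normed F"
    and U: "U \<subseteq> car (E 0)" and f': "\<And>x. x \<in> U \<Longrightarrow> f' (\<phi> x) = \<psi> (f x)"
    and f: "sc0_map E U F f"
  shows "sc0_map E' (\<phi> ` U) F' f'"
  unfolding sc0_map_def
proof
  fix m
  define g where "g = inv_into (car (E m)) \<phi>"
  have nE: "normed (E m)" "normed (E' m)" and nF: "normed (F m)" 
    using n sc_normed_isometry[OF i(1) n(1)] by (auto simp: sc_normed_def)
  have iE: "lin_isometry (E m) (E' m) \<phi>" and iF: "lin_isometry (F m) (F' m) \<psi>"
    using i by (auto simp: sc_isometry_def)
  have inj: "inj_on \<phi> (car (E 0))" using sc_isometry_inj[OF i(1)] .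
  have g: "g (\<phi> x) = x" if "x \<in> car (E m)" for x
    unfolding g_def using inj_on_subset[OF inj sc_normed_car[OF n(1)]] that by simp
  have gU: "x \<in> car (E m) \<and> x \<in> U" if x: "x \<in> U" "\<phi> x \<in> car (E' m)" for x
  proof -
    obtain y where y: "y \<in> car (E m)" "\<phi> x = \<phi> y" using x(2) sc_isometry_car[OF i(1)] by auto
    then have "x = y" using inj_onD[OF inj y(2)] x(1) U sc_normed_car[OF n(1)] by blast
    with y x show ?thesis by simp
  qed
  have "continuous_map (ntop (E' m)) (ntop (E m)) g"
    unfolding g_def using lin_isometry_homeo[OF lin_isometry_inv[OF iE nE(1)] nE(2)]
    by (rule homeomorphic_imp_continuous_map)
  then have 1: "continuous_map (subtopology (ntop (E' m)) (\<phi> ` U)) (subtopology (ntop (E m)) U) g"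
    by (auto simp: continuous_map_in_subtopology topspace_ntop[OF nE(2)] g gU
        intro: continuous_map_from_subtopology)
  have 2: "continuous_map (subtopology (ntop (E m)) U) (ntop (F m)) f"
    using f by (simp add: sc0_map_def)
  have 3: "continuous_map (ntop (F m)) (ntop (F' m)) \<psi>"
    using lin_isometry_homeo[OF iF nF] by (rule homeomorphic_imp_continuous_map)
  show "continuous_map (subtopology (ntop (E' m)) (\<phi> ` U)) (ntop (F' m)) f'"
  proof (rule continuous_map_eq[OF continuous_map_compose[OF 1 continuous_map_compose[OF 2 3]]])
    fix y assume "y \<in> topspace (subtopology (ntop (E' m)) (\<phi> ` U))"
    then obtain x where "x \<in> U" "y = \<phi> x" "\<phi> x \<in> car (E' m)" by (auto simp: topspace_ntop[OF nE(2)])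
    then show "(\<psi> \<circ> f \<circ> g) y = f' y" using gU g f' by auto
  qed
qed

lemma sc0_map_in:
  assumes "sc0_map E U F f" "sc_normed E" "sc_normed F" "U \<subseteq> car (E 0)"
  shows "f \<in> U \<rightarrow> car (F 0)"
proof -
  have "continuous_map (subtopology (ntop (E 0)) U) (ntop (F 0)) f" using assms(1) by (simp add: sc0_map_def)
  moreover have "normed (E 0)" "normed (F 0)" using assms(2,3) by (auto simp: sc_normed_def)
  ultimately show ?thesis
    using assms(4) by (auto simp: continuous_map_def topspace_ntop Pi_iff)
qed

lemma lin_isometry_bounded_lin_map:
  assumes i: "lin_isometry V V' \<phi>" "lin_isometry W W' \<psi>" and n: "normed V" "normed W"
    and A: "bounded_lin_map V W A" and A': "\<And>h. h \<in> car V \<Longrightarrow> A' (\<phi> h) = \<psi> (A h)"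
  shows "bounded_lin_map V' W' A'"
proof -
  have lA: "lin_map V W A" using A by (simp add: bounded_lin_map_def)
  obtain K where K: "\<And>x. x \<in> car V \<Longrightarrow> nrm W (A x) \<le> K * nrm V x" using A by (auto simp: bounded_lin_map_def)
  have lf: "lin_map V V' \<phi>" and c: "car V' = \<phi> ` car V" and nf: "\<And>x. x \<in> car V \<Longrightarrow> nrm V' (\<phi> x) = nrm V x"
    using i(1) by (auto simp: lin_isometry_def bij_betw_def)
  have lg: "lin_map W W' \<psi>" and ng: "\<And>x. x \<in> car W \<Longrightarrow> nrm W' (\<psi> x) = nrm W x"
    using i(2) by (auto simp: lin_isometry_def bij_betw_def)
  have "lin_map V' W' A'"
    unfolding lin_map_def
  proof (intro conjI funcsetI ballI allI)
    fix y assume "y \<in> car V'"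
    then obtain x where x: "x \<in> car V" "y = \<phi> x" using c by auto
    show "A' y \<in> car W'" using x A' lin_mapD(1)[OF lA] lin_mapD(1)[OF lg] by simp
    show "A' (r *\<^sub>R y) = r *\<^sub>R A' y" for r
      using x A' lin_mapD(1,3)[OF lA] lin_mapD(3)[OF lg] lin_mapD(3)[OF lf, symmetric] normedD(4)[OF n(1)] by simp
    fix y' assume "y' \<in> car V'"
    then obtain x' where x': "x' \<in> car V" "y' = \<phi> x'" using c by auto
    show "A' (y + y') = A' y + A' y'"
      using x x' A' lin_mapD(1,2)[OF lA] lin_mapD(2)[OF lg] lin_mapD(2)[OF lf, symmetric] normedD(2)[OF n(1)] by simp
  qed
  moreover have "nrm W' (A' y) \<le> K * nrm V' y" if "y \<in> car V'" for y
    using that K A' nf ng lin_mapD(1)[OF lA] unfolding c by auto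
  ultimately show ?thesis unfolding bounded_lin_map_def by blast
qed

lemma sc_isometry_sc_derivative:
  assumes i: "sc_isometry E E' \<phi>" "sc_isometry F F' \<psi>" and n: "sc_normed E" "sc_normed F"
    and U: "U \<subseteq> car (E 0)" and f': "\<And>x. x \<in> U \<Longrightarrow> f' (\<phi> x) = \<psi> (f x)"
    and f: "f \<in> U \<rightarrow> car (F 0)" and Df: "sc_derivative E U F f Df"
    and Df': "\<And>x h. x \<in> U \<Longrightarrow> h \<in> car (E 0) \<Longrightarrow> Df' (\<phi> x) (\<phi> h) = \<psi> (Df x h)"
  shows "sc_derivative E' (\<phi> ` U) F' f' Df'"
  unfolding sc_derivative_def
proof
  fix y assume "y \<in> \<phi> ` U \<inter> car (E' 1)"
  then obtain x z where x: "x \<in> U" "y = \<phi> x" and z: "z \<in> car (E 1)" "y = \<phi> z"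
    using sc_isometry_car[OF i(1)] by auto
  have "x = z"
    using inj_onD[OF sc_isometry_inj[OF i(1)], of x z] x z U sc_normed_car[OF n(1)] by blast
  with z have x1: "x \<in> car (E 1)" by simp
  have b: "bounded_lin_map (E 0) (F 0) (Df x)" and fo: "first_order_at (E 1) (F 0) U f x (Df x)"
    using Df x x1 by (auto simp: sc_derivative_def)
  have nn: "normed (E 0)" "normed (E 1)" "normed (F 0)" using n by (auto simp: sc_normed_def)
  have ii: "lin_isometry (E 0) (E' 0) \<phi>" "lin_isometry (E 1) (E' 1) \<phi>" "lin_isometry (F 0) (F' 0) \<psi>"
    using i by (auto simp: sc_isometry_def)
  have D: "Df x \<in> car (E 0) \<rightarrow> car (F 0)" using b by (simp add: bounded_lin_map_def lin_map_def)
  show "bounded_lin_map (E' 0) (F' 0) (Df' y) \<and> first_order_at (E' 1) (F' 0) (\<phi> ` U) f' y (Df' y)"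
    unfolding x(2)
    using lin_isometry_bounded_lin_map[OF ii(1,3) nn(1,3) b Df'[OF x(1)]]
      lin_isometry_first_order_at[OF ii(1,2) sc_normed_car[OF n(1)] nn(1,2) ii(3) nn(3) U x(1) f D f' Df'[OF x(1)] fo]
    by blast
qed

lemma tangent_set_image:
  assumes i: "sc_isometry E E' \<phi>" and n: "sc_normed E" and U: "U \<subseteq> car (E 0)"
  shows "tangent_set E' (\<phi> ` U) = map_prod \<phi> \<phi> ` tangent_set E U"
proof -
  have "\<phi> ` U \<inter> \<phi> ` car (E 1) = \<phi> ` (U \<inter> car (E 1))"
    using inj_on_image_Int[OF sc_isometry_inj[OF i] U sc_normed_car[OF n]] by simp
  then show ?thesis
    unfolding tangent_set_def sc_isometry_car[OF i] by (simp add: map_prod_surj_on)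
qed

lemma tangent_set_subset: "sc_normed E \<Longrightarrow> tangent_set E U \<subseteq> car (tangent E 0)"
  by (auto simp: tangent_set_def tangent_def sc_sum_def sc_shift_def nsum_def)

lemma sc_isometry_sc_map_coded:
  assumes "sc_isometry E E' \<phi>" "sc_isometry F F' \<psi>" "sc_normed E" "sc_normed F"
    and "U \<subseteq> car (E 0)" and "\<And>x. x \<in> U \<Longrightarrow> f' (\<phi> x) = \<psi> (f x)"
    and "sc_map_coded k E U F f"
  shows "sc_map_coded k E' (\<phi> ` U) F' f'"
  using assms
proof (induction k arbitrary: E E' \<phi> F F' \<psi> U f f')
  case 0
  then show ?case using sc_isometry_sc0_map[where f = f and f' = f' and \<phi> = \<phi> and \<psi> = \<psi>, OF 0(1-6)] by simp
next
  case (Suc k)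
  note i = Suc.prems(1,2) and n = Suc.prems(3,4) and U = Suc.prems(5) and f' = Suc.prems(6)
  obtain Df where f0: "sc0_map E U F f" and Df: "sc_derivative E U F f Df"
    and T: "sc_map_coded k (nimage node \<circ> tangent E) (node ` tangent_set E U) (nimage node \<circ> tangent F)
          (node \<circ> tangent_map f Df \<circ> unnode)"
    using Suc.prems(7) by auto
  define g where "g = inv_into (car (E 0)) \<phi>"
  have g: "g (\<phi> x) = x" if "x \<in> car (E 0)" for x
    unfolding g_def using sc_isometry_inj[OF i(1)] that by simp
  define Df' where "Df' = (\<lambda>y h. \<psi> (Df (g y) (g h)))"
  have Df': "Df' (\<phi> x) (\<phi> h) = \<psi> (Df x h)" if "x \<in> U" "h \<in> car (E 0)" for x h
    unfolding Df'_def using g that U by auto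
  have j: "sc_isometry (nimage node \<circ> tangent E) (nimage node \<circ> tangent E') (node \<circ> (map_prod \<phi> \<phi> \<circ> unnode))"
    "sc_isometry (nimage node \<circ> tangent F) (nimage node \<circ> tangent F') (node \<circ> (map_prod \<psi> \<psi> \<circ> unnode))"
    using i by (auto intro!: sc_isometry_comp[OF _ sc_isometry_node] sc_isometry_comp[OF sc_isometry_unnode]
        sc_isometry_tangent)
  have nj: "sc_normed (nimage node \<circ> tangent E)" "sc_normed (nimage node \<circ> tangent F)"
    using sc_normed_isometry[OF sc_isometry_node] sc_normed_tangent n by blast+
  have s: "node ` tangent_set E U \<subseteq> car ((nimage node \<circ> tangent E) 0)"
    using tangent_set_subset[OF n(1)] sc_isometry_car[OF sc_isometry_node] by blast
  have "sc_map_coded k (nimage node \<circ> tangent E') ((node \<circ> (map_prod \<phi> \<phi> \<circ> unnode)) ` (node ` tangent_set E U))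
     (nimage node \<circ> tangent F') (node \<circ> tangent_map f' Df' \<circ> unnode)"
    using f' Df' by (intro Suc.IH[OF j nj s _ T]) (auto simp: tangent_set_def tangent_map_def)
  moreover have "(node \<circ> (map_prod \<phi> \<phi> \<circ> unnode)) ` (node ` tangent_set E U) = node ` tangent_set E' (\<phi> ` U)"
    unfolding tangent_set_image[OF i(1) n(1) U] image_image by simp
  ultimately show ?case
    using sc_isometry_sc0_map[where f = f and f' = f' and \<phi> = \<phi> and \<psi> = \<psi>, OF i n U f' f0]
      sc_isometry_sc_derivative[where f = f and f' = f' and \<phi> = \<phi> and \<psi> = \<psi> and Df = Df and Df' = Df',
        OF i n U f' sc0_map_in[OF f0 n U] Df Df'] by auto
qed

lemma sc_map_0:
  fixes E :: "'a::real_vector sc_space" and F :: "'b::real_vector sc_space"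
  assumes n: "sc_normed E" "sc_normed F" and U: "U \<subseteq> car (E 0)"
  shows "sc_map 0 E U F f \<longleftrightarrow> sc0_map E U F f"
proof -
  let ?E = "nimage leaf \<circ> E :: (bool list \<Rightarrow> 'a) sc_space" and ?F = "nimage leaf \<circ> F :: (bool list \<Rightarrow> 'b) sc_space"
    and ?U = "leaf ` U :: (bool list \<Rightarrow> 'a) set" and ?f = "leaf \<circ> f \<circ> unleaf :: (bool list \<Rightarrow> 'a) \<Rightarrow> bool list \<Rightarrow> 'b"
  have nj: "sc_normed ?E" "sc_normed ?F"
    using sc_normed_isometry[OF sc_isometry_leaf] n by blast+
  have s: "?U \<subseteq> car (?E 0)"
    using U sc_isometry_car[OF sc_isometry_leaf] by blast
  have uU: "unleaf ` ?U = U" by (simp add: image_image)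
  have "sc0_map E (unleaf ` ?U) F f" if "sc0_map ?E ?U ?F ?f"
    by (rule sc_isometry_sc0_map[OF sc_isometry_unleaf sc_isometry_unleaf nj s _ that]) auto
  moreover have "sc0_map ?E ?U ?F ?f" if "sc0_map E U F f"
    by (rule sc_isometry_sc0_map[OF sc_isometry_leaf sc_isometry_leaf n U _ that]) auto
  ultimately show ?thesis unfolding sc_map_def uU by auto
qed

lemma sc_map_Suc:
  fixes E :: "'a::real_vector sc_space" and F :: "'b::real_vector sc_space"
  assumes n: "sc_normed E" "sc_normed F" and U: "U \<subseteq> car (E 0)"
  shows "sc_map (Suc k) E U F f \<longleftrightarrow> sc0_map E U F f \<and>
    (\<exists>Df. sc_derivative E U F f Df \<and> sc_map k (tangent E) (tangent_set E U) (tangent F) (tangent_map f Df))"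
proof -
  let ?E = "nimage leaf \<circ> E :: (bool list \<Rightarrow> 'a) sc_space" and ?F = "nimage leaf \<circ> F :: (bool list \<Rightarrow> 'b) sc_space"
    and ?U = "leaf ` U :: (bool list \<Rightarrow> 'a) set" and ?f = "leaf \<circ> f \<circ> unleaf :: (bool list \<Rightarrow> 'a) \<Rightarrow> bool list \<Rightarrow> 'b"
  have nj: "sc_normed ?E" "sc_normed ?F"
    using sc_normed_isometry[OF sc_isometry_leaf] n by blast+
  have s: "?U \<subseteq> car (?E 0)"
    using U sc_isometry_car[OF sc_isometry_leaf] by blast
  have f0: "sc0_map ?E ?U ?F ?f \<longleftrightarrow> sc0_map E U F f"
    using sc_map_0[OF n U, of f] by (simp add: sc_map_def)
  have uU: "unleaf ` ?U = U" by (simp add: image_image)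
  let ?TE = "nimage leaf \<circ> tangent E :: (bool list \<Rightarrow> 'a \<times> 'a) sc_space"
    and ?TF = "nimage leaf \<circ> tangent F :: (bool list \<Rightarrow> 'b \<times> 'b) sc_space"
    and ?TU = "leaf ` tangent_set E U :: (bool list \<Rightarrow> 'a \<times> 'a) set"
  have *: "sc_map_coded k ?TE ?TU ?TF
          (leaf \<circ> tangent_map f Df \<circ> unleaf)"
    if T: "sc_map_coded k (nimage node \<circ> tangent ?E) (node ` tangent_set ?E ?U) (nimage node \<circ> tangent ?F)
          (node \<circ> tangent_map ?f Df1 \<circ> unnode)"
      and D: "\<And>x h. x \<in> U \<Longrightarrow> h \<in> car (E 0) \<Longrightarrow> Df x h = unleaf (Df1 (leaf x) (leaf h))"
    for Df Df1
  proof -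
    let ?c = "leaf \<circ> (map_prod unleaf unleaf \<circ> unnode)"
    have j: "sc_isometry (nimage node \<circ> tangent ?E) ?TE ?c"
      "sc_isometry (nimage node \<circ> tangent ?F) ?TF ?c"
      by (intro sc_isometry_comp[OF _ sc_isometry_leaf] sc_isometry_comp[OF sc_isometry_unnode]
        sc_isometry_tangent sc_isometry_unleaf)+
    have nt: "sc_normed (nimage node \<circ> tangent ?E)" "sc_normed (nimage node \<circ> tangent ?F)"
      using sc_normed_isometry[OF sc_isometry_node] sc_normed_tangent nj by blast+
    have st: "node ` tangent_set ?E ?U \<subseteq> car ((nimage node \<circ> tangent ?E) 0)"
      using tangent_set_subset[OF nj(1)] sc_isometry_car[OF sc_isometry_node] by blast
    have "sc_map_coded k ?TE (?c ` (node ` tangent_set ?E ?U))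
       ?TF (leaf \<circ> tangent_map f Df \<circ> unleaf)"
      using D by (intro sc_isometry_sc_map_coded[OF j nt st _ T])
        (auto simp: tangent_set_def tangent_map_def nimage_def inj_eq[OF inj_leaf])
    moreover have "?c ` (node ` tangent_set ?E ?U) = ?TU"
      unfolding tangent_set_image[OF sc_isometry_unleaf nj(1) s, unfolded uU] by (simp add: image_image)
    ultimately show ?thesis by (simp only:)
  qed
  have **: "sc_map_coded k (nimage node \<circ> tangent ?E) (node ` tangent_set ?E ?U) (nimage node \<circ> tangent ?F)
          (node \<circ> tangent_map ?f Df1 \<circ> unnode)"
    if T: "sc_map_coded k ?TE ?TU ?TF
          (leaf \<circ> tangent_map f Df \<circ> unleaf)"
      and D: "\<And>x h. x \<in> U \<Longrightarrow> h \<in> car (E 0) \<Longrightarrow> Df1 (leaf x) (leaf h) = leaf (Df x h)"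
    for Df Df1
  proof -
    let ?c = "node \<circ> (map_prod leaf leaf \<circ> unleaf)"
    have j: "sc_isometry ?TE (nimage node \<circ> tangent ?E) ?c"
      "sc_isometry ?TF (nimage node \<circ> tangent ?F) ?c"
      by (intro sc_isometry_comp[OF _ sc_isometry_node] sc_isometry_comp[OF sc_isometry_unleaf]
        sc_isometry_tangent sc_isometry_leaf)+
    have nt: "sc_normed ?TE" "sc_normed ?TF"
      using sc_normed_isometry[OF sc_isometry_leaf] sc_normed_tangent n by blast+
    have st: "?TU \<subseteq> car (?TE 0)"
      using tangent_set_subset[OF n(1)] sc_isometry_car[OF sc_isometry_leaf] by blast
    have "sc_map_coded k (nimage node \<circ> tangent ?E) (?c ` ?TU) (nimage node \<circ> tangent ?F)
          (node \<circ> tangent_map ?f Df1 \<circ> unnode)"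
      using D by (intro sc_isometry_sc_map_coded[OF j nt st _ T]) (auto simp: tangent_set_def tangent_map_def)
    moreover have "?c ` ?TU = node ` tangent_set ?E ?U"
      unfolding tangent_set_image[OF sc_isometry_leaf n(1) U] by (simp add: image_image)
    ultimately show ?thesis by simp
  qed
  show ?thesis
  proof
    assume "sc_map (Suc k) E U F f"
    then obtain Df1 where 0: "sc0_map ?E ?U ?F ?f" and D1: "sc_derivative ?E ?U ?F ?f Df1"
      and T: "sc_map_coded k (nimage node \<circ> tangent ?E) (node ` tangent_set ?E ?U) (nimage node \<circ> tangent ?F)
          (node \<circ> tangent_map ?f Df1 \<circ> unnode)"
      unfolding sc_map_def by auto
    define Df where "Df = (\<lambda>x h. unleaf (Df1 (leaf x) (leaf h)))"
    have "sc_derivative E (unleaf ` ?U) F f Df"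
      by (intro sc_isometry_sc_derivative[OF sc_isometry_unleaf sc_isometry_unleaf nj s _ sc0_map_in[OF 0 nj s] D1])
        (auto simp: Df_def nimage_def)
    then show "sc0_map E U F f \<and>
       (\<exists>Df. sc_derivative E U F f Df \<and> sc_map k (tangent E) (tangent_set E U) (tangent F) (tangent_map f Df))"
      using 0 f0 *[OF T, of Df] uU unfolding sc_map_def by (auto simp: Df_def)
  next
    assume "sc0_map E U F f \<and>
       (\<exists>Df. sc_derivative E U F f Df \<and> sc_map k (tangent E) (tangent_set E U) (tangent F) (tangent_map f Df))"
    then obtain Df where 0: "sc0_map E U F f" and D: "sc_derivative E U F f Df"
      and T: "sc_map_coded k ?TE ?TU ?TF
          (leaf \<circ> tangent_map f Df \<circ> unleaf)"
      unfolding sc_map_def by blast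
    define Df1 where "Df1 = (\<lambda>(x :: bool list \<Rightarrow> 'a) (h :: bool list \<Rightarrow> 'a). leaf (Df (unleaf x) (unleaf h)) :: bool list \<Rightarrow> 'b)"
    have "sc_derivative ?E ?U ?F ?f Df1"
      by (intro sc_isometry_sc_derivative[OF sc_isometry_leaf sc_isometry_leaf n U _ sc0_map_in[OF 0 n U] D])
        (auto simp: Df1_def)
    then show "sc_map (Suc k) E U F f"
      using 0 f0 **[OF T, of Df1] unfolding sc_map_def by (auto simp: Df1_def)
  qed
qed

lemma sc_banach_imp_sc_normed: "sc_banach E \<Longrightarrow> sc_normed E"
  by (simp add: sc_banach_def sc_normed_def banach_space_def)

lemma op_space_bound:
  assumes "bounded_lin_map V W A" and V: "normed V" and W: "normed W"
  shows "bdd_above ((\<lambda>x. nrm W (A x)) ` {x \<in> car V. nrm V x \<le> 1})"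
proof -
  obtain K where K: "\<And>x. x \<in> car V \<Longrightarrow> nrm W (A x) \<le> K * nrm V x" using assms(1) by (auto simp: bounded_lin_map_def)
  have "nrm W (A x) \<le> \<bar>K\<bar>" if x: "x \<in> car V" "nrm V x \<le> 1" for x
  proof -
    have "K * nrm V x \<le> \<bar>K\<bar> * 1"
      using x normedD(5)[OF V x(1)] by (intro mult_mono) auto
    then show ?thesis using K[OF x(1)] by simp
  qed
  then show ?thesis by (auto intro!: bdd_aboveI[of _ "\<bar>K\<bar>"])
qed

lemma op_space_nrm_ub:
  assumes A: "A \<in> car (op_space V W)" and V: "normed V" and W: "normed W" and x: "x \<in> car V" "nrm V x \<le> 1"
  shows "nrm W (A x) \<le> nrm (op_space V W) A"
  unfolding op_space_def nspace.simps using A x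
  by (intro cSUP_upper op_space_bound V W) (auto simp: op_space_def)

lemma op_space_nrm_le:
  assumes V: "normed V" and "\<And>x. x \<in> car V \<Longrightarrow> nrm V x \<le> 1 \<Longrightarrow> nrm W (A x) \<le> B"
  shows "nrm (op_space V W) A \<le> B"
proof -
  have "0 \<in> {x \<in> car V. nrm V x \<le> 1}" using normedD(1,6)[OF V] by force
  then show ?thesis
    unfolding op_space_def nspace.simps using assms(2) by (intro cSUP_least) auto
qed

lemma bounded_lin_map_add:
  assumes "bounded_lin_map V W A" "bounded_lin_map V W B" "normed W"
  shows "bounded_lin_map V W (\<lambda>x. A x + B x)"
proof -
  have l: "lin_map V W A" "lin_map V W B" using assms by (auto simp: bounded_lin_map_def)
  obtain K L where K: "\<And>x. x \<in> car V \<Longrightarrow> nrm W (A x) \<le> K * nrm V x"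
    "\<And>x. x \<in> car V \<Longrightarrow> nrm W (B x) \<le> L * nrm V x" using assms(1,2) by (auto simp: bounded_lin_map_def)
  have "nrm W (A x + B x) \<le> (K + L) * nrm V x" if "x \<in> car V" for x
    using normedD(8)[OF assms(3) lin_mapD(1)[OF l(1) that] lin_mapD(1)[OF l(2) that]] K(1)[OF that] K(2)[OF that]
    by (simp add: distrib_right)
  moreover have "lin_map V W (\<lambda>x. A x + B x)"
    unfolding lin_map_def
    using lin_mapD[OF l(1)] lin_mapD[OF l(2)] normedD(2)[OF assms(3)] by (auto simp: scaleR_add_right)
  ultimately show ?thesis unfolding bounded_lin_map_def by blast
qed

lemma bounded_lin_map_scale:
  assumes "bounded_lin_map V W A" "normed W"
  shows "bounded_lin_map V W (\<lambda>x. c *\<^sub>R A x)"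
proof -
  have l: "lin_map V W A" using assms by (auto simp: bounded_lin_map_def)
  obtain K where K: "\<And>x. x \<in> car V \<Longrightarrow> nrm W (A x) \<le> K * nrm V x"
    using assms(1) by (auto simp: bounded_lin_map_def)
  have "nrm W (c *\<^sub>R A x) \<le> (\<bar>c\<bar> * K) * nrm V x" if "x \<in> car V" for x
    using normedD(7)[OF assms(2) lin_mapD(1)[OF l that]] mult_left_mono[OF K[OF that], of "\<bar>c\<bar>"]
    by (simp add: mult.assoc)
  moreover have "lin_map V W (\<lambda>x. c *\<^sub>R A x)"
    unfolding lin_map_def
    using lin_mapD[OF l] normedD(4)[OF assms(2)] by (auto simp: scaleR_add_right)
  ultimately show ?thesis unfolding bounded_lin_map_def by blast
qed

lemma normed_op_space:
  assumes V: "normed V" and W: "normed W"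
  shows "normed (op_space V W)"
proof -
  let ?L = "op_space V W"
  have 0: "nrm W 0 = 0" "0 \<in> car W" using normedD(1,6)[OF W] by auto
  have mem: "A \<in> car ?L \<longleftrightarrow> bounded_lin_map V W A \<and> (\<forall>x. x \<notin> car V \<longrightarrow> A x = 0)" for A
    by (simp add: op_space_def)
  have im: "A x \<in> car W" if "A \<in> car ?L" "x \<in> car V" for A x
    using that by (auto simp: mem bounded_lin_map_def lin_map_def)
  have s: "subspace (car ?L)"
    unfolding subspace_def
  proof (intro conjI ballI allI)
    have "bounded_lin_map V W (\<lambda>x. 0)"
      unfolding bounded_lin_map_def lin_map_def by (auto simp: 0 intro!: exI[of _ 0])
    then show "0 \<in> car ?L" by (simp add: mem zero_fun_def)
    fix A assume A: "A \<in> car ?L"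
    then show "c *\<^sub>R A \<in> car ?L" for c
      by (simp add: mem scaleR_fun_def bounded_lin_map_scale W)
    fix B assume "B \<in> car ?L"
    with A show "A + B \<in> car ?L"
      by (simp add: mem plus_fun_def bounded_lin_map_add W)
  qed
  have zero: "0 \<in> car V" "nrm V 0 \<le> 1"
    using normedD(1)[OF V] normedD(6)[OF V normedD(1)[OF V]] by auto
  have nn: "0 \<le> nrm ?L A" if "A \<in> car ?L" for A
    using op_space_nrm_ub[OF that V W zero] normedD(5)[OF W im[OF that zero(1)]] by linarith
  have def0: "A = 0" if A: "A \<in> car ?L" and z: "nrm ?L A = 0" for A
  proof
    fix x show "A x = 0 x"
    proof (cases "x \<in> car V \<and> x \<noteq> 0")
      case True
      then have p: "nrm V x > 0" using normedD(5,6)[OF V, of x] by linarith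
      let ?y = "(1 / nrm V x) *\<^sub>R x"
      have y: "?y \<in> car V" using True normedD(4)[OF V] by blast
      have "nrm V ?y = 1" using True p normedD(7)[OF V, of x] by simp
      then have "nrm W (A ?y) \<le> 0" using op_space_nrm_ub[OF A V W y] z by simp
      then have "A ?y = 0" using normedD(5,6)[OF W im[OF A y]] by linarith
      moreover have "A ?y = (1 / nrm V x) *\<^sub>R A x"
        using A True by (auto simp: mem bounded_lin_map_def lin_map_def)
      ultimately show ?thesis using p by simp
    next
      case False
      have "lin_map V W A" using A by (simp add: mem bounded_lin_map_def)
      then show ?thesis using False A lin_map_0[OF _ V] by (auto simp: mem)
    qed
  qed
  have nz: "nrm ?L 0 = 0"
    using op_space_nrm_le[OF V, where W = W and A = 0 and B = 0] nn[OF subspace_0[OF s]] 0 by (simp add: zero_fun_def)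
  have sc_le: "nrm ?L (c *\<^sub>R A) \<le> \<bar>c\<bar> * nrm ?L A" if A: "A \<in> car ?L" for c A
  proof (rule op_space_nrm_le[OF V])
    fix x assume x: "x \<in> car V" "nrm V x \<le> 1"
    show "nrm W ((c *\<^sub>R A) x) \<le> \<bar>c\<bar> * nrm ?L A"
      using op_space_nrm_ub[OF A V W x] normedD(7)[OF W im[OF A x(1)]]
      by (simp add: scaleR_fun_def mult_left_mono)
  qed
  have sc: "nrm ?L (c *\<^sub>R A) = \<bar>c\<bar> * nrm ?L A" if A: "A \<in> car ?L" for c A
  proof (cases "c = 0")
    case False
    have "nrm ?L ((1 / c) *\<^sub>R (c *\<^sub>R A)) \<le> \<bar>1 / c\<bar> * nrm ?L (c *\<^sub>R A)"
      using sc_le subspace_scale[OF s A] by blast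
    then have "\<bar>c\<bar> * nrm ?L A \<le> nrm ?L (c *\<^sub>R A)"
      using False by (simp add: field_simps)
    then show ?thesis using sc_le[OF A, of c] by linarith
  qed (simp add: nz)
  have tri: "nrm ?L (A + B) \<le> nrm ?L A + nrm ?L B" if A: "A \<in> car ?L" and B: "B \<in> car ?L" for A B
  proof (rule op_space_nrm_le[OF V])
    fix x assume x: "x \<in> car V" "nrm V x \<le> 1"
    show "nrm W ((A + B) x) \<le> nrm ?L A + nrm ?L B"
      using op_space_nrm_ub[OF A V W x] op_space_nrm_ub[OF B V W x]
        normedD(8)[OF W im[OF A x(1)] im[OF B x(1)]] by (simp add: plus_fun_def)
  qed
  show ?thesis
    unfolding normed_def using s nn def0 nz sc tri by blast
qed

definition push_op :: "'a::real_vector nspace \<Rightarrow> ('b::real_vector \<Rightarrow> 'c::real_vector) \<Rightarrow> ('a \<Rightarrow> 'b) \<Rightarrow> 'a \<Rightarrow> 'c" where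
  "push_op V \<psi> A = (\<lambda>h. if h \<in> car V then \<psi> (A h) else 0)"

lemma lin_isometry_id: "lin_isometry V V (\<lambda>x. x)"
  by (auto simp: lin_isometry_def lin_map_def bij_betw_def)

lemma push_op_in:
  assumes "lin_isometry W W' \<psi>" "normed V" "normed W" "A \<in> car (op_space V W)"
  shows "push_op V \<psi> A \<in> car (op_space V W')"
  using lin_isometry_bounded_lin_map[OF lin_isometry_id assms(1-3), of A "push_op V \<psi> A"] assms(4)
  by (simp add: op_space_def push_op_def)

lemma lin_isometry_op_space:
  assumes i: "lin_isometry W W' \<psi>" and V: "normed V" and W: "normed W"
  shows "lin_isometry (op_space V W) (op_space V W') (push_op V \<psi>)"
proof -
  let ?g = "inv_into (car W) \<psi>"
  have i': "lin_isometry W' W ?g" and W': "normed W'"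
    using lin_isometry_inv[OF i W] lin_isometry_normed[OF i W] .
  have l: "lin_map W W' \<psi>" and nr: "\<And>x. x \<in> car W \<Longrightarrow> nrm W' (\<psi> x) = nrm W x"
    and bij: "bij_betw \<psi> (car W) (car W')"
    using i by (auto simp: lin_isometry_def)
  have im: "A x \<in> car Z" if "A \<in> car (op_space V Z)" "x \<in> car V" for A x and Z :: "'z::real_vector nspace"
    using that by (auto simp: op_space_def bounded_lin_map_def lin_map_def)
  have out: "A x = 0" if "A \<in> car (op_space V Z)" "x \<notin> car V" for A x and Z :: "'z::real_vector nspace"
    using that by (auto simp: op_space_def)
  have "bij_betw (push_op V \<psi>) (car (op_space V W)) (car (op_space V W'))"
  proof (rule bij_betw_byWitness[where f' = "push_op V ?g"])
    show "\<forall>A\<in>car (op_space V W). push_op V ?g (push_op V \<psi> A) = A"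
      using im out bij bij_betw_inv_into_left[OF bij] by (fastforce simp: push_op_def)
    show "\<forall>A\<in>car (op_space V W'). push_op V \<psi> (push_op V ?g A) = A"
      using im out bij_betw_inv_into_right[OF bij] by (fastforce simp: push_op_def)
    show "push_op V \<psi> ` car (op_space V W) \<subseteq> car (op_space V W')"
      using push_op_in[OF i V W] by blast
    show "push_op V ?g ` car (op_space V W') \<subseteq> car (op_space V W)"
      using push_op_in[OF i' V W'] by blast
  qed
  moreover have "lin_map (op_space V W) (op_space V W') (push_op V \<psi>)"
    unfolding lin_map_def
  proof (intro conjI funcsetI ballI allI)
    fix A assume A: "A \<in> car (op_space V W)"
    show "push_op V \<psi> A \<in> car (op_space V W')" using push_op_in[OF i V W A] .
    show "push_op V \<psi> (c *\<^sub>R A) = c *\<^sub>R push_op V \<psi> A" for c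
      using lin_mapD(3)[OF l im[OF A]] by (auto simp: push_op_def scaleR_fun_def)
    fix B assume B: "B \<in> car (op_space V W)"
    show "push_op V \<psi> (A + B) = push_op V \<psi> A + push_op V \<psi> B"
      using lin_mapD(2)[OF l im[OF A] im[OF B]] by (auto simp: push_op_def plus_fun_def)
  qed
  moreover have "nrm (op_space V W') (push_op V \<psi> A) = nrm (op_space V W) A" if A: "A \<in> car (op_space V W)" for A
    unfolding op_space_def nspace.simps
    by (rule SUP_cong) (auto simp: push_op_def nr im[OF A])
  ultimately show ?thesis unfolding lin_isometry_def by blast
qed

definition curry_op :: "('a list \<Rightarrow> 'b) \<Rightarrow> 'a \<Rightarrow> 'a list \<Rightarrow> 'b" where
  "curry_op z = (\<lambda>h v. z (h # v))"

lemma lin_isometry_uncurry_op: "lin_isometry V (nimage uncurry_op V) uncurry_op"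
  by (rule lin_isometry_nimage[OF linear_uncurry_op inj_uncurry_op])

lemma curry_uncurry_op [simp]: "curry_op (uncurry_op A) = A"
  by (simp add: curry_op_def uncurry_op_def)

lemma lin_isometry_curry_op: "lin_isometry (nimage uncurry_op V) V curry_op"
proof (rule lin_isometry_nimage_inv[OF linear_uncurry_op])
  show "linear curry_op" by (auto simp: linear_iff curry_op_def fun_eq_iff scaleR_fun_def)
qed simp

lemma lin_isometry_c0_map:
  assumes i: "lin_isometry W W' \<psi>" and n: "normed V" "normed W"
    and f': "\<And>x. x \<in> U \<Longrightarrow> f' x = \<psi> (f x)" and f: "c0_map V U W f"
  shows "c0_map V U W' f'"
  unfolding c0_map_def
proof (rule continuous_map_eq[OF continuous_map_compose])
  show "continuous_map (subtopology (ntop V) U) (ntop W) f" using f by (simp add: c0_map_def)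
  show "continuous_map (ntop W) (ntop W') \<psi>"
    using lin_isometry_homeo[OF i n(2)] by (rule homeomorphic_imp_continuous_map)
qed (auto simp: f')

lemma lin_isometry_frechet_derivative_on:
  assumes i: "lin_isometry W W' \<psi>" and n: "normed V" "normed W" and U: "U \<subseteq> car V"
    and f: "f \<in> U \<rightarrow> car W"
    and f': "\<And>x. x \<in> U \<Longrightarrow> f' x = \<psi> (f x)" and D: "frechet_derivative_on V U W f Df"
    and Df': "\<And>x. x \<in> U \<Longrightarrow> Df' x = push_op V \<psi> (Df x)"
  shows "frechet_derivative_on V U W' f' Df'"
  unfolding frechet_derivative_on_def
proof (intro ballI conjI)
  fix x assume x: "x \<in> U"
  have Dx: "Df x \<in> car (op_space V W)" "first_order_at V W U f x (Df x)"
    using D x by (auto simp: frechet_derivative_on_def)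
  show "Df' x \<in> car (op_space V W')" using push_op_in[OF i n Dx(1)] Df' x by simp
  have im: "Df x \<in> car V \<rightarrow> car W" using Dx(1) by (auto simp: op_space_def bounded_lin_map_def lin_map_def)
  have "first_order_at V W' ((\<lambda>x. x) ` U) f' x (Df' x)"
    by (rule lin_isometry_first_order_at[OF lin_isometry_id lin_isometry_id order_refl n(1,1) i n(2) U x f im f' _ Dx(2)])
      (auto simp: Df'[OF x] push_op_def)
  then show "first_order_at V W' U f' x (Df' x)" by simp
qed

lemma c0_map_in:
  assumes "c0_map V U W f" "normed V" "normed W" "U \<subseteq> car V"
  shows "f \<in> U \<rightarrow> car W"
  using assms by (auto simp: c0_map_def continuous_map_def topspace_ntop Pi_iff)

lemma lin_isometry_c_map_coded:
  assumes "lin_isometry W W' \<psi>" "normed V" "normed W" "U \<subseteq> car V"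
    and "\<And>x. x \<in> U \<Longrightarrow> f' x = \<psi> (f x)" and "c_map_coded l V U W f"
  shows "c_map_coded l V U W' f'"
  using assms
proof (induction l arbitrary: W W' \<psi> f f')
  case 0
  then show ?case using lin_isometry_c0_map[where f = f and f' = f' and \<psi> = \<psi>, OF 0(1-3,5)] by simp
next
  case (Suc l)
  note i = Suc.prems(1) and n = Suc.prems(2,3) and U = Suc.prems(4) and f' = Suc.prems(5)
  obtain Df where f0: "c0_map V U W f" and Df: "frechet_derivative_on V U W f Df"
    and T: "c_map_coded l V U (nimage uncurry_op (op_space V W)) (uncurry_op \<circ> Df)"
    using Suc.prems(6) by auto
  define Df' where "Df' = (\<lambda>x. push_op V \<psi> (Df x))"
  have j: "lin_isometry (nimage uncurry_op (op_space V W)) (nimage uncurry_op (op_space V W'))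
      (uncurry_op \<circ> (push_op V \<psi> \<circ> curry_op))"
    by (intro lin_isometry_comp[OF _ lin_isometry_uncurry_op] lin_isometry_comp[OF lin_isometry_curry_op]
        lin_isometry_op_space i n)
  have "c_map_coded l V U (nimage uncurry_op (op_space V W')) (uncurry_op \<circ> Df')"
    by (rule Suc.IH[OF j n(1) lin_isometry_normed[OF lin_isometry_uncurry_op normed_op_space[OF n]] U _ T])
      (simp add: Df'_def)
  moreover have "frechet_derivative_on V U W' f' Df'"
    by (rule lin_isometry_frechet_derivative_on[OF i n U c0_map_in[OF f0 n U] f' Df]) (simp_all add: Df'_def)
  ultimately show ?case
    using lin_isometry_c0_map[where f = f and f' = f' and \<psi> = \<psi>, OF i n f' f0] by auto
qed

lemma lin_isometry_leaf: "lin_isometry V (nimage leaf V) leaf"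
  and lin_isometry_unleaf: "lin_isometry (nimage leaf V) V unleaf"
  by (simp_all add: lin_isometry_nimage lin_isometry_nimage_inv linear_leaf inj_leaf unleaf_linear)

lemma c_map_0:
  fixes W :: "'b::real_vector nspace" and V :: "'a::real_vector nspace"
  assumes n: "normed V" "normed W"
  shows "c_map 0 V U W f \<longleftrightarrow> c0_map V U W f"
proof -
  let ?W = "nimage leaf W :: ('a list \<Rightarrow> 'b) nspace" and ?f = "leaf \<circ> f :: 'a \<Rightarrow> 'a list \<Rightarrow> 'b"
  have nW: "normed ?W" using lin_isometry_normed[OF lin_isometry_leaf n(2)] .
  have "c0_map V U W f" if "c0_map V U ?W ?f"
    by (rule lin_isometry_c0_map[OF lin_isometry_unleaf n(1) nW _ that]) simp
  moreover have "c0_map V U ?W ?f" if "c0_map V U W f"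
    by (rule lin_isometry_c0_map[OF lin_isometry_leaf n _ that]) simp
  ultimately show ?thesis unfolding c_map_def by auto
qed

lemma c_map_Suc:
  fixes W :: "'b::real_vector nspace" and V :: "'a::real_vector nspace"
  assumes n: "normed V" "normed W" and U: "U \<subseteq> car V"
  shows "c_map (Suc l) V U W f \<longleftrightarrow> c0_map V U W f \<and>
    (\<exists>Df. frechet_derivative_on V U W f Df \<and> c_map l V U (op_space V W) Df)"
proof -
  let ?W = "nimage leaf W :: ('a list \<Rightarrow> 'b) nspace" and ?f = "leaf \<circ> f :: 'a \<Rightarrow> 'a list \<Rightarrow> 'b"
  have nW: "normed ?W" using lin_isometry_normed[OF lin_isometry_leaf n(2)] .
  have f0: "c0_map V U ?W ?f \<longleftrightarrow> c0_map V U W f" using c_map_0[OF n] by (simp add: c_map_def)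
  show ?thesis
  proof
    assume "c_map (Suc l) V U W f"
    then obtain Df1 where 0: "c0_map V U ?W ?f" and D1: "frechet_derivative_on V U ?W ?f Df1"
      and T: "c_map_coded l V U (nimage uncurry_op (op_space V ?W)) (uncurry_op \<circ> Df1)"
      unfolding c_map_def by auto
    define Df where "Df = (\<lambda>x. push_op V unleaf (Df1 x))"
    have "frechet_derivative_on V U W f Df"
      by (rule lin_isometry_frechet_derivative_on[OF lin_isometry_unleaf n(1) nW U c0_map_in[OF 0 n(1) nW U] _ D1])
        (simp_all add: Df_def)
    moreover have j: "lin_isometry (nimage uncurry_op (op_space V ?W)) (nimage leaf (op_space V W))
        (leaf \<circ> (push_op V unleaf \<circ> curry_op))"
      by (intro lin_isometry_comp[OF _ lin_isometry_leaf] lin_isometry_comp[OF lin_isometry_curry_op]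
          lin_isometry_op_space lin_isometry_unleaf n nW)
    have "c_map_coded l V U (nimage leaf (op_space V W)) (leaf \<circ> Df)"
      by (rule lin_isometry_c_map_coded[OF j n(1) lin_isometry_normed[OF lin_isometry_uncurry_op
            normed_op_space[OF n(1) nW]] U _ T]) (simp add: Df_def)
    ultimately show "c0_map V U W f \<and> (\<exists>Df. frechet_derivative_on V U W f Df \<and> c_map l V U (op_space V W) Df)"
      using 0 f0 unfolding c_map_def by auto
  next
    assume "c0_map V U W f \<and> (\<exists>Df. frechet_derivative_on V U W f Df \<and> c_map l V U (op_space V W) Df)"
    then obtain Df where 0: "c0_map V U W f" and D: "frechet_derivative_on V U W f Df"
      and T: "c_map_coded l V U (nimage leaf (op_space V W)) (leaf \<circ> Df)"
      unfolding c_map_def by blast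
    define Df1 where "Df1 = (\<lambda>x. push_op V leaf (Df x) :: 'a \<Rightarrow> 'a list \<Rightarrow> 'b)"
    have "frechet_derivative_on V U ?W ?f Df1"
      by (rule lin_isometry_frechet_derivative_on[OF lin_isometry_leaf n U c0_map_in[OF 0 n U] _ D])
        (simp_all add: Df1_def)
    moreover have j: "lin_isometry (nimage leaf (op_space V W)) (nimage uncurry_op (op_space V ?W))
        (uncurry_op \<circ> (push_op V leaf \<circ> unleaf))"
      by (intro lin_isometry_comp[OF _ lin_isometry_uncurry_op] lin_isometry_comp[OF lin_isometry_unleaf]
          lin_isometry_op_space lin_isometry_leaf n)
    have "c_map_coded l V U (nimage uncurry_op (op_space V ?W)) (uncurry_op \<circ> Df1)"
      by (rule lin_isometry_c_map_coded[OF j n(1) lin_isometry_normed[OF lin_isometry_leaf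
            normed_op_space[OF n]] U _ T]) (simp add: Df1_def)
    ultimately show "c_map (Suc l) V U W f"
      using 0 f0 unfolding c_map_def by auto
  qed
qed

end

theory Submission
  imports Defs
begin

text \<open>
  The claim is an induction on \<open>k\<close> that goes through the tangent map. If \<open>f\<close> is sc-\<open>(k + 1)\<close>, then
  \<open>Tf\<close> is sc-\<open>k\<close>, and since \<open>(TE)\<^sub>m\<^sub>+\<^sub>l = E\<^sub>m\<^sub>+\<^sub>l\<^sub>+\<^sub>1 \<oplus> E\<^sub>m\<^sub>+\<^sub>l\<close> the induction hypothesis says that
  \<open>\<Phi>(x, h) = Df(x)h\<close> is of class \<open>C\<^sup>l\<close> as a map \<open>U\<^sub>m\<^sub>+\<^sub>l\<^sub>+\<^sub>1 \<oplus> E\<^sub>m\<^sub>+\<^sub>l \<rightarrow> F\<^sub>m\<close>. Two things separate this from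
  \<open>f: U\<^sub>m\<^sub>+\<^sub>l\<^sub>+\<^sub>1 \<rightarrow> F\<^sub>m\<close> being of class \<open>C\<^sup>l\<^sup>+\<^sup>1\<close>.

  First, joint regularity of \<open>\<Phi>\<close> has to become regularity of \<open>x \<mapsto> \<Phi>(x, \<cdot>)\<close> in the operator norm, which
  fails in general. Here \<open>h\<close> only has to range over the unit ball of \<open>E\<^sub>m\<^sub>+\<^sub>l\<^sub>+\<^sub>1\<close>, which is
  relatively compact in \<open>E\<^sub>m\<^sub>+\<^sub>l\<close>, and a jointly continuous map is continuous in \<open>x\<close> uniformly over a
  compact set of \<open>h\<close> (\<open>compact_incl_uniform\<close>). For \<open>l > 0\<close> one applies this to the partial derivative
  \<open>D\<^sub>1\<Phi>(x, h) \<in> L(V, W)\<close>, which is again linear in \<open>h\<close> and one degree less regular, and identifies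
  \<open>L(Y, L(V, W))\<close> with \<open>L(V, L(Y, W))\<close> (\<open>c_map_op_of_linear_param\<close>). That \<open>D\<^sub>1\<Phi>\<close> is linear in \<open>h\<close> rests on
  the uniqueness of derivatives, and so on the domain having enough directions: a partial quadrant
  is a convex cone \<open>C\<close> with \<open>C - C\<close> the whole space, on every level.

  Secondly, \<open>f\<close> is assumed differentiable only as a map into \<open>F\<^sub>0\<close>, whereas the remainder has to be
  estimated in \<open>F\<^sub>m\<close>. Along a segment, \<open>f(x + h) - f(x) = \<integral> Df(x + th)h dt\<close> holds in \<open>F\<^sub>0\<close>, and the integrand
  is continuous into the complete space \<open>F\<^sub>m\<close>. Its Riemann sums thus converge in \<open>F\<^sub>m\<close>, necessarily to
  the same element, and the remainder is at most the supremum of \<open>|Df(x + th)h - Df(x)h|\<^sub>m\<close>, which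
  the uniformity above bounds by \<open>\<epsilon>|h|\<close> (\<open>path_increment_in_finer_space\<close>,
  \<open>first_order_at_finer_target\<close>).

  The properties of \<open>E\<close>, \<open>F\<close> and \<open>U\<close> that enter are collected in \<open>sc_source\<close> and \<open>sc_target\<close>. They pass to
  tangent spaces and are invariant under linear isometries, so that the induction can run on the
  coded form of sc-maps, whose type does not change.
\<close>

section \<open>Estimates for subspace norms\<close>

lemma nrm_0: "normed V \<Longrightarrow> nrm V 0 = 0"
  using normedD(1,6) by blast

lemma nrm_minus: "normed V \<Longrightarrow> x \<in> car V \<Longrightarrow> nrm V (- x) = nrm V x"
  using normedD(7)[of V x "-1"] by simp

lemma nrm_minus_commute: "normed V \<Longrightarrow> x \<in> car V \<Longrightarrow> y \<in> car V \<Longrightarrow> nrm V (x - y) = nrm V (y - x)"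
  using nrm_minus[of V "y - x"] normedD(3)[of V y x] by simp

lemma nrm_triangle_diff:
  assumes "normed V" "x \<in> car V" "y \<in> car V" shows "nrm V (x - y) \<le> nrm V x + nrm V y"
  using normedD(8)[OF assms(1,2), of "- y"] nrm_minus[OF assms(1,3)] normedD(4)[OF assms(1,3), of "-1"] by simp

lemma nrm_triangle_via:
  assumes "normed V" "x \<in> car V" "y \<in> car V" "z \<in> car V"
  shows "nrm V (x - z) \<le> nrm V (x - y) + nrm V (y - z)"
  using normedD(8)[OF assms(1) normedD(3)[OF assms(1-3)] normedD(3)[OF assms(1,3,4)]] by simp

lemma car_sum: "normed V \<Longrightarrow> (\<And>i. i \<in> I \<Longrightarrow> g i \<in> car V) \<Longrightarrow> sum g I \<in> car V"
  by (induction I rule: infinite_finite_induct) (auto simp: normedD)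

lemma nrm_sum_le:
  assumes "normed V" "\<And>i. i \<in> I \<Longrightarrow> g i \<in> car V"
  shows "nrm V (sum g I) \<le> (\<Sum>i\<in>I. nrm V (g i))"
  using assms(2)
proof (induction I rule: infinite_finite_induct)
  case (insert i I)
  have "nrm V (g i + sum g I) \<le> nrm V (g i) + nrm V (sum g I)"
    using insert.prems car_sum[OF assms(1), of I g] by (intro normedD(8)[OF assms(1)]) auto
  then show ?case using insert by force
qed (auto simp: nrm_0[OF assms(1)])

lemma c0_map_iff:
  assumes V: "normed V" and W: "normed W"
  shows "c0_map V U W f \<longleftrightarrow> (\<forall>x\<in>U \<inter> car V. f x \<in> car W \<and>
    (\<forall>e>0. \<exists>d>0. \<forall>y\<in>U \<inter> car V. nrm V (y - x) < d \<longrightarrow> nrm W (f y - f x) < e))"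
proof -
  let ?S = "U \<inter> car V"
  interpret Submetric "car V" "ndist V" ?S
    by (intro Submetric.intro metric_normed V) (simp add: Submetric_axioms_def)
  have "subtopology (ntop V) U = sub.mtopology"
    unfolding mtopology_submetric by (metis Int_commute subtopology_restrict topspace_ntop[OF V])
  then have "c0_map V U W f \<longleftrightarrow> f ` ?S \<subseteq> car W \<and> (\<forall>x\<in>?S. \<forall>e>0. \<exists>d>0. \<forall>y.
      y \<in> ?S \<and> ndist V x y < d \<longrightarrow> ndist W (f x) (f y) < e)"
    unfolding c0_map_def using sub.metric_continuous_map[OF metric_normed[OF W]] by simp
  also have "\<dots> \<longleftrightarrow> f ` ?S \<subseteq> car W \<and> (\<forall>x\<in>?S. \<forall>e>0. \<exists>d>0. \<forall>y\<in>?S.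
      nrm V (y - x) < d \<longrightarrow> nrm W (f y - f x) < e)"
    by (intro conj_cong refl ball_cong all_cong imp_cong ex_cong)
      (auto simp: ndist_def image_subset_iff nrm_minus_commute[OF V] nrm_minus_commute[OF W] cong: conj_cong)
  finally show ?thesis by blast
qed

lemma c0_mapD:
  assumes "c0_map V U W f" "normed V" "normed W" "x \<in> U" "x \<in> car V"
  shows "f x \<in> car W"
    and "e > 0 \<Longrightarrow> \<exists>d>0. \<forall>y\<in>U. y \<in> car V \<longrightarrow> nrm V (y - x) < d \<longrightarrow> nrm W (f y - f x) < e"
  using assms(1)[unfolded c0_map_iff[OF assms(2,3)]] assms(4,5) by (meson IntI)+

lemma c_map_imp_c0_map:
  assumes "normed V" "normed W" "U \<subseteq> car V" "c_map l V U W f"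
  shows "c0_map V U W f"
  using assms c_map_0 c_map_Suc by (cases l) blast+

lemma bounded_lin_mapE:
  assumes "bounded_lin_map V W A" "normed V"
  obtains K where "K > 0" "\<And>x. x \<in> car V \<Longrightarrow> nrm W (A x) \<le> K * nrm V x"
proof -
  obtain K where K: "\<And>x. x \<in> car V \<Longrightarrow> nrm W (A x) \<le> K * nrm V x"
    using assms(1) by (auto simp: bounded_lin_map_def)
  have "nrm W (A x) \<le> (\<bar>K\<bar> + 1) * nrm V x" if "x \<in> car V" for x
    using K[OF that] mult_right_mono[of K "\<bar>K\<bar> + 1" "nrm V x"] normedD(5)[OF assms(2) that] by linarith
  then show ?thesis using that[of "\<bar>K\<bar> + 1"] by simp
qed

lemma bounded_lin_map_lin_map: "bounded_lin_map V W A \<Longrightarrow> lin_map V W A"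
  by (simp add: bounded_lin_map_def)

lemma lin_isometry_imp_bounded: "lin_isometry V W \<phi> \<Longrightarrow> bounded_lin_map V W \<phi>"
  unfolding lin_isometry_def bounded_lin_map_def by (auto intro!: exI[of _ 1])

lemma lin_map_id: "lin_map W W (\<lambda>x. x)"
  by (simp add: lin_map_def)

lemma bounded_lin_map_id: "bounded_lin_map W W (\<lambda>x. x)"
  unfolding bounded_lin_map_def by (auto simp: lin_map_id intro!: exI[of _ 1])

lemma op_space_in: "A \<in> car (op_space V W) \<longleftrightarrow> bounded_lin_map V W A \<and> (\<forall>x. x \<notin> car V \<longrightarrow> A x = 0)"
  by (simp add: op_space_def)

lemma op_space_nrm_apply:
  assumes A: "A \<in> car (op_space V W)" and V: "normed V" and W: "normed W" and x: "x \<in> car V"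
  shows "nrm W (A x) \<le> nrm (op_space V W) A * nrm V x"
proof (cases "x = 0")
  case True
  have "lin_map V W A" using A by (simp add: op_space_in bounded_lin_map_def)
  then show ?thesis using True by (simp add: lin_map_0[OF _ V] nrm_0 V W)
next
  case False
  then have p: "nrm V x > 0" using normedD(5,6)[OF V x] by linarith
  have l: "lin_map V W A" using A by (simp add: op_space_in bounded_lin_map_def)
  let ?y = "(1 / nrm V x) *\<^sub>R x"
  have "nrm W (A ?y) \<le> nrm (op_space V W) A"
    using p by (intro op_space_nrm_ub[OF A V W] normedD(4)[OF V x]) (simp add: normedD(7)[OF V x])
  moreover have "nrm W (A ?y) = nrm W (A x) / nrm V x"
    using p by (simp add: lin_mapD(3)[OF l x] normedD(7)[OF W lin_mapD(1)[OF l x]])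
  ultimately show ?thesis using p by (simp add: field_simps)
qed

text \<open>Elements of \<^const>\<open>op_space\<close> have to vanish outside the carrier, so operators given by a formula
  are cut off to become elements of it.\<close>

definition restr :: "'a nspace \<Rightarrow> ('a \<Rightarrow> 'b::zero) \<Rightarrow> 'a \<Rightarrow> 'b" where
  "restr V A = (\<lambda>x. if x \<in> car V then A x else 0)"

lemma restr_in [simp]: "x \<in> car V \<Longrightarrow> restr V A x = A x"
  by (simp add: restr_def)

lemma restr_op_spaceI:
  assumes V: "normed V"
    and "\<And>x. x \<in> car V \<Longrightarrow> A x \<in> car W"
    and "\<And>x y. x \<in> car V \<Longrightarrow> y \<in> car V \<Longrightarrow> A (x + y) = A x + A y"
    and "\<And>c x. x \<in> car V \<Longrightarrow> A (c *\<^sub>R x) = c *\<^sub>R A x"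
    and "\<And>x. x \<in> car V \<Longrightarrow> nrm W (A x) \<le> K * nrm V x"
  shows "restr V A \<in> car (op_space V W)"
  unfolding op_space_in bounded_lin_map_def lin_map_def
  using assms(2-) normedD(2,4)[OF V] by (auto simp: restr_def intro!: exI[of _ K])

lemma op_space_nrm_restr_le:
  assumes V: "normed V" and "K \<ge> 0" and "\<And>x. x \<in> car V \<Longrightarrow> nrm W (A x) \<le> K * nrm V x"
  shows "nrm (op_space V W) (restr V A) \<le> K"
proof (rule op_space_nrm_le[OF V])
  fix x assume x: "x \<in> car V" "nrm V x \<le> 1"
  show "nrm W (restr V A x) \<le> K"
    using assms(3)[OF x(1)] mult_left_mono[OF x(2) \<open>K \<ge> 0\<close>] x(1) by simp
qed

text \<open>
  The next two rules replace the difference quotient by an inequality that covers the zero increment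
  as well. The converse direction needs the remainder to lie in \<open>W\<close>, for a norm is known to be
  nonnegative only there.
\<close>

lemma first_order_atD:
  assumes "first_order_at V W U f x A" "normed V" "normed W" "A 0 = 0" "e > 0"
  obtains d where "d > 0" "\<And>h. h \<in> car V \<Longrightarrow> nrm V h < d \<Longrightarrow> x + h \<in> U \<Longrightarrow>
    nrm W (f (x + h) - f x - A h) \<le> e * nrm V h"
proof -
  obtain d where d: "d > 0" "\<forall>h\<in>car V. h \<noteq> 0 \<and> nrm V h < d \<and> x + h \<in> U \<longrightarrow>
        \<bar>nrm W (f (x + h) - f x - A h) / nrm V h\<bar> < e"
    using assms(1,5) unfolding first_order_at_iff[OF assms(2)] by blast
  have "nrm W (f (x + h) - f x - A h) \<le> e * nrm V h" if h: "h \<in> car V" "nrm V h < d" "x + h \<in> U" for h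
  proof (cases "h = 0")
    case True then show ?thesis using assms(4) by (simp add: nrm_0 assms(2,3))
  next
    case False
    then have "nrm V h > 0" using normedD(5,6)[OF assms(2) h(1)] by linarith
    moreover have "nrm W (f (x + h) - f x - A h) / nrm V h < e"
      using d(2) h False by (meson abs_le_D1 abs_ge_self le_less_trans)
    ultimately show ?thesis by (simp add: field_simps)
  qed
  then show ?thesis using d(1) that by blast
qed

lemma first_order_atI:
  assumes V: "normed V" and W: "normed W" and f: "\<And>y. y \<in> U \<Longrightarrow> f y \<in> car W" and x: "x \<in> U"
    and A: "\<And>h. h \<in> car V \<Longrightarrow> A h \<in> car W"
    and e: "\<And>e. e > 0 \<Longrightarrow> \<exists>d>0. \<forall>h\<in>car V. nrm V h < d \<longrightarrow> x + h \<in> U \<longrightarrow>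
      nrm W (f (x + h) - f x - A h) \<le> e * nrm V h"
  shows "first_order_at V W U f x A"
  unfolding first_order_at_iff[OF V]
proof (intro allI impI)
  fix e :: real assume "e > 0"
  then obtain d where d: "d > 0" "\<forall>h\<in>car V. nrm V h < d \<longrightarrow> x + h \<in> U \<longrightarrow>
      nrm W (f (x + h) - f x - A h) \<le> e / 2 * nrm V h"
    using e[of "e / 2"] by auto
  show "\<exists>d>0. \<forall>h\<in>car V. h \<noteq> 0 \<and> nrm V h < d \<and> x + h \<in> U \<longrightarrow>
        \<bar>nrm W (f (x + h) - f x - A h) / nrm V h\<bar> < e"
  proof (intro exI[of _ d] conjI ballI impI)
    show "d > 0" by fact
    fix h assume h: "h \<in> car V" "h \<noteq> 0 \<and> nrm V h < d \<and> x + h \<in> U"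
    have p: "nrm V h > 0" using h normedD(5,6)[OF V h(1)] by linarith
    have "f (x + h) - f x - A h \<in> car W" using h f x A normedD(3)[OF W] by simp
    then have "nrm W (f (x + h) - f x - A h) \<ge> 0" by (rule normedD(5)[OF W])
    moreover have "nrm W (f (x + h) - f x - A h) < e * nrm V h"
    proof (rule le_less_trans)
      show "nrm W (f (x + h) - f x - A h) \<le> e / 2 * nrm V h" using d(2) h by blast
      show "e / 2 * nrm V h < e * nrm V h" using p \<open>e > 0\<close> by simp
    qed
    ultimately show "\<bar>nrm W (f (x + h) - f x - A h) / nrm V h\<bar> < e"
      using p by (simp add: field_simps)
  qed
qed

section \<open>Composition with bounded linear maps\<close>

text \<open>The action of \<open>L(\<theta>, \<psi>): L(V, G) \<rightarrow> L(V', G')\<close>, which the chain rule applies to the derivative.\<close>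

definition conj_op :: "'c nspace \<Rightarrow> ('c \<Rightarrow> 'a) \<Rightarrow> ('b \<Rightarrow> 'd::zero) \<Rightarrow> ('a \<Rightarrow> 'b) \<Rightarrow> 'c \<Rightarrow> 'd" where
  "conj_op V' \<theta> \<psi> B = restr V' (\<lambda>h. \<psi> (B (\<theta> h)))"

lemma bounded_lin_map_compose:
  assumes "bounded_lin_map V W A" "bounded_lin_map W Z B" "normed V" "normed W"
  shows "bounded_lin_map V Z (B \<circ> A)"
proof -
  obtain K where K: "K > 0" "\<And>x. x \<in> car V \<Longrightarrow> nrm W (A x) \<le> K * nrm V x"
    using bounded_lin_mapE[OF assms(1,3)] by blast
  obtain L where L: "L > 0" "\<And>x. x \<in> car W \<Longrightarrow> nrm Z (B x) \<le> L * nrm W x"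
    using bounded_lin_mapE[OF assms(2,4)] by blast
  note A = lin_mapD[OF bounded_lin_map_lin_map[OF assms(1)]]
  note B = lin_mapD[OF bounded_lin_map_lin_map[OF assms(2)]]
  have "nrm Z (B (A x)) \<le> (L * K) * nrm V x" if x: "x \<in> car V" for x
    using order_trans[OF L(2)[OF A(1)[OF x]] mult_left_mono[OF K(2)[OF x], of L]] L(1) by (simp add: mult.assoc)
  moreover have "lin_map V Z (B \<circ> A)" unfolding lin_map_def using A B by auto
  ultimately show ?thesis unfolding bounded_lin_map_def by auto
qed

lemma bounded_lin_map_conj_op:
  assumes \<theta>: "bounded_lin_map V' V \<theta>" and \<psi>: "bounded_lin_map G G' \<psi>"
    and V: "normed V" and V': "normed V'" and G: "normed G" and G': "normed G'"
  shows "bounded_lin_map (op_space V G) (op_space V' G') (conj_op V' \<theta> \<psi>)"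
proof -
  obtain K where K: "K > 0" "\<And>x. x \<in> car V' \<Longrightarrow> nrm V (\<theta> x) \<le> K * nrm V' x"
    using bounded_lin_mapE[OF \<theta> V'] by blast
  obtain L where L: "L > 0" "\<And>x. x \<in> car G \<Longrightarrow> nrm G' (\<psi> x) \<le> L * nrm G x"
    using bounded_lin_mapE[OF \<psi> G] by blast
  note T = lin_mapD[OF bounded_lin_map_lin_map[OF \<theta>]]
  note P = lin_mapD[OF bounded_lin_map_lin_map[OF \<psi>]]
  have B: "lin_map V G B" if "B \<in> car (op_space V G)" for B
    using that by (simp add: op_space_in bounded_lin_map_def)
  note B = lin_mapD[OF B]
  have bd: "nrm G' (\<psi> (B (\<theta> h))) \<le> (L * K * nrm (op_space V G) B) * nrm V' h"
    if "B \<in> car (op_space V G)" "h \<in> car V'" for B h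
  proof -
    have nn: "nrm (op_space V G) B \<ge> 0" using normedD(5)[OF normed_op_space[OF V G]] that by blast
    have "nrm G (B (\<theta> h)) \<le> nrm (op_space V G) B * (K * nrm V' h)"
      using op_space_nrm_apply[OF that(1) V G T(1)[OF that(2)]] mult_left_mono[OF K(2)[OF that(2)] nn] by linarith
    then have "L * nrm G (B (\<theta> h)) \<le> L * (nrm (op_space V G) B * (K * nrm V' h))"
      using L(1) by simp
    then show ?thesis using L(2)[OF B(1)[OF that(1) T(1)[OF that(2)]]] by (simp add: algebra_simps)
  qed
  show ?thesis
    unfolding bounded_lin_map_def lin_map_def
  proof (intro conjI funcsetI ballI allI exI)
    fix B assume B1: "B \<in> car (op_space V G)"
    show "conj_op V' \<theta> \<psi> B \<in> car (op_space V' G')"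
      unfolding conj_op_def using B[OF B1] T P bd[OF B1] by (intro restr_op_spaceI[OF V']) auto
    show "conj_op V' \<theta> \<psi> (c *\<^sub>R B) = c *\<^sub>R conj_op V' \<theta> \<psi> B" for c
      using P(3)[OF B(1)[OF B1 T(1)]] by (auto simp: conj_op_def restr_def scaleR_fun_def)
    show "nrm (op_space V' G') (conj_op V' \<theta> \<psi> B) \<le> (L * K) * nrm (op_space V G) B"
      unfolding conj_op_def using bd[OF B1] L(1) K(1) normedD(5)[OF normed_op_space[OF V G] B1]
      by (intro op_space_nrm_restr_le[OF V']) auto
    fix B' assume B2: "B' \<in> car (op_space V G)"
    show "conj_op V' \<theta> \<psi> (B + B') = conj_op V' \<theta> \<psi> B + conj_op V' \<theta> \<psi> B'"
      using P(2)[OF B(1)[OF B1 T(1)] B(1)[OF B2 T(1)]] by (auto simp: conj_op_def restr_def plus_fun_def)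
  qed
qed

lemma c0_map_compose:
  assumes \<theta>: "bounded_lin_map V' V \<theta>" and \<psi>: "bounded_lin_map W W' \<psi>"
    and n: "normed V" "normed V'" "normed W" "normed W'"
    and U: "\<And>x. x \<in> U' \<Longrightarrow> \<theta> x \<in> U" and f': "\<And>x. x \<in> U' \<Longrightarrow> f' x = \<psi> (f (\<theta> x))"
    and f: "c0_map V U W f"
  shows "c0_map V' U' W' f'"
  unfolding c0_map_iff[OF n(2,4)]
proof (intro ballI conjI allI impI)
  note T = lin_mapD[OF bounded_lin_map_lin_map[OF \<theta>]]
  note P = lin_mapD[OF bounded_lin_map_lin_map[OF \<psi>]]
  fix x assume x: "x \<in> U' \<inter> car V'"
  note fD = c0_mapD[OF f n(1,3)]
  have fi: "f (\<theta> y) \<in> car W" if "y \<in> U' \<inter> car V'" for y using fD(1) U T that by auto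
  show "f' x \<in> car W'" using f' P(1) fi x by auto
  fix e :: real assume "e > 0"
  obtain K where K: "K > 0" "\<And>x. x \<in> car V' \<Longrightarrow> nrm V (\<theta> x) \<le> K * nrm V' x"
    using bounded_lin_mapE[OF \<theta> n(2)] by blast
  obtain L where L: "L > 0" "\<And>x. x \<in> car W \<Longrightarrow> nrm W' (\<psi> x) \<le> L * nrm W x"
    using bounded_lin_mapE[OF \<psi> n(3)] by blast
  obtain d where d: "d > 0" "\<And>y. y \<in> U \<Longrightarrow> y \<in> car V \<Longrightarrow> nrm V (y - \<theta> x) < d \<Longrightarrow> nrm W (f y - f (\<theta> x)) < e / L"
    using fD(2)[of "\<theta> x" "e / L"] U T x \<open>e > 0\<close> L(1) by (auto simp: Ball_def)
  show "\<exists>d>0. \<forall>y\<in>U' \<inter> car V'. nrm V' (y - x) < d \<longrightarrow> nrm W' (f' y - f' x) < e"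
  proof (intro exI[of _ "d / K"] conjI ballI impI)
    show "d / K > 0" using d K by simp
    fix y assume y: "y \<in> U' \<inter> car V'" "nrm V' (y - x) < d / K"
    have "nrm V (\<theta> y - \<theta> x) \<le> K * nrm V' (y - x)"
      using K(2)[of "y - x"] lin_map_diff[OF bounded_lin_map_lin_map[OF \<theta>] n(2)] normedD(3)[OF n(2)] x y by auto
    also have "\<dots> < d" using y(2) K(1) by (simp add: field_simps)
    finally have "nrm W (f (\<theta> y) - f (\<theta> x)) < e / L" using d(2) U T y by auto
    then have "L * nrm W (f (\<theta> y) - f (\<theta> x)) < e" using L(1) by (simp add: field_simps)
    moreover have "f' y - f' x = \<psi> (f (\<theta> y) - f (\<theta> x))"
      using f' x y fi lin_map_diff[OF bounded_lin_map_lin_map[OF \<psi>] n(3)] by auto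
    ultimately show "nrm W' (f' y - f' x) < e"
      using L(2)[OF normedD(3)[OF n(3) fi[OF y(1)] fi[OF x]]] by simp
  qed
qed

lemma frechet_derivative_on_compose:
  assumes \<theta>: "bounded_lin_map V' V \<theta>" and \<psi>: "bounded_lin_map W W' \<psi>"
    and n: "normed V" "normed V'" "normed W" "normed W'"
    and U: "\<And>x. x \<in> U' \<Longrightarrow> \<theta> x \<in> U" "U \<subseteq> car V" "U' \<subseteq> car V'"
    and f': "\<And>x. x \<in> U' \<Longrightarrow> f' x = \<psi> (f (\<theta> x))"
    and f: "f \<in> U \<rightarrow> car W" and Df: "frechet_derivative_on V U W f Df"
  shows "frechet_derivative_on V' U' W' f' (\<lambda>x. conj_op V' \<theta> \<psi> (Df (\<theta> x)))"
  unfolding frechet_derivative_on_def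
proof (intro ballI conjI)
  note T = lin_mapD[OF bounded_lin_map_lin_map[OF \<theta>]]
  note P = lin_mapD[OF bounded_lin_map_lin_map[OF \<psi>]]
  note C = lin_mapD[OF bounded_lin_map_lin_map[OF bounded_lin_map_conj_op[OF \<theta> \<psi> n]]]
  fix x assume x: "x \<in> U'"
  then have D: "Df (\<theta> x) \<in> car (op_space V W)" "first_order_at V W U f (\<theta> x) (Df (\<theta> x))"
    using Df U(1) by (auto simp: frechet_derivative_on_def)
  show C1: "conj_op V' \<theta> \<psi> (Df (\<theta> x)) \<in> car (op_space V' W')" using C(1)[OF D(1)] .
  have lD: "lin_map V W (Df (\<theta> x))" using D(1) by (simp add: op_space_in bounded_lin_map_def)
  have fi: "f (\<theta> y) \<in> car W" if "y \<in> U'" for y using f U that by auto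
  obtain K where K: "K > 0" "\<And>x. x \<in> car V' \<Longrightarrow> nrm V (\<theta> x) \<le> K * nrm V' x"
    using bounded_lin_mapE[OF \<theta> n(2)] by blast
  obtain L where L: "L > 0" "\<And>x. x \<in> car W \<Longrightarrow> nrm W' (\<psi> x) \<le> L * nrm W x"
    using bounded_lin_mapE[OF \<psi> n(3)] by blast
  show "first_order_at V' W' U' f' x (conj_op V' \<theta> \<psi> (Df (\<theta> x)))"
  proof (rule first_order_atI[OF n(2,4) _ x])
    show "f' y \<in> car W'" if "y \<in> U'" for y using f'[OF that] P(1) fi[OF that] by simp
    show "conj_op V' \<theta> \<psi> (Df (\<theta> x)) h \<in> car W'" if "h \<in> car V'" for h
      using that P(1) lin_mapD(1)[OF lD] T(1) by (simp add: conj_op_def)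
    fix e :: real assume "e > 0"
    then have "e / (L * K) > 0" using L(1) K(1) by simp
    then obtain d where d: "d > 0" "\<And>h. h \<in> car V \<Longrightarrow> nrm V h < d \<Longrightarrow> \<theta> x + h \<in> U \<Longrightarrow>
        nrm W (f (\<theta> x + h) - f (\<theta> x) - Df (\<theta> x) h) \<le> e / (L * K) * nrm V h"
      using first_order_atD[OF D(2) n(1,3) lin_map_0[OF lD n(1)]] by blast
    show "\<exists>d>0. \<forall>h\<in>car V'. nrm V' h < d \<longrightarrow> x + h \<in> U' \<longrightarrow>
      nrm W' (f' (x + h) - f' x - conj_op V' \<theta> \<psi> (Df (\<theta> x)) h) \<le> e * nrm V' h"
    proof (intro exI[of _ "d / K"] conjI ballI impI)
      show "d / K > 0" using d K by simp
      fix h assume h: "h \<in> car V'" "nrm V' h < d / K" "x + h \<in> U'"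
      have xh: "\<theta> (x + h) = \<theta> x + \<theta> h" using T(2) h(1) x U(3) by auto
      let ?r = "f (\<theta> (x + h)) - f (\<theta> x) - Df (\<theta> x) (\<theta> h)"
      have ri: "f (\<theta> (x + h)) - f (\<theta> x) \<in> car W" "Df (\<theta> x) (\<theta> h) \<in> car W"
        using fi h x lin_mapD(1)[OF lD] T(1) normedD(3)[OF n(3)] by auto
      have "nrm V (\<theta> h) < d" using K(2)[OF h(1)] h(2) K(1) by (simp add: field_simps)
      then have "nrm W ?r \<le> e / (L * K) * nrm V (\<theta> h)"
        using d(2)[OF T(1)[OF h(1)]] U(1)[OF h(3)] by (simp add: xh)
      also have "\<dots> \<le> e / (L * K) * (K * nrm V' h)"
        using K(2)[OF h(1)] \<open>e / (L * K) > 0\<close> by (intro mult_left_mono) auto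
      finally have "L * nrm W ?r \<le> L * (e / (L * K) * (K * nrm V' h))" using L(1) by simp
      then have "L * nrm W ?r \<le> e * nrm V' h" using L(1) K(1) by simp
      moreover have "f' (x + h) - f' x - conj_op V' \<theta> \<psi> (Df (\<theta> x)) h = \<psi> ?r"
        using f'[OF x] f'[OF h(3)] h(1) ri lin_map_diff[OF bounded_lin_map_lin_map[OF \<psi>] n(3)] fi[OF x] fi[OF h(3)]
        by (simp add: conj_op_def)
      ultimately show "nrm W' (f' (x + h) - f' x - conj_op V' \<theta> \<psi> (Df (\<theta> x)) h) \<le> e * nrm V' h"
        using L(2)[OF normedD(3)[OF n(3) ri]] by simp
    qed
  qed
qed

text \<open>
  The derivative of \<open>\<psi> \<circ> f \<circ> \<theta>\<close> is \<open>L(\<theta>, \<psi>) \<circ> Df \<circ> \<theta>\<close>, a composition of the same shape with the bounded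
  operator \<open>L(\<theta>, \<psi>)\<close> in place of \<open>\<psi>\<close>. This is why the induction generalizes over \<open>\<psi>\<close> and keeps \<open>\<theta>\<close>.
\<close>

lemma c_map_coded_compose:
  fixes G :: "('a::real_vector list \<Rightarrow> 'b::real_vector) nspace" and G' :: "('c::real_vector list \<Rightarrow> 'd::real_vector) nspace"
  assumes "bounded_lin_map V' V \<theta>" "bounded_lin_map G G' \<psi>"
    and "normed V" "normed V'" "normed G" "normed G'"
    and "\<And>x. x \<in> U' \<Longrightarrow> \<theta> x \<in> U" "U \<subseteq> car V" "U' \<subseteq> car V'"
    and "\<And>x. x \<in> U' \<Longrightarrow> f' x = \<psi> (f (\<theta> x))" and "c_map_coded l V U G f"
  shows "c_map_coded l V' U' G' f'"
  using assms(2,5,6,10,11)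
proof (induction l arbitrary: G G' \<psi> f f')
  case 0
  have "c0_map V' U' G' f'"
    by (rule c0_map_compose[where f = f and f' = f', OF assms(1) 0(1) assms(3,4) 0(2,3) assms(7) 0(4)])
      (use 0(5) in simp_all)
  then show ?case by simp
next
  case (Suc l)
  note \<psi> = Suc.prems(1) and n = assms(3,4) Suc.prems(2,3) and f' = Suc.prems(4)
  obtain Df where f0: "c0_map V U G f" and Df: "frechet_derivative_on V U G f Df"
    and T: "c_map_coded l V U (nimage uncurry_op (op_space V G)) (uncurry_op \<circ> Df)"
    using Suc.prems(5) by auto
  let ?D = "\<lambda>x. conj_op V' \<theta> \<psi> (Df (\<theta> x))"
  let ?O = "op_space V G" and ?O' = "op_space V' G'"
  have nO: "normed ?O" "normed ?O'" "normed (nimage uncurry_op ?O)" "normed (nimage uncurry_op ?O')"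
    using normed_op_space n lin_isometry_normed[OF lin_isometry_uncurry_op] by blast+
  have "bounded_lin_map (nimage uncurry_op ?O) (nimage uncurry_op ?O') ((uncurry_op \<circ> conj_op V' \<theta> \<psi>) \<circ> curry_op)"
    by (intro bounded_lin_map_compose[OF lin_isometry_imp_bounded[OF lin_isometry_curry_op]]
      bounded_lin_map_compose[OF bounded_lin_map_conj_op[OF assms(1) \<psi> n]] nO
      lin_isometry_imp_bounded[OF lin_isometry_uncurry_op])
  then have "c_map_coded l V' U' (nimage uncurry_op ?O') (uncurry_op \<circ> ?D)"
    by (rule Suc.IH[OF _ nO(3,4) _ T]) simp
  moreover have "frechet_derivative_on V' U' G' f' ?D"
    by (rule frechet_derivative_on_compose[where f = f and f' = f', OF assms(1) \<psi> n assms(7-9) f' c0_map_in[OF f0 n(1,3) assms(8)] Df])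
  moreover have "c0_map V' U' G' f'"
    by (rule c0_map_compose[where f = f and f' = f', OF assms(1) \<psi> n assms(7) f' f0])
  ultimately show ?case by auto
qed

lemma c_map_compose:
  fixes W :: "'b::real_vector nspace" and W' :: "'d::real_vector nspace"
  assumes \<theta>: "bounded_lin_map V' V \<theta>" and \<psi>: "bounded_lin_map W W' \<psi>"
    and n: "normed V" "normed V'" "normed W" "normed W'"
    and U: "\<And>x. x \<in> U' \<Longrightarrow> \<theta> x \<in> U" "U \<subseteq> car V" "U' \<subseteq> car V'"
    and f': "\<And>x. x \<in> U' \<Longrightarrow> f' x = \<psi> (f (\<theta> x))" and f: "c_map l V U W f"
  shows "c_map l V' U' W' f'"
  unfolding c_map_def
proof (rule c_map_coded_compose[OF \<theta> _ n(1,2) _ _ U])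
  have n': "normed (nimage leaf W)" "normed (nimage leaf W')"
    using n lin_isometry_normed[OF lin_isometry_leaf] by blast+
  then show "normed (nimage leaf W)" "normed (nimage leaf W')" .
  show "bounded_lin_map (nimage leaf W) (nimage leaf W') ((leaf \<circ> \<psi>) \<circ> unleaf)"
    by (intro bounded_lin_map_compose[OF lin_isometry_imp_bounded[OF lin_isometry_unleaf]]
      bounded_lin_map_compose[OF \<psi>] n n' lin_isometry_imp_bounded[OF lin_isometry_leaf])
  show "c_map_coded l V U (nimage leaf W) (leaf \<circ> f)" using f by (simp add: c_map_def)
qed (use f' in \<open>simp_all add: f'\<close>)

section \<open>Mean value estimates for paths\<close>

definition path_deriv :: "'b::real_vector nspace \<Rightarrow> (real \<Rightarrow> 'b) \<Rightarrow> (real \<Rightarrow> 'b) \<Rightarrow> real \<Rightarrow> real \<Rightarrow> bool" where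
  "path_deriv W \<phi> g a b \<longleftrightarrow> (\<forall>s\<in>{a..b}. \<forall>e>0. \<exists>d>0. \<forall>t\<in>{a..b}. \<bar>t - s\<bar> < d \<longrightarrow>
     nrm W (\<phi> t - \<phi> s - (t - s) *\<^sub>R g s) \<le> e * \<bar>t - s\<bar>)"

lemma path_deriv_subset: "path_deriv W \<phi> g a b \<Longrightarrow> a \<le> a' \<Longrightarrow> b' \<le> b \<Longrightarrow> path_deriv W \<phi> g a' b'"
  unfolding path_deriv_def by (meson atLeastAtMost_iff order_trans)

text \<open>
  Subtracting the affine path with slope \<open>c\<close> reduces this to a path with derivative of norm at most \<open>M\<close>.
  The estimate with \<open>M + e\<close> in place of \<open>M\<close> holds on all short intervals around a given point, and it
  is additive over adjacent intervals, so bisection gives it on \<open>[a, b]\<close>.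
\<close>

lemma mean_value_estimate:
  assumes W: "normed W" and ab: "a \<le> b" and \<phi>: "\<And>t. t \<in> {a..b} \<Longrightarrow> \<phi> t \<in> car W"
    and g: "\<And>t. t \<in> {a..b} \<Longrightarrow> g t \<in> car W" and D: "path_deriv W \<phi> g a b" and c: "c \<in> car W"
    and M: "\<And>t. t \<in> {a..b} \<Longrightarrow> nrm W (g t - c) \<le> M"
  shows "nrm W (\<phi> b - \<phi> a - (b - a) *\<^sub>R c) \<le> M * (b - a)"
proof -
  note n = normedD[OF W]
  let ?r = "\<lambda>u v. \<phi> v - \<phi> u - (v - u) *\<^sub>R c"
  have r: "?r u v \<in> car W" if "u \<in> {a..b}" "v \<in> {a..b}" for u v
    using \<phi> that c n by simp
  have eps: "nrm W (?r a b) \<le> (M + e) * (b - a)" if "e > 0" for e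
  proof -
    let ?P = "\<lambda>u v. a \<le> u \<and> u \<le> v \<and> v \<le> b \<longrightarrow> nrm W (?r u v) \<le> (M + e) * (v - u)"
    have "?P a b"
    proof (rule Bolzano[where P = ?P, OF ab])
      fix u v w assume trans: "?P u v" "?P v w" "u \<le> v" "v \<le> w"
      show "?P u w"
      proof
        assume w: "a \<le> u \<and> u \<le> w \<and> w \<le> b"
        have "?r u w = ?r u v + ?r v w" by (simp add: algebra_simps)
        moreover have "nrm W (?r u v + ?r v w) \<le> nrm W (?r u v) + nrm W (?r v w)"
          using trans w by (intro n(8) r) auto
        ultimately have "nrm W (?r u w) \<le> nrm W (?r u v) + nrm W (?r v w)" by (simp only:)
        then show "nrm W (?r u w) \<le> (M + e) * (w - u)"
          using trans w by (simp add: algebra_simps)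
      qed
    next
      fix x assume "a \<le> x" "x \<le> b"
      then have x: "x \<in> {a..b}" by simp
      then obtain d where d: "d > 0" "\<And>t. t \<in> {a..b} \<Longrightarrow> \<bar>t - x\<bar> < d \<Longrightarrow>
          nrm W (\<phi> t - \<phi> x - (t - x) *\<^sub>R g x) \<le> e * \<bar>t - x\<bar>"
        using D \<open>e > 0\<close> unfolding path_deriv_def by meson
      show "\<exists>d>0. \<forall>u v. u \<le> x \<and> x \<le> v \<and> v - u < d \<longrightarrow> ?P u v"
      proof (intro exI[of _ d] conjI[OF d(1)] allI impI)
        fix u v assume uv: "u \<le> x \<and> x \<le> v \<and> v - u < d" and uvb: "a \<le> u \<and> u \<le> v \<and> v \<le> b"
        let ?q = "\<lambda>t. \<phi> t - \<phi> x - (t - x) *\<^sub>R g x"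
        have q: "?q t \<in> car W" if "t \<in> {a..b}" for t using that x \<phi> g n by simp
        have uv': "u \<in> {a..b}" "v \<in> {a..b}" using uv uvb by auto
        have "?r u v = (?q v - ?q u) + (v - u) *\<^sub>R (g x - c)"
          by (simp add: algebra_simps)
        then have "nrm W (?r u v) = nrm W ((?q v - ?q u) + (v - u) *\<^sub>R (g x - c))"
          by (rule arg_cong)
        also have "\<dots> \<le> nrm W (?q v - ?q u) + nrm W ((v - u) *\<^sub>R (g x - c))"
          by (rule n(8)[OF n(3)[OF q[OF uv'(2)] q[OF uv'(1)]] n(4)[OF n(3)[OF g[OF x] c]]])
        also have "\<dots> \<le> (nrm W (?q v) + nrm W (?q u)) + (v - u) * M"
          using nrm_triangle_diff[OF W q[OF uv'(2)] q[OF uv'(1)]] M[OF x] uv uvb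
          by (simp add: n(7)[OF n(3)[OF g[OF x] c]] add_mono mult_left_mono)
        also have "\<dots> \<le> (e * (v - x) + e * (x - u)) + (v - u) * M"
          using d(2)[OF uv'(1)] d(2)[OF uv'(2)] uv by simp
        finally show "nrm W (?r u v) \<le> (M + e) * (v - u)" by (simp add: algebra_simps)
      qed
    qed
    then show ?thesis using ab by simp
  qed
  show ?thesis
  proof (rule field_le_epsilon)
    fix e :: real assume "e > 0"
    \<comment> \<open>the summand 1 covers the degenerate interval\<close>
    have "nrm W (?r a b) \<le> (M + e / (b - a + 1)) * (b - a)" using \<open>e > 0\<close> ab by (intro eps) simp
    also have "\<dots> \<le> M * (b - a) + e" using \<open>e > 0\<close> ab by (simp add: field_simps)
    finally show "nrm W (?r a b) \<le> M * (b - a) + e" .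
  qed
qed

lemma path_deriv_of_first_order:
  assumes V: "normed V" and W: "normed W" and v: "v \<in> car V"
    and U: "\<And>s. s \<in> {0..1} \<Longrightarrow> x + s *\<^sub>R v \<in> U"
    and D: "\<And>s. s \<in> {0..1} \<Longrightarrow> first_order_at V W U f (x + s *\<^sub>R v) (A s)"
    and A: "\<And>s c. s \<in> {0..1} \<Longrightarrow> A s (c *\<^sub>R v) = c *\<^sub>R A s v"
  shows "path_deriv W (\<lambda>t. f (x + t *\<^sub>R v)) (\<lambda>s. A s v) 0 1"
  unfolding path_deriv_def
proof (intro ballI allI impI)
  fix s e :: real assume s: "s \<in> {0..1}" and "e > 0"
  have nv: "nrm V v \<ge> 0" using normedD(5)[OF V v] .
  have "A s 0 = 0" using A[OF s, of 0] by simp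
  moreover have "e / (nrm V v + 1) > 0" using \<open>e > 0\<close> nv by simp
  ultimately obtain r where r: "r > 0" "\<And>h. h \<in> car V \<Longrightarrow> nrm V h < r \<Longrightarrow> (x + s *\<^sub>R v) + h \<in> U \<Longrightarrow>
      nrm W (f ((x + s *\<^sub>R v) + h) - f (x + s *\<^sub>R v) - A s h) \<le> e / (nrm V v + 1) * nrm V h"
    using first_order_atD[OF D[OF s] V W] by blast
  show "\<exists>d>0. \<forall>t\<in>{0..1}. \<bar>t - s\<bar> < d \<longrightarrow>
      nrm W (f (x + t *\<^sub>R v) - f (x + s *\<^sub>R v) - (t - s) *\<^sub>R A s v) \<le> e * \<bar>t - s\<bar>"
  proof (intro exI[of _ "r / (nrm V v + 1)"] conjI ballI impI)
    show "r / (nrm V v + 1) > 0" using r(1) nv by simp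
    fix t assume t: "t \<in> {0..1}" "\<bar>t - s\<bar> < r / (nrm V v + 1)"
    let ?h = "(t - s) *\<^sub>R v"
    have h: "?h \<in> car V" "nrm V ?h = \<bar>t - s\<bar> * nrm V v" using normedD(4,7)[OF V v] by auto
    have eq: "(x + s *\<^sub>R v) + ?h = x + t *\<^sub>R v" by (simp add: algebra_simps)
    have le: "\<bar>t - s\<bar> * nrm V v \<le> \<bar>t - s\<bar> * (nrm V v + 1)" by (simp add: mult_left_mono)
    also have "\<dots> < r" using t(2) nv by (simp add: pos_less_divide_eq)
    finally have "nrm V ?h < r" by (simp add: h)
    then have "nrm W (f (x + t *\<^sub>R v) - f (x + s *\<^sub>R v) - (t - s) *\<^sub>R A s v) \<le> e / (nrm V v + 1) * (\<bar>t - s\<bar> * nrm V v)"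
      using r(2)[OF h(1)] U[OF t(1)] unfolding eq A[OF s] h(2) by blast
    also have "\<dots> \<le> e / (nrm V v + 1) * (\<bar>t - s\<bar> * (nrm V v + 1))"
      using le \<open>e / (nrm V v + 1) > 0\<close> by (intro mult_left_mono) auto
    also have "\<dots> = e * \<bar>t - s\<bar>" using nv by simp
    finally show "nrm W (f (x + t *\<^sub>R v) - f (x + s *\<^sub>R v) - (t - s) *\<^sub>R A s v) \<le> e * \<bar>t - s\<bar>" .
  qed
qed

text \<open>
  Sequential forms of convergence and completeness, which transfer to products and along isometries
  without any mention of topologies.
\<close>

definition nlim :: "'a::real_vector nspace \<Rightarrow> (nat \<Rightarrow> 'a) \<Rightarrow> 'a \<Rightarrow> bool" where
  "nlim V \<sigma> l \<longleftrightarrow> l \<in> car V \<and> (\<forall>n. \<sigma> n \<in> car V) \<and> (\<lambda>n. nrm V (\<sigma> n - l)) \<longlonglongrightarrow> 0"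

definition ncomplete :: "'a::real_vector nspace \<Rightarrow> bool" where
  "ncomplete V \<longleftrightarrow> (\<forall>\<sigma>. (\<forall>n. \<sigma> n \<in> car V) \<and> (\<forall>e>0. \<exists>N. \<forall>i\<ge>N. \<forall>j\<ge>N. nrm V (\<sigma> i - \<sigma> j) < e) \<longrightarrow>
     (\<exists>l. nlim V \<sigma> l))"

definition path_cont :: "'b::real_vector nspace \<Rightarrow> (real \<Rightarrow> 'b) \<Rightarrow> bool" where
  "path_cont W g \<longleftrightarrow> (\<forall>s\<in>{0..1}. \<forall>e>0. \<exists>d>0. \<forall>t\<in>{0..1}. \<bar>t - s\<bar> < d \<longrightarrow> nrm W (g t - g s) < e)"

lemma path_cont_uniform:
  assumes W: "normed W" and g: "\<And>t. t \<in> {0..1} \<Longrightarrow> g t \<in> car W" and c: "path_cont W g" and "e > 0"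
  obtains d where "d > 0" "\<And>s t. s \<in> {0..1} \<Longrightarrow> t \<in> {0..1} \<Longrightarrow> \<bar>t - s\<bar> < d \<Longrightarrow> nrm W (g t - g s) < e"
proof (rule ccontr)
  assume no: "\<not> thesis"
  have "\<exists>s t. s \<in> {0..1} \<and> t \<in> {0..1} \<and> \<bar>t - s\<bar> < 1 / real (Suc n) \<and> \<not> nrm W (g t - g s) < e" for n
    using no that[of "1 / real (Suc n)"] by (metis of_nat_0_less_iff zero_less_Suc zero_less_divide_1_iff)
  then obtain s t where st: "\<And>n. s n \<in> {0..1} \<and> t n \<in> {0..1} \<and> \<bar>t n - s n\<bar> < 1 / real (Suc n)
      \<and> \<not> nrm W (g (t n) - g (s n)) < e" by metis
  have "compact {0..1::real}" by simp
  then obtain l r where lr: "l \<in> {0..1}" "strict_mono r" "(s \<circ> r) \<longlonglongrightarrow> l"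
    using st unfolding compact_def by meson
  obtain d where d: "d > 0" "\<And>t. t \<in> {0..1} \<Longrightarrow> \<bar>t - l\<bar> < d \<Longrightarrow> nrm W (g t - g l) < e / 2"
    using c lr(1) \<open>e > 0\<close> unfolding path_cont_def by (meson half_gt_zero)
  have "(\<lambda>n. 1 / real (Suc (r n))) \<longlonglongrightarrow> 0"
    using LIMSEQ_subseq_LIMSEQ[OF LIMSEQ_inverse_real_of_nat lr(2)] by (simp add: o_def inverse_eq_divide)
  then have "\<forall>\<^sub>F n in sequentially. 1 / real (Suc (r n)) < d / 2"
    using d(1) by (intro order_tendstoD(2)) auto
  moreover have "\<forall>\<^sub>F n in sequentially. \<bar>s (r n) - l\<bar> < d / 2"
    using lr(3) d(1) unfolding tendsto_iff dist_real_def o_def by (meson half_gt_zero)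
  ultimately obtain n where n: "1 / real (Suc (r n)) < d / 2" "\<bar>s (r n) - l\<bar> < d / 2"
    using eventually_happens[OF eventually_conj] sequentially_bot by blast
  note q = st[of "r n"]
  have "\<bar>t (r n) - s (r n)\<bar> < 1 / real (Suc (r n))" using q by blast
  then have "\<bar>t (r n) - l\<bar> < d" "\<bar>s (r n) - l\<bar> < d" using n by linarith+
  then have "nrm W (g (t (r n)) - g l) < e / 2" "nrm W (g (s (r n)) - g l) < e / 2"
    using q d(2) by blast+
  then have "nrm W (g (t (r n)) - g (s (r n))) < e"
    using nrm_triangle_via[OF W, of "g (t (r n))" "g l" "g (s (r n))"] g q lr(1)
      nrm_minus_commute[OF W, of "g l" "g (s (r n))"] by auto
  then show False using q by blast
qed

text \<open>
  The fundamental theorem of calculus across two norms: \<open>\<phi>\<close> is differentiable only for the weaker norm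
  of \<open>W0\<close>, but its derivative \<open>g\<close> is continuous for the norm of \<open>W\<close>. The Riemann sums \<open>S m\<close> of \<open>g\<close> are Cauchy
  in \<open>W\<close> by uniform continuity, and the mean value estimate on each subinterval shows that they tend
  to \<open>\<phi> 1 - \<phi> 0\<close> in \<open>W0\<close>. Limits in \<open>W0\<close> being unique, the increment is the limit in \<open>W\<close>; it inherits the
  bound by \<open>M\<close> because every \<open>S m - p\<close> is an average of values \<open>g t - p\<close>.
\<close>

lemma path_increment_in_finer_space:
  assumes W0: "normed W0" and W: "normed W" and cp: "ncomplete W" and inc: "bounded_lin_map W W0 (\<lambda>x. x)"
    and \<phi>: "\<And>t. t \<in> {0..1} \<Longrightarrow> \<phi> t \<in> car W0" and g: "\<And>t. t \<in> {0..1} \<Longrightarrow> g t \<in> car W"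
    and D: "path_deriv W0 \<phi> g 0 1" and c: "path_cont W g" and p: "p \<in> car W"
    and M: "\<And>t. t \<in> {0..1} \<Longrightarrow> nrm W (g t - p) \<le> M"
  shows "\<phi> 1 - \<phi> 0 \<in> car W \<and> nrm W (\<phi> 1 - \<phi> 0 - p) \<le> M"
proof -
  note n = normedD[OF W] and n0 = normedD[OF W0]
  obtain K where K: "K > 0" "\<And>x. x \<in> car W \<Longrightarrow> nrm W0 x \<le> K * nrm W x"
    using bounded_lin_mapE[OF inc W] by blast
  have sub: "x \<in> car W0" if "x \<in> car W" for x using lin_mapD(1)[OF bounded_lin_map_lin_map[OF inc]] that .
  define S where "S = (\<lambda>m. \<Sum>i<m. (1 / real m) *\<^sub>R g (real i / real m))"
  have unit: "real i / real m \<in> {0..1}" if "i \<le> m" for i m :: nat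
    using that by (cases "m = 0") auto
  have gi: "g (real i / real m) \<in> car W" if "i < m" for i m using g unit that by simp
  have Si: "S m \<in> car W" for m unfolding S_def using gi n(4) by (intro car_sum[OF W]) auto
  \<comment> \<open>Sums over \<open>m\<close> and over \<open>m k\<close> points are compared by grouping the finer one into \<open>m\<close> blocks of \<open>k\<close>
    terms; two arbitrary sums are then compared through their common refinement.\<close>
  have refine: "nrm W (S m - S (m * k)) \<le> \<eta>" if d: "m > 0" "k > 0"
     "\<And>s t. s \<in> {0..1} \<Longrightarrow> t \<in> {0..1} \<Longrightarrow> \<bar>t - s\<bar> < 1 / real m \<Longrightarrow> nrm W (g t - g s) \<le> \<eta>" for m k \<eta>
  proof -
    define q where "q = 1 / (real m * real k)"
    let ?J = "\<lambda>i. {i * k ..< i * k + k}"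
    have "S m = (\<Sum>i<m. \<Sum>j\<in>?J i. q *\<^sub>R g (real i / real m))"
      unfolding S_def q_def using d by (intro sum.cong refl) (simp add: sum_constant_scaleR)
    moreover have "S (m * k) = (\<Sum>i<m. \<Sum>j\<in>?J i. q *\<^sub>R g (real j / (real m * real k)))"
      unfolding S_def q_def by (simp add: sum.nat_group)
    ultimately have eq: "S m - S (m * k) =
        (\<Sum>i<m. \<Sum>j\<in>?J i. q *\<^sub>R (g (real i / real m) - g (real j / (real m * real k))))"
      by (simp add: sum_subtractf scaleR_diff_right)
    have piece: "q *\<^sub>R (g (real i / real m) - g (real j / (real m * real k))) \<in> car W \<and>
        nrm W (q *\<^sub>R (g (real i / real m) - g (real j / (real m * real k)))) \<le> q * \<eta>"
      if ij: "i < m" "j \<in> ?J i" for i j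
    proof -
      have "j < Suc i * k" using ij by simp
      also have "\<dots> \<le> m * k" using ij by (intro mult_right_mono) auto
      finally have "j < m * k" .
      then have u: "real j / (real m * real k) \<in> {0..1}" using unit[of j "m * k"] by simp
      have u': "real i / real m \<in> {0..1}" using unit ij by simp
      have "real i / real m - real j / (real m * real k) = - ((real j - real i * real k) / (real m * real k))"
        using d by (simp add: field_simps)
      then have "\<bar>real i / real m - real j / (real m * real k)\<bar> = \<bar>real j - real i * real k\<bar> / (real m * real k)"
        by simp
      also have "\<dots> < real k / (real m * real k)"
      proof (rule divide_strict_right_mono)
        have "real i * real k \<le> real j" "real j < real i * real k + real k"
          using ij(2) by (simp_all flip: of_nat_mult of_nat_add)
        then show "\<bar>real j - real i * real k\<bar> < real k" by linarith
      qed (use d in simp)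
      also have "\<dots> = 1 / real m" using d(2) by simp
      finally have "\<bar>real i / real m - real j / (real m * real k)\<bar> < 1 / real m" .
      then have "nrm W (g (real i / real m) - g (real j / (real m * real k))) \<le> \<eta>"
        by (rule d(3)[OF u u'])
      moreover have "g (real i / real m) - g (real j / (real m * real k)) \<in> car W"
        using g u u' n(3) by blast
      ultimately show ?thesis
        using n(4) n(7) d(1,2) by (auto simp: q_def intro!: divide_right_mono)
    qed
    have "nrm W (S m - S (m * k)) \<le> (\<Sum>i<m. \<Sum>j\<in>?J i. q * \<eta>)"
      unfolding eq using piece
      by (intro order_trans[OF nrm_sum_le[OF W]] sum_mono car_sum[OF W]) auto
    also have "\<dots> = \<eta>" using d(1,2) by (simp add: q_def)
    finally show ?thesis .
  qed
  have mesh: "\<exists>N>0. \<forall>m\<ge>N. \<forall>s\<in>{0..1}. \<forall>t\<in>{0..1}. \<bar>t - s\<bar> \<le> 1 / real m \<longrightarrow> nrm W (g t - g s) \<le> \<eta>"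
    if "\<eta> > 0" for \<eta>
  proof -
    obtain d where d: "d > 0" "\<And>s t. s \<in> {0..1} \<Longrightarrow> t \<in> {0..1} \<Longrightarrow> \<bar>t - s\<bar> < d \<Longrightarrow> nrm W (g t - g s) < \<eta>"
      using path_cont_uniform[OF W g c \<open>\<eta> > 0\<close>] by blast
    obtain N where N: "inverse (real (Suc N)) < d" using reals_Archimedean[OF d(1)] by blast
    have "1 / real m < d" if "m \<ge> Suc N" for m
    proof -
      have "1 / real m \<le> 1 / real (Suc N)" using that by (intro divide_left_mono) auto
      then show ?thesis using N by (simp add: inverse_eq_divide)
    qed
    then have "nrm W (g t - g s) \<le> \<eta>"
      if "m \<ge> Suc N" "s \<in> {0..1}" "t \<in> {0..1}" "\<bar>t - s\<bar> \<le> 1 / real m" for m s t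
      using d(2) that by (meson le_less_trans less_imp_le)
    then show ?thesis by (intro exI[of _ "Suc N"]) blast
  qed
  have close0: "nrm W0 (\<phi> 1 - \<phi> 0 - S m) \<le> K * \<eta>" if m: "m > 0"
     "\<forall>s\<in>{0..1}. \<forall>t\<in>{0..1}. \<bar>t - s\<bar> \<le> 1 / real m \<longrightarrow> nrm W (g t - g s) \<le> \<eta>" for m \<eta>
  proof -
    let ?x = "\<lambda>i. real i / real m"
    let ?T = "\<lambda>i. \<phi> (?x (Suc i)) - \<phi> (?x i) - (?x (Suc i) - ?x i) *\<^sub>R g (?x i)"
    have w: "?x (Suc i) - ?x i = 1 / real m" for i using m by (simp add: field_simps)
    have "(\<Sum>i<m. \<phi> (?x (Suc i)) - \<phi> (?x i)) = \<phi> 1 - \<phi> 0"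
      using sum_lessThan_telescope[of "\<lambda>i. \<phi> (?x i)" m] m by simp
    then have eq: "\<phi> 1 - \<phi> 0 - S m = (\<Sum>i<m. ?T i)"
      unfolding S_def w by (simp add: sum_subtractf)
    have T: "?T i \<in> car W0 \<and> nrm W0 (?T i) \<le> K * \<eta> * (1 / real m)" if i: "i < m" for i
    proof
      have sub_i: "{?x i..?x (Suc i)} \<subseteq> {0..1}" using unit[of i m] unit[of "Suc i" m] i by auto
      show "?T i \<in> car W0"
        using \<phi> unit[of i m] unit[of "Suc i" m] i sub[OF gi[OF i]] n0(3,4) by simp
      have "nrm W0 (?T i) \<le> (K * \<eta>) * (?x (Suc i) - ?x i)"
      proof (rule mean_value_estimate[OF W0, where g = g])
        show "path_deriv W0 \<phi> g (?x i) (?x (Suc i))"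
          using sub_i by (intro path_deriv_subset[OF D]) (auto simp: divide_right_mono)
        fix t assume t: "t \<in> {?x i..?x (Suc i)}"
        then have t1: "t \<in> {0..1}" using sub_i by blast
        have "\<bar>t - ?x i\<bar> \<le> 1 / real m" using t w[of i] by auto
        then have "nrm W (g t - g (?x i)) \<le> \<eta>" using m(2) t1 unit[of i m] i by simp
        then show "nrm W0 (g t - g (?x i)) \<le> K * \<eta>"
          using order_trans[OF K(2)[OF n(3)[OF g[OF t1] gi[OF i]]]] K(1) by simp
        show "g t \<in> car W0" "\<phi> t \<in> car W0" using sub[OF g[OF t1]] \<phi>[OF t1] .
      qed (use sub[OF gi[OF i]] in \<open>auto simp: divide_right_mono\<close>)
      then show "nrm W0 (?T i) \<le> K * \<eta> * (1 / real m)" by (simp only: w)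
    qed
    have "nrm W0 (\<Sum>i<m. ?T i) \<le> (\<Sum>i<m. K * \<eta> * (1 / real m))"
      using T by (intro order_trans[OF nrm_sum_le[OF W0]] sum_mono) auto
    also have "\<dots> = K * \<eta>" using m(1) by simp
    finally show ?thesis unfolding eq .
  qed
  have "\<exists>l. nlim W S l"
  proof (rule cp[unfolded ncomplete_def, rule_format], intro conjI allI impI)
    fix e :: real assume "e > 0"
    then obtain N where N: "N > 0" "\<forall>m\<ge>N. \<forall>s\<in>{0..1}. \<forall>t\<in>{0..1}. \<bar>t - s\<bar> \<le> 1 / real m \<longrightarrow> nrm W (g t - g s) \<le> e / 3"
      using mesh[of "e / 3"] by auto
    show "\<exists>N. \<forall>i\<ge>N. \<forall>j\<ge>N. nrm W (S i - S j) < e"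
    proof (intro exI[of _ N] allI impI)
      fix i j assume ij: "i \<ge> N" "j \<ge> N"
      have "nrm W (S i - S (i * j)) \<le> e / 3" using ij N by (intro refine) auto
      moreover have "nrm W (S j - S (j * i)) \<le> e / 3" using ij N by (intro refine) auto
      moreover have "nrm W (S i - S j) \<le> nrm W (S i - S (i * j)) + nrm W (S (i * j) - S j)"
        by (rule nrm_triangle_via[OF W Si Si Si])
      ultimately show "nrm W (S i - S j) < e"
        using \<open>e > 0\<close> nrm_minus_commute[OF W Si Si, of "i * j" j] by (simp add: mult.commute)
    qed
  qed (rule Si)
  then obtain l where l: "l \<in> car W" "(\<lambda>m. nrm W (S m - l)) \<longlonglongrightarrow> 0" by (auto simp: nlim_def)
  have near: "\<exists>m>0. nrm W (S m - l) < \<eta> \<and> (\<forall>s\<in>{0..1}. \<forall>t\<in>{0..1}. \<bar>t - s\<bar> \<le> 1 / real m \<longrightarrow> nrm W (g t - g s) \<le> \<eta>)"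
    if "\<eta> > 0" for \<eta>
  proof -
    obtain N where N: "N > 0" "\<forall>m\<ge>N. \<forall>s\<in>{0..1}. \<forall>t\<in>{0..1}. \<bar>t - s\<bar> \<le> 1 / real m \<longrightarrow> nrm W (g t - g s) \<le> \<eta>"
      using mesh[OF \<open>\<eta> > 0\<close>] by blast
    have "\<forall>\<^sub>F m in sequentially. nrm W (S m - l) < \<eta>" using l(2) that by (rule order_tendstoD(2))
    then obtain N' where "\<forall>m\<ge>N'. nrm W (S m - l) < \<eta>" by (auto simp: eventually_sequentially)
    moreover have "max N N' > 0" "max N N' \<ge> N" "max N N' \<ge> N'" using N(1) by auto
    ultimately show ?thesis using N(2) by blast
  qed
  have in0: "\<phi> 1 - \<phi> 0 \<in> car W0" using \<phi>[of 0] \<phi>[of 1] n0(3) by simp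
  have "nrm W0 (\<phi> 1 - \<phi> 0 - l) \<le> 0"
  proof (rule field_le_epsilon)
    fix e :: real assume "e > 0"
    then have "e / (2 * K) > 0" using K(1) by simp
    then obtain m where m: "m > 0" "nrm W (S m - l) < e / (2 * K)"
        "\<forall>s\<in>{0..1}. \<forall>t\<in>{0..1}. \<bar>t - s\<bar> \<le> 1 / real m \<longrightarrow> nrm W (g t - g s) \<le> e / (2 * K)"
      using near by blast
    have "nrm W0 (S m - l) \<le> K * (e / (2 * K))"
      using order_trans[OF K(2)[OF n(3)[OF Si l(1)]] mult_left_mono[OF less_imp_le[OF m(2)]]] K(1) by simp
    then have "nrm W0 (\<phi> 1 - \<phi> 0 - l) \<le> K * (e / (2 * K)) + K * (e / (2 * K))"
      using close0[OF m(1,3)] nrm_triangle_via[OF W0 in0 sub[OF Si] sub[OF l(1)], of m] by linarith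
    then show "nrm W0 (\<phi> 1 - \<phi> 0 - l) \<le> 0 + e" using K(1) by simp
  qed
  then have eq: "\<phi> 1 - \<phi> 0 = l"
    using n0(5,6)[OF n0(3)[OF in0 sub[OF l(1)]]] by simp
  have Sp: "nrm W (S m - p) \<le> M" if m: "m > 0" for m
  proof -
    have "S m - p = (\<Sum>i<m. (1 / real m) *\<^sub>R (g (real i / real m) - p))"
      using m by (simp add: S_def sum_subtractf scaleR_diff_right sum_constant_scaleR)
    also have "nrm W \<dots> \<le> (\<Sum>i<m. (1 / real m) * M)"
      using gi p n(3,4) M unit
      by (intro order_trans[OF nrm_sum_le[OF W]] sum_mono) (auto simp: n(7) intro!: divide_right_mono)
    also have "\<dots> = M" using m by simp
    finally show ?thesis .
  qed
  have "nrm W (l - p) \<le> M"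
  proof (rule field_le_epsilon)
    fix e :: real assume "e > 0"
    then obtain m where m: "m > 0" "nrm W (S m - l) < e" using near by blast
    then show "nrm W (l - p) \<le> M + e"
      using nrm_triangle_via[OF W l(1) Si p, of m] Sp[OF m(1)] nrm_minus_commute[OF W l(1) Si, of m] by linarith
  qed
  then show ?thesis using eq l(1) by simp
qed

section \<open>Domains in generating cones\<close>

definition generating_cone :: "'a::real_vector nspace \<Rightarrow> 'a set \<Rightarrow> bool" where
  "generating_cone V C \<longleftrightarrow> C \<subseteq> car V \<and> (\<forall>x\<in>C. \<forall>y\<in>C. x + y \<in> C) \<and>
     (\<forall>c\<ge>0. \<forall>x\<in>C. c *\<^sub>R x \<in> C) \<and> (\<forall>v\<in>car V. \<exists>a\<in>C. \<exists>b\<in>C. v = a - b)"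

lemma generating_coneD:
  assumes "generating_cone V C"
  shows "C \<subseteq> car V" "x \<in> C \<Longrightarrow> y \<in> C \<Longrightarrow> x + y \<in> C" "c \<ge> 0 \<Longrightarrow> x \<in> C \<Longrightarrow> c *\<^sub>R x \<in> C"
    "v \<in> car V \<Longrightarrow> \<exists>a\<in>C. \<exists>b\<in>C. v = a - b"
  using assms unfolding generating_cone_def by blast+

text \<open>
  The geometry of a relatively open subset of a partial quadrant, without coordinates: convexity of the
  cone makes \<open>U\<close> star-shaped near each of its points, as mean value estimates require, and
  generation makes derivatives at points of \<open>U\<close> unique.
\<close>

definition cone_domain :: "'a::real_vector nspace \<Rightarrow> 'a set \<Rightarrow> bool" where
  "cone_domain V U \<longleftrightarrow> (\<exists>C. generating_cone V C \<and> U \<subseteq> C \<and>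
     (\<forall>x\<in>U. \<exists>d>0. \<forall>y\<in>C. nrm V (y - x) < d \<longrightarrow> y \<in> U))"

lemma cone_domain_subset: "cone_domain V U \<Longrightarrow> U \<subseteq> car V"
  unfolding cone_domain_def using generating_coneD(1) by blast

lemma cone_domain_segment:
  assumes V: "normed V" and c: "cone_domain V U" and x: "x \<in> U"
  obtains d where "d > 0"
    "\<And>y t. y \<in> U \<Longrightarrow> nrm V (y - x) < d \<Longrightarrow> t \<in> {0..1} \<Longrightarrow> x + t *\<^sub>R (y - x) \<in> U"
proof -
  obtain C d where C: "generating_cone V C" "U \<subseteq> C"
    and d: "d > 0" "\<And>y. y \<in> C \<Longrightarrow> nrm V (y - x) < d \<Longrightarrow> y \<in> U"
    using c x unfolding cone_domain_def by blast
  note cone = generating_coneD[OF C(1)]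
  have "x + t *\<^sub>R (y - x) \<in> U" if y: "y \<in> U" "nrm V (y - x) < d" and t: "t \<in> {0..1}" for y t
  proof (rule d(2))
    have "x + t *\<^sub>R (y - x) = (1 - t) *\<^sub>R x + t *\<^sub>R y" by (simp add: algebra_simps)
    also have "\<dots> \<in> C" using x y(1) C(2) t by (intro cone(2,3)) auto
    finally show "x + t *\<^sub>R (y - x) \<in> C" .
    have yx: "y - x \<in> car V" using x y(1) C(2) cone(1) normedD(3)[OF V] by blast
    have "t * nrm V (y - x) \<le> 1 * nrm V (y - x)"
      using t normedD(5)[OF V yx] by (intro mult_right_mono) auto
    then show "nrm V (x + t *\<^sub>R (y - x) - x) < d" using y t by (simp add: normedD(7)[OF V yx])
  qed
  then show ?thesis using d(1) that by blast
qed

lemma cone_domain_directions: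
  assumes V: "normed V" and c: "cone_domain V U" and x: "x \<in> U" and v: "v \<in> car V"
  obtains a b d where "a \<in> car V" "b \<in> car V" "v = a - b" "d > 0"
    "\<And>t. 0 < t \<Longrightarrow> t < d \<Longrightarrow> x + t *\<^sub>R a \<in> U" "\<And>t. 0 < t \<Longrightarrow> t < d \<Longrightarrow> x + t *\<^sub>R b \<in> U"
proof -
  obtain C d where C: "generating_cone V C" "U \<subseteq> C"
    and d: "d > 0" "\<And>y. y \<in> C \<Longrightarrow> nrm V (y - x) < d \<Longrightarrow> y \<in> U"
    using c x unfolding cone_domain_def by blast
  note cone = generating_coneD[OF C(1)]
  obtain a b where ab: "a \<in> C" "b \<in> C" "v = a - b" using cone(4)[OF v] by blast
  then have abV: "a \<in> car V" "b \<in> car V" using cone(1) by auto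
  \<comment> \<open>a common bound for the two directions, positive even if both vanish\<close>
  define N where "N = nrm V a + nrm V b + 1"
  have N: "N > 0" "nrm V a < N" "nrm V b < N"
    using normedD(5)[OF V] abV by (auto simp: N_def add_nonneg_pos add_pos_nonneg add_strict_increasing2 add_strict_increasing)
  have dir: "x + t *\<^sub>R u \<in> U" if "u \<in> C" "nrm V u < N" "0 < t" "t < d / N" for u t
  proof (rule d(2))
    show "x + t *\<^sub>R u \<in> C" using x C(2) that by (intro cone(2,3)) auto
    have "t * nrm V u \<le> t * N" using that by simp
    also have "\<dots> < d" using that(4) N(1) by (simp add: field_simps)
    finally show "nrm V (x + t *\<^sub>R u - x) < d" using that(3) normedD(7)[OF V subsetD[OF cone(1) that(1)]] by simp
  qed
  show ?thesis
    using that[OF abV ab(3), of "d / N"] dir ab N d(1) by simp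
qed

section \<open>Passing to operator-valued maps along a compact inclusion\<close>

lemma car_nsum [simp]: "car (nsum V W) = car V \<times> car W"
  and nrm_nsum [simp]: "nrm (nsum V W) (x, y) = nrm V x + nrm W y"
  by (simp_all add: nsum_def)

definition compact_incl :: "'a::real_vector nspace \<Rightarrow> 'a nspace \<Rightarrow> bool" where
  "compact_incl Y X \<longleftrightarrow> bounded_lin_map Y X (\<lambda>x. x) \<and>
     (\<forall>\<sigma>. (\<forall>n. \<sigma> n \<in> car Y \<and> nrm Y (\<sigma> n) \<le> 1) \<longrightarrow> (\<exists>r::nat \<Rightarrow> nat. \<exists>l. strict_mono r \<and> nlim X (\<sigma> \<circ> r) l))"

lemma compact_incl_bounded: "compact_incl Y X \<Longrightarrow> bounded_lin_map Y X (\<lambda>x. x)"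
  by (simp add: compact_incl_def)

lemma compact_inclE:
  assumes "compact_incl Y X" "\<And>n. \<sigma> n \<in> car Y" "\<And>n. nrm Y (\<sigma> n) \<le> 1"
  obtains r :: "nat \<Rightarrow> nat" and l where "strict_mono r" "nlim X (\<sigma> \<circ> r) l"
  using assms unfolding compact_incl_def by blast

text \<open>
  If uniformity failed, there would be \<open>y\<^sub>n \<rightarrow> x\<close> and \<open>h\<^sub>n\<close> in the unit ball of \<open>Y\<close> with \<open>\<Phi>(y\<^sub>n, h\<^sub>n)\<close> and \<open>\<Phi>(x, h\<^sub>n)\<close>
  staying apart. A subsequence of \<open>h\<^sub>n\<close> converges in \<open>X\<close> to some \<open>l\<close>, and both values tend to \<open>\<Phi>(x, l)\<close>. Linearity in
  \<open>h\<close> turns the bound on the unit ball into one proportional to the norm of \<open>h\<close>.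
\<close>

lemma compact_incl_uniform:
  assumes V: "normed V" and X: "normed X" and Y: "normed Y" and W: "normed W"
    and YX: "compact_incl Y X" and U: "U \<subseteq> car V"
    and \<Phi>: "c0_map (nsum V X) (U \<times> car X) W \<Phi>" and lin: "\<And>x. x \<in> U \<Longrightarrow> lin_map X W (\<lambda>h. \<Phi> (x, h))"
    and x: "x \<in> U" and "e > 0"
  obtains d where "d > 0"
    "\<And>y h. y \<in> U \<Longrightarrow> nrm V (y - x) < d \<Longrightarrow> h \<in> car Y \<Longrightarrow> nrm W (\<Phi> (y, h) - \<Phi> (x, h)) \<le> e * nrm Y h"
proof -
  have VX: "normed (nsum V X)" using normed_nsum[OF V X] .
  have sub: "h \<in> car X" if "h \<in> car Y" for h
    using lin_mapD(1)[OF bounded_lin_map_lin_map[OF compact_incl_bounded[OF YX]]] that .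
  have \<Phi>i: "\<Phi> (y, h) \<in> car W" if "y \<in> U" "h \<in> car X" for y h
    using c0_mapD(1)[OF \<Phi> VX W, of "(y, h)"] that U by auto
  have "\<exists>d>0. \<forall>y\<in>U. nrm V (y - x) < d \<longrightarrow> (\<forall>h\<in>car Y. nrm Y h \<le> 1 \<longrightarrow> nrm W (\<Phi> (y, h) - \<Phi> (x, h)) \<le> e)"
  proof (rule ccontr)
    assume no: "\<not> ?thesis"
    have "\<exists>y h. y \<in> U \<and> nrm V (y - x) < 1 / real (Suc n) \<and> h \<in> car Y \<and> nrm Y h \<le> 1 \<and>
        \<not> nrm W (\<Phi> (y, h) - \<Phi> (x, h)) \<le> e" for n
      using no by (meson of_nat_0_less_iff zero_less_Suc zero_less_divide_1_iff)
    then obtain y h where yh: "\<And>n. y n \<in> U" "\<And>n. nrm V (y n - x) < 1 / real (Suc n)"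
        "\<And>n. h n \<in> car Y \<and> nrm Y (h n) \<le> 1" "\<And>n. \<not> nrm W (\<Phi> (y n, h n) - \<Phi> (x, h n)) \<le> e" by metis
    obtain r l where rl: "strict_mono r" "nlim X (h \<circ> r) l" using YX yh(3) unfolding compact_incl_def by blast
    have l: "l \<in> car X" using rl(2) by (simp add: nlim_def)
    have "\<exists>d>0. \<forall>p\<in>U \<times> car X. p \<in> car (nsum V X) \<longrightarrow> nrm (nsum V X) (p - (x, l)) < d \<longrightarrow>
        nrm W (\<Phi> p - \<Phi> (x, l)) < e / 2"
      by (rule c0_mapD(2)[OF \<Phi> VX W]) (use x l U \<open>e > 0\<close> in auto)
    then obtain d where d: "d > 0" "\<And>p. p \<in> U \<times> car X \<Longrightarrow> p \<in> car (nsum V X) \<Longrightarrow> nrm (nsum V X) (p - (x, l)) < d \<Longrightarrow>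
        nrm W (\<Phi> p - \<Phi> (x, l)) < e / 2" by blast
    have "(\<lambda>n. 1 / real (Suc (r n))) \<longlonglongrightarrow> 0"
      using LIMSEQ_subseq_LIMSEQ[OF LIMSEQ_inverse_real_of_nat rl(1)] by (simp add: o_def inverse_eq_divide)
    then have "\<forall>\<^sub>F n in sequentially. 1 / real (Suc (r n)) < d / 2"
      using d(1) by (intro order_tendstoD(2)) auto
    moreover have "\<forall>\<^sub>F n in sequentially. nrm X (h (r n) - l) < d / 2"
      using rl(2) d(1) unfolding nlim_def o_def by (intro order_tendstoD(2)) auto
    ultimately obtain n where n: "1 / real (Suc (r n)) < d / 2" "nrm X (h (r n) - l) < d / 2"
      using eventually_happens[OF eventually_conj] sequentially_bot by blast
    have hX: "h (r n) \<in> car X" using yh(3) sub by blast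
    have "nrm (nsum V X) ((y (r n), h (r n)) - (x, l)) < d" "nrm (nsum V X) ((x, h (r n)) - (x, l)) < d"
      using n yh(2)[of "r n"] nrm_0[OF V] d(1) by auto
    then have "nrm W (\<Phi> (y (r n), h (r n)) - \<Phi> (x, l)) < e / 2" "nrm W (\<Phi> (x, h (r n)) - \<Phi> (x, l)) < e / 2"
      using d(2) yh(1)[of "r n"] hX x subsetD[OF U] by auto
    then have "nrm W (\<Phi> (y (r n), h (r n)) - \<Phi> (x, h (r n))) < e"
      using nrm_triangle_via[OF W \<Phi>i[OF yh(1) hX] \<Phi>i[OF x l] \<Phi>i[OF x hX]]
        nrm_minus_commute[OF W \<Phi>i[OF x l] \<Phi>i[OF x hX]] by (smt (verit) field_sum_of_halves)
    then show False using yh(4)[of "r n"] by linarith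
  qed
  then obtain d where d: "d > 0" "\<And>y h. y \<in> U \<Longrightarrow> nrm V (y - x) < d \<Longrightarrow> h \<in> car Y \<Longrightarrow> nrm Y h \<le> 1 \<Longrightarrow>
      nrm W (\<Phi> (y, h) - \<Phi> (x, h)) \<le> e" by blast
  have "nrm W (\<Phi> (y, h) - \<Phi> (x, h)) \<le> e * nrm Y h" if y: "y \<in> U" "nrm V (y - x) < d" and h: "h \<in> car Y" for y h
  proof (cases "h = 0")
    case True
    then show ?thesis using lin_map_0[OF lin[OF y(1)] X] lin_map_0[OF lin[OF x] X] by (simp add: nrm_0 W Y)
  next
    case False
    then have p: "nrm Y h > 0" using normedD(5,6)[OF Y h] by linarith
    let ?k = "(1 / nrm Y h) *\<^sub>R h"
    have "nrm W (\<Phi> (y, ?k) - \<Phi> (x, ?k)) \<le> e"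
      using p by (intro d(2)[OF y] normedD(4)[OF Y h]) (simp add: normedD(7)[OF Y h])
    moreover have "\<Phi> (y, ?k) - \<Phi> (x, ?k) = (1 / nrm Y h) *\<^sub>R (\<Phi> (y, h) - \<Phi> (x, h))"
      using lin_mapD(3)[OF lin[OF y(1)] sub[OF h]] lin_mapD(3)[OF lin[OF x] sub[OF h]] by (simp add: scaleR_diff_right)
    ultimately show ?thesis
      using p normedD(7)[OF W normedD(3)[OF W \<Phi>i[OF y(1) sub[OF h]] \<Phi>i[OF x sub[OF h]]]] by (simp add: field_simps)
  qed
  then show ?thesis using d(1) that by blast
qed

lemma partial_op_bounded:
  assumes V: "normed V" and X: "normed X" and W: "normed W" and U: "U \<subseteq> car V"
    and \<Phi>: "c0_map (nsum V X) (U \<times> car X) W \<Phi>" and lin: "lin_map X W (\<lambda>h. \<Phi> (x, h))" and x: "x \<in> U"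
  shows "bounded_lin_map X W (\<lambda>h. \<Phi> (x, h))"
proof -
  note l = lin_mapD[OF lin]
  have x0: "\<Phi> (x, 0) = 0" using lin_map_0[OF lin X] .
  obtain d where d: "d > 0" "\<And>h. h \<in> car X \<Longrightarrow> nrm X h < d \<Longrightarrow> nrm W (\<Phi> (x, h)) < 1"
  proof -
    obtain d where "d > 0" "\<forall>p\<in>U \<times> car X. p \<in> car (nsum V X) \<longrightarrow> nrm (nsum V X) (p - (x, 0)) < d \<longrightarrow>
        nrm W (\<Phi> p - \<Phi> (x, 0)) < 1"
      using c0_mapD(2)[OF \<Phi> normed_nsum[OF V X] W, of "(x, 0)" 1] x U normedD(1)[OF X] by auto
    then show ?thesis using that[of d] x U by (auto simp: nrm_0 V x0)
  qed
  have "nrm W (\<Phi> (x, h)) \<le> (2 / d) * nrm X h" if h: "h \<in> car X" for h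
  proof (cases "h = 0")
    case True then show ?thesis using x0 by (simp add: nrm_0 X W)
  next
    case False
    then have p: "nrm X h > 0" using normedD(5,6)[OF X h] by linarith
    let ?c = "d / (2 * nrm X h)"
    have "nrm X (?c *\<^sub>R h) < d" using p d(1) by (simp add: normedD(7)[OF X h])
    then have "nrm W (\<Phi> (x, ?c *\<^sub>R h)) < 1" by (rule d(2)[OF normedD(4)[OF X h]])
    then have "?c * nrm W (\<Phi> (x, h)) < 1"
      using p d(1) by (simp add: l(3)[OF h] normedD(7)[OF W l(1)[OF h]])
    then show ?thesis using p d(1) by (simp add: field_simps)
  qed
  then show ?thesis using lin unfolding bounded_lin_map_def by blast
qed

lemma restr_of_bounded:
  assumes "bounded_lin_map Y W A" "normed Y"
  shows "restr Y A \<in> car (op_space Y W)"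
proof -
  obtain K where "K > 0" "\<And>x. x \<in> car Y \<Longrightarrow> nrm W (A x) \<le> K * nrm Y x"
    using bounded_lin_mapE[OF assms] by blast
  then show ?thesis
    using lin_mapD[OF bounded_lin_map_lin_map[OF assms(1)]] by (intro restr_op_spaceI[OF assms(2)]) auto
qed

lemma c0_map_op_of_linear_param:
  assumes V: "normed V" and X: "normed X" and Y: "normed Y" and W: "normed W"
    and YX: "compact_incl Y X" and U: "U \<subseteq> car V"
    and \<Phi>: "c0_map (nsum V X) (U \<times> car X) W \<Phi>" and lin: "\<And>x. x \<in> U \<Longrightarrow> lin_map X W (\<lambda>h. \<Phi> (x, h))"
  shows "c0_map V U (op_space Y W) (\<lambda>x. restr Y (\<lambda>h. \<Phi> (x, h)))"
  unfolding c0_map_iff[OF V normed_op_space[OF Y W]]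
proof (intro ballI conjI allI impI)
  fix x assume "x \<in> U \<inter> car V"
  then have x: "x \<in> U" by simp
  have "bounded_lin_map Y W ((\<lambda>h. \<Phi> (x, h)) \<circ> (\<lambda>x. x))"
    by (rule bounded_lin_map_compose[OF compact_incl_bounded[OF YX] partial_op_bounded[OF V X W U \<Phi> lin[OF x] x] Y X])
  then show "restr Y (\<lambda>h. \<Phi> (x, h)) \<in> car (op_space Y W)" by (intro restr_of_bounded Y) (simp add: o_def)
  fix e :: real assume "e > 0"
  then have "e / 2 > 0" by simp
  obtain d where d: "d > 0" "\<And>y h. y \<in> U \<Longrightarrow> nrm V (y - x) < d \<Longrightarrow> h \<in> car Y \<Longrightarrow>
      nrm W (\<Phi> (y, h) - \<Phi> (x, h)) \<le> e / 2 * nrm Y h"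
    using compact_incl_uniform[OF V X Y W YX U \<Phi> lin x \<open>e / 2 > 0\<close>] by blast
  show "\<exists>d>0. \<forall>y\<in>U \<inter> car V. nrm V (y - x) < d \<longrightarrow>
      nrm (op_space Y W) (restr Y (\<lambda>h. \<Phi> (y, h)) - restr Y (\<lambda>h. \<Phi> (x, h))) < e"
  proof (intro exI[of _ d] conjI d(1) ballI impI)
    fix y assume y: "y \<in> U \<inter> car V" "nrm V (y - x) < d"
    have "restr Y (\<lambda>h. \<Phi> (y, h)) - restr Y (\<lambda>h. \<Phi> (x, h)) = restr Y (\<lambda>h. \<Phi> (y, h) - \<Phi> (x, h))"
      by (auto simp: restr_def)
    moreover have "nrm (op_space Y W) (restr Y (\<lambda>h. \<Phi> (y, h) - \<Phi> (x, h))) \<le> e / 2"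
      using d(2) y \<open>e > 0\<close> by (intro op_space_nrm_restr_le[OF Y]) auto
    ultimately show "nrm (op_space Y W) (restr Y (\<lambda>h. \<Phi> (y, h)) - restr Y (\<lambda>h. \<Phi> (x, h))) < e"
      using \<open>e > 0\<close> by simp
  qed
qed

text \<open>
  The identification of \<open>L(Y, L(V, W))\<close> with \<open>L(V, L(Y, W))\<close>. Differentiating in \<open>x\<close> and then restricting
  the parameter to \<open>Y\<close> produces an element of the first space; the derivative of \<open>x \<mapsto> \<Phi>(x, \<cdot>)\<close> has to
  lie in the second.
\<close>

definition swap_op :: "'a nspace \<Rightarrow> 'b nspace \<Rightarrow> ('b \<Rightarrow> 'a \<Rightarrow> 'c::zero) \<Rightarrow> 'a \<Rightarrow> 'b \<Rightarrow> 'c" where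
  "swap_op V Y B = restr V (\<lambda>v. restr Y (\<lambda>h. B h v))"

lemma bounded_lin_map_swap_op:
  assumes V: "normed V" and Y: "normed Y" and W: "normed W"
  shows "bounded_lin_map (op_space Y (op_space V W)) (op_space V (op_space Y W)) (swap_op V Y)"
proof -
  note nO = normed_op_space[OF V W] normed_op_space[OF Y W]
  let ?L = "op_space Y (op_space V W)"
  have nL: "normed ?L" using normed_op_space[OF Y nO(1)] .
  have B1: "lin_map Y (op_space V W) B" if "B \<in> car ?L" for B
    using that by (simp add: op_space_in bounded_lin_map_def)
  have B2: "lin_map V W (B h)" if "B \<in> car ?L" "h \<in> car Y" for B h
    using lin_mapD(1)[OF B1[OF that(1)] that(2)] by (simp add: op_space_in bounded_lin_map_def)
  have bd: "nrm W (B h v) \<le> nrm ?L B * nrm V v * nrm Y h"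
    if "B \<in> car ?L" "h \<in> car Y" "v \<in> car V" for B h v
  proof -
    have "nrm W (B h v) \<le> nrm (op_space V W) (B h) * nrm V v"
      by (rule op_space_nrm_apply[OF lin_mapD(1)[OF B1[OF that(1)] that(2)] V W that(3)])
    also have "\<dots> \<le> (nrm ?L B * nrm Y h) * nrm V v"
      by (intro mult_right_mono op_space_nrm_apply[OF that(1) Y nO(1) that(2)] normedD(5)[OF V that(3)])
    finally show ?thesis by (simp add: mult_ac)
  qed
  have inner: "restr Y (\<lambda>h. B h v) \<in> car (op_space Y W) \<and>
      nrm (op_space Y W) (restr Y (\<lambda>h. B h v)) \<le> nrm ?L B * nrm V v" if B: "B \<in> car ?L" and v: "v \<in> car V" for B v
  proof
    show "restr Y (\<lambda>h. B h v) \<in> car (op_space Y W)"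
      using lin_mapD(1)[OF B2[OF B] v] lin_mapD(2,3)[OF B1[OF B]] bd[OF B _ v]
      by (intro restr_op_spaceI[OF Y]) (auto simp: plus_fun_def scaleR_fun_def)
    show "nrm (op_space Y W) (restr Y (\<lambda>h. B h v)) \<le> nrm ?L B * nrm V v"
      using bd[OF B _ v] normedD(5)[OF V v] normedD(5)[OF nL B] by (intro op_space_nrm_restr_le[OF Y]) auto
  qed
  show ?thesis
    unfolding bounded_lin_map_def lin_map_def
  proof (intro conjI funcsetI ballI allI exI)
    fix B assume B: "B \<in> car ?L"
    show "swap_op V Y B \<in> car (op_space V (op_space Y W))"
      unfolding swap_op_def
    proof (rule restr_op_spaceI[OF V])
      fix v assume v: "v \<in> car V"
      show "restr Y (\<lambda>h. B h v) \<in> car (op_space Y W)"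
        "nrm (op_space Y W) (restr Y (\<lambda>h. B h v)) \<le> nrm ?L B * nrm V v" using inner[OF B v] by auto
      show "restr Y (\<lambda>h. B h (c *\<^sub>R v)) = c *\<^sub>R restr Y (\<lambda>h. B h v)" for c
        using lin_mapD(3)[OF B2[OF B] v] by (auto simp: restr_def scaleR_fun_def)
      fix v' assume v': "v' \<in> car V"
      show "restr Y (\<lambda>h. B h (v + v')) = restr Y (\<lambda>h. B h v) + restr Y (\<lambda>h. B h v')"
        using lin_mapD(2)[OF B2[OF B] v v'] by (auto simp: restr_def plus_fun_def)
    qed
    show "swap_op V Y (c *\<^sub>R B) = c *\<^sub>R swap_op V Y B" for c
      by (auto simp: swap_op_def restr_def scaleR_fun_def fun_eq_iff)
    show "nrm (op_space V (op_space Y W)) (swap_op V Y B) \<le> 1 * nrm ?L B"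
      unfolding swap_op_def using inner[OF B] normedD(5)[OF nL B] by (intro op_space_nrm_restr_le[OF V]) auto
    fix B' assume B': "B' \<in> car ?L"
    show "swap_op V Y (B + B') = swap_op V Y B + swap_op V Y B'"
      by (auto simp: swap_op_def restr_def plus_fun_def fun_eq_iff)
  qed
qed

text \<open>The partial derivative in the first variable, extracted from a total derivative \<open>D\<close>.\<close>

definition partial1 :: "'v::real_vector nspace \<Rightarrow> ('v \<times> 'x::real_vector \<Rightarrow> 'v \<times> 'x \<Rightarrow> 'w::zero) \<Rightarrow> 'v \<times> 'x \<Rightarrow> 'v \<Rightarrow> 'w" where
  "partial1 V D p = restr V (\<lambda>v. D p (v, 0))"

lemma bounded_lin_map_inl: "normed V \<Longrightarrow> normed X \<Longrightarrow> bounded_lin_map V (nsum V X) (\<lambda>v. (v, 0))"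
  unfolding bounded_lin_map_def lin_map_def by (auto simp: normedD nrm_0 intro!: exI[of _ 1])

lemma partial1_conj_op: "partial1 V D p = conj_op V (\<lambda>v. (v, 0)) (\<lambda>x. x) (D p)"
  by (simp add: partial1_def conj_op_def)

text \<open>
  In a direction \<open>a\<close> into which one can move from \<open>x\<close> without leaving \<open>U\<close>, \<open>D (x, h) (a, 0)\<close> is the limit of the quotients
  \<open>(\<Phi>(x + t a, h) - \<Phi>(x, h)) / t\<close> for \<open>t\<close> tending to 0 from above, and these are linear in \<open>h\<close>. Differences of
  such directions exhaust \<open>V\<close>, since the cone is generating.
\<close>

lemma partial1_linear:
  assumes V: "normed V" and X: "normed X" and W: "normed W" and U: "cone_domain V U"
    and \<Phi>: "c0_map (nsum V X) (U \<times> car X) W \<Phi>" and lin: "\<And>y. y \<in> U \<Longrightarrow> lin_map X W (\<lambda>h. \<Phi> (y, h))"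
    and D: "frechet_derivative_on (nsum V X) (U \<times> car X) W \<Phi> D" and x: "x \<in> U"
    and h1: "h1 \<in> car X" and h2: "h2 \<in> car X" and v: "v \<in> car V"
  shows "D (x, c *\<^sub>R h1 + h2) (v, 0) = c *\<^sub>R D (x, h1) (v, 0) + D (x, h2) (v, 0)"
proof -
  have Us: "U \<subseteq> car V" using cone_domain_subset[OF U] .
  note VX = normed_nsum[OF V X] and n = normedD[OF W] and nX = normedD[OF X]
  have Dl: "lin_map (nsum V X) W (D (x, h))" if "h \<in> car X" for h
    using D x that by (auto simp: frechet_derivative_on_def op_space_in bounded_lin_map_def)
  have Df: "first_order_at (nsum V X) W (U \<times> car X) \<Phi> (x, h) (D (x, h))" if "h \<in> car X" for h
    using D x that by (auto simp: frechet_derivative_on_def)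
  have \<Phi>i: "\<Phi> (y, h) \<in> car W" if "y \<in> U" "h \<in> car X" for y h using lin_mapD(1)[OF lin] that by blast
  let ?h = "c *\<^sub>R h1 + h2"
  have h: "?h \<in> car X" using nX h1 h2 by simp
  let ?E = "\<lambda>a. D (x, ?h) (a, 0) - c *\<^sub>R D (x, h1) (a, 0) - D (x, h2) (a, 0)"
  have Di: "D (x, h) (a, 0) \<in> car W" if "h \<in> car X" "a \<in> car V" for h a
    using lin_mapD(1)[OF Dl[OF that(1)], of "(a, 0)"] that nX(1) by simp
  have Ei: "?E a \<in> car W" if "a \<in> car V" for a using Di h h1 h2 that n by simp
  have zero: "?E a = 0" if a: "a \<in> car V" and d: "d > 0" "\<And>t. 0 < t \<Longrightarrow> t < d \<Longrightarrow> x + t *\<^sub>R a \<in> U" for a d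
  proof -
    let ?K = "2 + \<bar>c\<bar>"
    have na: "nrm V a \<ge> 0" using normedD(5)[OF V a] .
    have est: "nrm W (?E a) \<le> e * (?K * nrm V a)" if "e > 0" for e
    proof -
      have ex: "\<exists>r>0. \<forall>t. 0 < t \<and> t < r \<longrightarrow> nrm W (\<Phi> (x + t *\<^sub>R a, k) - \<Phi> (x, k) - t *\<^sub>R D (x, k) (a, 0)) \<le> e * (t * nrm V a)"
        if k: "k \<in> car X" for k
      proof -
        obtain r where r: "r > 0" "\<And>q. q \<in> car (nsum V X) \<Longrightarrow> nrm (nsum V X) q < r \<Longrightarrow> (x, k) + q \<in> U \<times> car X \<Longrightarrow>
            nrm W (\<Phi> ((x, k) + q) - \<Phi> (x, k) - D (x, k) q) \<le> e * nrm (nsum V X) q"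
          using first_order_atD[OF Df[OF k] VX W lin_map_0[OF Dl[OF k] VX] \<open>e > 0\<close>] by blast
        have "nrm W (\<Phi> (x + t *\<^sub>R a, k) - \<Phi> (x, k) - t *\<^sub>R D (x, k) (a, 0)) \<le> e * (t * nrm V a)"
          if t: "0 < t" "t < min d (r / (nrm V a + 1))" for t
        proof -
          have "t * nrm V a \<le> t * (nrm V a + 1)" using t by simp
          also have "\<dots> < r" using t na by (simp add: field_simps)
          finally have "nrm (nsum V X) (t *\<^sub>R a, 0) < r" using t by (simp add: normedD(7)[OF V a] nrm_0[OF X])
          then have "nrm W (\<Phi> ((x, k) + (t *\<^sub>R a, 0)) - \<Phi> (x, k) - D (x, k) (t *\<^sub>R a, 0)) \<le> e * nrm (nsum V X) (t *\<^sub>R a, 0)"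
            using d(2) t normedD(4)[OF V a] nX(1) k by (intro r(2)) auto
          moreover have "D (x, k) (t *\<^sub>R a, 0) = t *\<^sub>R D (x, k) (a, 0)"
            using lin_mapD(3)[OF Dl[OF k], of "(a, 0)" t] a nX(1) by simp
          ultimately show ?thesis using t by (simp add: normedD(7)[OF V a] nrm_0[OF X])
        qed
        moreover have "min d (r / (nrm V a + 1)) > 0" using d(1) r(1) na by simp
        ultimately show ?thesis by blast
      qed
      let ?R = "\<lambda>k t. \<Phi> (x + t *\<^sub>R a, k) - \<Phi> (x, k) - t *\<^sub>R D (x, k) (a, 0)"
      obtain r r1 r2 where r: "r > 0" "r1 > 0" "r2 > 0"
        "\<And>t. 0 < t \<Longrightarrow> t < r \<Longrightarrow> nrm W (?R ?h t) \<le> e * (t * nrm V a)"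
        "\<And>t. 0 < t \<Longrightarrow> t < r1 \<Longrightarrow> nrm W (?R h1 t) \<le> e * (t * nrm V a)"
        "\<And>t. 0 < t \<Longrightarrow> t < r2 \<Longrightarrow> nrm W (?R h2 t) \<le> e * (t * nrm V a)"
        using ex[OF h] ex[OF h1] ex[OF h2] by metis
      \<comment> \<open>a single step that is small enough for the expansions at \<open>c h1 + h2\<close>, \<open>h1\<close> and \<open>h2\<close>\<close>
      define t where "t = min (min r r1) (min r2 d) / 2"
      have t: "0 < t" "t < r" "t < r1" "t < r2" "t < d" using r(1-3) d(1) by (auto simp: t_def)
      have xt: "x + t *\<^sub>R a \<in> U" using d(2) t by simp
      have Ri: "?R k t \<in> car W" if "k \<in> car X" for k using \<Phi>i[OF xt] \<Phi>i[OF x] Di[OF that a] that n by simp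
      have lc: "\<Phi> (y, ?h) = c *\<^sub>R \<Phi> (y, h1) + \<Phi> (y, h2)" if "y \<in> U" for y
        using lin_mapD(2,3)[OF lin[OF that]] h1 h2 nX(4) by simp
      have "t *\<^sub>R ?E a = c *\<^sub>R ?R h1 t + ?R h2 t - ?R ?h t"
        unfolding lc[OF xt] lc[OF x] by (simp add: algebra_simps)
      then have "t * nrm W (?E a) = nrm W (c *\<^sub>R ?R h1 t + ?R h2 t - ?R ?h t)"
        using n(7)[OF Ei[OF a], of t] t(1) by simp
      also have "\<dots> \<le> (\<bar>c\<bar> * nrm W (?R h1 t) + nrm W (?R h2 t)) + nrm W (?R ?h t)"
        using nrm_triangle_diff[OF W n(2)[OF n(4)[OF Ri[OF h1]] Ri[OF h2]] Ri[OF h], of c]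
          n(8)[OF n(4)[OF Ri[OF h1]] Ri[OF h2], of c] n(7)[OF Ri[OF h1], of c] by linarith
      also have "\<dots> \<le> (\<bar>c\<bar> * (e * (t * nrm V a)) + e * (t * nrm V a)) + e * (t * nrm V a)"
        using t r(4-6) by (intro add_mono mult_left_mono) auto
      also have "\<dots> = t * (e * (?K * nrm V a))" by (simp add: algebra_simps)
      finally show ?thesis using t(1) by simp
    qed
    have "nrm W (?E a) \<le> 0"
    proof (rule field_le_epsilon)
      fix e :: real assume "e > 0"
      have "nrm W (?E a) \<le> e / (?K * nrm V a + 1) * (?K * nrm V a)"
        using \<open>e > 0\<close> na by (intro est) (simp add: add_nonneg_pos)
      also have "\<dots> \<le> 0 + e"
      proof -
        have "e / (N + 1) * N \<le> e" if "N \<ge> 0" for N using \<open>e > 0\<close> that by (simp add: field_simps)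
        then show ?thesis using na by simp
      qed
      finally show "nrm W (?E a) \<le> 0 + e" .
    qed
    then show ?thesis using n(5,6)[OF Ei[OF a]] by simp
  qed
  obtain a b d where ab: "a \<in> car V" "b \<in> car V" "v = a - b" "d > 0"
    "\<And>t. 0 < t \<Longrightarrow> t < d \<Longrightarrow> x + t *\<^sub>R a \<in> U" "\<And>t. 0 < t \<Longrightarrow> t < d \<Longrightarrow> x + t *\<^sub>R b \<in> U"
    using cone_domain_directions[OF V U x v] by blast
  have sub: "D (x, k) (v, 0) = D (x, k) (a, 0) - D (x, k) (b, 0)" if "k \<in> car X" for k
    using lin_map_diff[OF Dl[OF that] VX, of "(a, 0)" "(b, 0)"] ab(1-3) nX(1) by simp
  have "?E v = ?E a - ?E b"
    unfolding sub[OF h] sub[OF h1] sub[OF h2] by (simp add: algebra_simps)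
  then have "?E v = 0" using zero[OF ab(1,4,5)] zero[OF ab(2,4,6)] by simp
  then show ?thesis by (simp add: algebra_simps)
qed

text \<open>
  For fixed \<open>h\<close>, the mean value estimate on the segment from \<open>x\<close> to \<open>x + v\<close> bounds the remainder of \<open>\<Phi>(\<cdot>, h)\<close> by
  the variation of \<open>D\<^sub>1\<Phi>(\<cdot>, h) v\<close> along it. Being linear in \<open>h\<close>, \<open>D\<^sub>1\<Phi>\<close> satisfies the hypotheses of
  \<open>compact_incl_uniform\<close>, so that this variation is at most \<open>e |h| |v|\<close> simultaneously for all \<open>h\<close> in \<open>Y\<close>,
  which is an estimate in operator norm.
\<close>

lemma frechet_derivative_op_of_linear_param:
  assumes V: "normed V" and X: "normed X" and Y: "normed Y" and W: "normed W"
    and YX: "compact_incl Y X" and U: "cone_domain V U"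
    and \<Phi>: "c0_map (nsum V X) (U \<times> car X) W \<Phi>" and lin: "\<And>x. x \<in> U \<Longrightarrow> lin_map X W (\<lambda>h. \<Phi> (x, h))"
    and D: "frechet_derivative_on (nsum V X) (U \<times> car X) W \<Phi> D"
    and c: "c0_map (nsum V X) (U \<times> car X) (op_space V W) (partial1 V D)"
  shows "\<And>x. x \<in> U \<Longrightarrow> lin_map X (op_space V W) (\<lambda>h. partial1 V D (x, h))"
    and "frechet_derivative_on V U (op_space Y W) (\<lambda>x. restr Y (\<lambda>h. \<Phi> (x, h)))
      (\<lambda>x. swap_op V Y (restr Y (\<lambda>h. partial1 V D (x, h))))"
proof -
  let ?\<Psi> = "partial1 V D"
  have Us: "U \<subseteq> car V" using cone_domain_subset[OF U] .
  note VX = normed_nsum[OF V X] and nO = normed_op_space[OF V W] normed_op_space[OF Y W]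
  have sub: "h \<in> car X" if "h \<in> car Y" for h
    using lin_mapD(1)[OF bounded_lin_map_lin_map[OF compact_incl_bounded[OF YX]]] that .
  have Dl: "lin_map (nsum V X) W (D (x, h))" if "x \<in> U" "h \<in> car X" for x h
    using D that by (auto simp: frechet_derivative_on_def op_space_in bounded_lin_map_def)
  have Di: "D (x, h) (v, 0) \<in> car W" if "x \<in> U" "h \<in> car X" "v \<in> car V" for x h v
    using lin_mapD(1)[OF Dl[OF that(1,2)], of "(v, 0)"] that normedD(1)[OF X] by simp
  have \<Phi>i: "\<Phi> (y, h) \<in> car W" if "y \<in> U" "h \<in> car X" for y h using lin_mapD(1)[OF lin] that by blast
  have D0: "D (x, 0) (v, 0) = 0" if "x \<in> U" "v \<in> car V" for x v
    using partial1_linear[OF V X W U \<Phi> lin D that(1) normedD(1)[OF X] normedD(1)[OF X] that(2), of 1]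
    by simp
  show lin\<Psi>: "lin_map X (op_space V W) (\<lambda>h. ?\<Psi> (x, h))" if x: "x \<in> U" for x
    unfolding lin_map_def
  proof (intro conjI funcsetI ballI allI)
    fix h assume h: "h \<in> car X"
    show "?\<Psi> (x, h) \<in> car (op_space V W)" using c0_mapD(1)[OF c VX nO(1), of "(x, h)"] x h Us by auto
    show "?\<Psi> (x, a *\<^sub>R h) = a *\<^sub>R ?\<Psi> (x, h)" for a
      using partial1_linear[OF V X W U \<Phi> lin D x h normedD(1)[OF X], of _ a] D0[OF x]
      by (auto simp: partial1_def restr_def scaleR_fun_def)
    fix h' assume h': "h' \<in> car X"
    show "?\<Psi> (x, h + h') = ?\<Psi> (x, h) + ?\<Psi> (x, h')"
      using partial1_linear[OF V X W U \<Phi> lin D x h h', of _ 1]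
      by (auto simp: partial1_def restr_def plus_fun_def)
  qed
  let ?F = "\<lambda>x. restr Y (\<lambda>h. \<Phi> (x, h))" and ?DF = "\<lambda>x. swap_op V Y (restr Y (\<lambda>h. ?\<Psi> (x, h)))"
  have F: "c0_map V U (op_space Y W) ?F"
    by (rule c0_map_op_of_linear_param[OF V X Y W YX Us \<Phi> lin])
  have \<Psi>op: "c0_map V U (op_space Y (op_space V W)) (\<lambda>x. restr Y (\<lambda>h. ?\<Psi> (x, h)))"
    by (rule c0_map_op_of_linear_param[OF V X Y nO(1) YX Us c lin\<Psi>])
  have DF: "?DF x \<in> car (op_space V (op_space Y W))" if "x \<in> U" for x
    using lin_mapD(1)[OF bounded_lin_map_lin_map[OF bounded_lin_map_swap_op[OF V Y W]]]
      c0_mapD(1)[OF \<Psi>op V normed_op_space[OF Y nO(1)]] that Us by blast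
  show "frechet_derivative_on V U (op_space Y W) ?F ?DF"
    unfolding frechet_derivative_on_def
  proof (intro ballI conjI)
    fix x assume x: "x \<in> U"
    show "?DF x \<in> car (op_space V (op_space Y W))" using DF[OF x] .
    show "first_order_at V (op_space Y W) U ?F x (?DF x)"
    proof (rule first_order_atI[OF V nO(2) _ x])
      show "?F y \<in> car (op_space Y W)" if "y \<in> U" for y
        using c0_mapD(1)[OF F V nO(2) that] that Us by blast
      show "?DF x v \<in> car (op_space Y W)" if "v \<in> car V" for v
        using DF[OF x] that lin_mapD(1)[OF bounded_lin_map_lin_map] by (metis op_space_in)
      fix e :: real assume "e > 0"
      obtain d1 where d1: "d1 > 0" "\<And>y h. y \<in> U \<Longrightarrow> nrm V (y - x) < d1 \<Longrightarrow> h \<in> car Y \<Longrightarrow>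
          nrm (op_space V W) (?\<Psi> (y, h) - ?\<Psi> (x, h)) \<le> e * nrm Y h"
        using compact_incl_uniform[OF V X Y nO(1) YX Us c lin\<Psi> x \<open>e > 0\<close>] by blast
      obtain d2 where d2: "d2 > 0"
          "\<And>y t. y \<in> U \<Longrightarrow> nrm V (y - x) < d2 \<Longrightarrow> t \<in> {0..1} \<Longrightarrow> x + t *\<^sub>R (y - x) \<in> U"
        using cone_domain_segment[OF V U x] by blast
      show "\<exists>d>0. \<forall>v\<in>car V. nrm V v < d \<longrightarrow> x + v \<in> U \<longrightarrow>
          nrm (op_space Y W) (?F (x + v) - ?F x - ?DF x v) \<le> e * nrm V v"
      proof (intro exI[of _ "min d1 d2"] conjI ballI impI)
        show "min d1 d2 > 0" using d1(1) d2(1) by simp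
        fix v assume v: "v \<in> car V" "nrm V v < min d1 d2" "x + v \<in> U"
        have nv: "nrm V v \<ge> 0" using normedD(5)[OF V v(1)] .
        have seg: "x + t *\<^sub>R v \<in> U" "nrm V (x + t *\<^sub>R v - x) < d1" if t: "t \<in> {0..1}" for t
        proof -
          show "x + t *\<^sub>R v \<in> U" using d2(2)[OF v(3) _ t] v(2) by simp
          have "t * nrm V v \<le> 1 * nrm V v" using t nv by (intro mult_right_mono) auto
          then show "nrm V (x + t *\<^sub>R v - x) < d1" using v t by (simp add: normedD(7)[OF V v(1)])
        qed
        have "nrm W (\<Phi> (x + v, h) - \<Phi> (x, h) - D (x, h) (v, 0)) \<le> e * nrm V v * nrm Y h" if h: "h \<in> car Y" for h
        proof -
          have hX: "h \<in> car X" using sub[OF h] .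
          let ?g = "\<lambda>t. D (x + t *\<^sub>R v, h) (v, 0)"
          have eq: "(x, h) + t *\<^sub>R (v, 0) = (x + t *\<^sub>R v, h)" for t by simp
          have "nrm W (\<Phi> (x + 1 *\<^sub>R v, h) - \<Phi> (x + 0 *\<^sub>R v, h) - (1 - 0) *\<^sub>R D (x, h) (v, 0)) \<le> (e * nrm Y h * nrm V v) * (1 - 0)"
          proof (rule mean_value_estimate[OF W, where g = ?g])
            have "path_deriv W (\<lambda>t. \<Phi> ((x, h) + t *\<^sub>R (v, 0))) (\<lambda>t. D (x + t *\<^sub>R v, h) (v, 0)) 0 1"
            proof (rule path_deriv_of_first_order[OF VX W, where U = "U \<times> car X" and A = "\<lambda>t. D (x + t *\<^sub>R v, h)"])
              show "(v, 0) \<in> car (nsum V X)" using v(1) normedD(1)[OF X] by simp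
              fix s :: real assume s: "s \<in> {0..1}"
              show "(x, h) + s *\<^sub>R (v, 0) \<in> U \<times> car X" using seg(1)[OF s] hX by simp
              show "first_order_at (nsum V X) W (U \<times> car X) \<Phi> ((x, h) + s *\<^sub>R (v, 0)) (D (x + s *\<^sub>R v, h))"
                using D seg(1)[OF s] hX unfolding eq by (auto simp: frechet_derivative_on_def)
              show "D (x + s *\<^sub>R v, h) (a *\<^sub>R (v, 0)) = a *\<^sub>R D (x + s *\<^sub>R v, h) (v, 0)" for a
                using v(1) normedD(1)[OF X] by (intro lin_mapD(3)[OF Dl[OF seg(1)[OF s] hX]]) simp
            qed
            then show "path_deriv W (\<lambda>t. \<Phi> (x + t *\<^sub>R v, h)) ?g 0 1" unfolding eq .
            fix t :: real assume t: "t \<in> {0..1}"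
            show "\<Phi> (x + t *\<^sub>R v, h) \<in> car W" "?g t \<in> car W" using \<Phi>i Di seg(1)[OF t] hX v(1) by blast+
            have "?g t - D (x, h) (v, 0) = (?\<Psi> (x + t *\<^sub>R v, h) - ?\<Psi> (x, h)) v"
              using v(1) by (simp add: partial1_def fun_diff_def)
            also have "nrm W \<dots> \<le> nrm (op_space V W) (?\<Psi> (x + t *\<^sub>R v, h) - ?\<Psi> (x, h)) * nrm V v"
              by (intro op_space_nrm_apply[OF _ V W v(1)] normedD(3)[OF nO(1)] lin_mapD(1)[OF lin\<Psi>] seg(1) t x hX)
            also have "\<dots> \<le> (e * nrm Y h) * nrm V v"
              by (intro mult_right_mono d1(2) seg t h nv)
            finally show "nrm W (?g t - D (x, h) (v, 0)) \<le> e * nrm Y h * nrm V v" .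
          qed (use Di[OF x hX v(1)] in auto)
          then show ?thesis by (simp add: mult_ac)
        qed
        moreover have "?F (x + v) - ?F x - ?DF x v = restr Y (\<lambda>h. \<Phi> (x + v, h) - \<Phi> (x, h) - D (x, h) (v, 0))"
          using v(1) by (auto simp: restr_def swap_op_def partial1_def fun_diff_def)
        ultimately show "nrm (op_space Y W) (?F (x + v) - ?F x - ?DF x v) \<le> e * nrm V v"
          using \<open>e > 0\<close> nv by (simp add: op_space_nrm_restr_le[OF Y])
      qed
    qed
  qed
qed

text \<open>
  The step replaces \<open>\<Phi>\<close> by \<open>D\<^sub>1\<Phi>\<close> and the target \<open>W\<close> by \<open>L(V, W)\<close>. Since an induction cannot change types,
  targets consist of functions on lists, among which \<^const>\<open>uncurry_op\<close> embeds \<open>L(V, W)\<close>.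
\<close>

lemma c_map_op_of_linear_param_coded:
  fixes V :: "'v::real_vector nspace" and X Y :: "'x::real_vector nspace"
    and W :: "('v list \<Rightarrow> 'b::real_vector) nspace"
  assumes V: "normed V" and X: "normed X" and Y: "normed Y" and W: "normed W"
    and YX: "compact_incl Y X" and U: "cone_domain V U"
    and \<Phi>: "c_map l (nsum V X) (U \<times> car X) W \<Phi>" and lin: "\<And>x. x \<in> U \<Longrightarrow> lin_map X W (\<lambda>h. \<Phi> (x, h))"
  shows "c_map l V U (op_space Y W) (\<lambda>x. restr Y (\<lambda>h. \<Phi> (x, h)))"
  using W \<Phi> lin
proof (induction l arbitrary: W \<Phi>)
  case 0
  then show ?case
    using c0_map_op_of_linear_param[OF V X Y 0(1) YX cone_domain_subset[OF U] _ 0(3)]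
    by (simp add: c_map_0 V X Y normed_op_space normed_nsum)
next
  case (Suc l)
  note W = Suc.prems(1) and lin = Suc.prems(3)
  have Us: "U \<subseteq> car V" using cone_domain_subset[OF U] .
  note VX = normed_nsum[OF V X] and nO = normed_op_space[OF V W] normed_op_space[OF Y W]
  have UX: "U \<times> car X \<subseteq> car (nsum V X)" using Us by auto
  obtain D where \<Phi>: "c0_map (nsum V X) (U \<times> car X) W \<Phi>"
    and D: "frechet_derivative_on (nsum V X) (U \<times> car X) W \<Phi> D"
    and T: "c_map l (nsum V X) (U \<times> car X) (op_space (nsum V X) W) D"
    using Suc.prems(2) unfolding c_map_Suc[OF VX W UX] by blast
  have p: "bounded_lin_map (op_space (nsum V X) W) (op_space V W) (conj_op V (\<lambda>v. (v, 0)) (\<lambda>x. x))"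
    by (rule bounded_lin_map_conj_op[OF bounded_lin_map_inl[OF V X] bounded_lin_map_id VX V W W])
  have T1: "c_map l (nsum V X) (U \<times> car X) (op_space V W) (partial1 V D)"
    by (rule c_map_compose[OF bounded_lin_map_id p VX VX normed_op_space[OF VX W] nO(1) _ UX UX _ T])
      (simp_all add: partial1_conj_op)
  have c: "c0_map (nsum V X) (U \<times> car X) (op_space V W) (partial1 V D)"
    by (rule c_map_imp_c0_map[OF VX nO(1) UX T1])
  have d1: "lin_map X (op_space V W) (\<lambda>h. partial1 V D (x, h))" if "x \<in> U" for x
    by (rule frechet_derivative_op_of_linear_param(1)[OF V X Y W YX U \<Phi> lin D c that])
  have d2: "frechet_derivative_on V U (op_space Y W) (\<lambda>x. restr Y (\<lambda>h. \<Phi> (x, h)))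
      (\<lambda>x. swap_op V Y (restr Y (\<lambda>h. partial1 V D (x, h))))"
    by (rule frechet_derivative_op_of_linear_param(2)[OF V X Y W YX U \<Phi> lin D c])
  have f0: "c0_map V U (op_space Y W) (\<lambda>x. restr Y (\<lambda>h. \<Phi> (x, h)))"
    by (rule c0_map_op_of_linear_param[OF V X Y W YX Us \<Phi> lin])
  let ?W = "nimage uncurry_op (op_space V W)"
  have nW: "normed ?W" using lin_isometry_normed[OF lin_isometry_uncurry_op nO(1)] .
  have cu: "bounded_lin_map (op_space V W) ?W uncurry_op" "bounded_lin_map ?W (op_space V W) curry_op"
    by (rule lin_isometry_imp_bounded, rule lin_isometry_uncurry_op lin_isometry_curry_op)+
  have T2: "c_map l (nsum V X) (U \<times> car X) ?W (\<lambda>p. uncurry_op (partial1 V D p))"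
    by (rule c_map_compose[OF bounded_lin_map_id cu(1) VX VX nO(1) nW _ UX UX _ T1]) simp_all
  have lin2: "lin_map X ?W (\<lambda>h. uncurry_op (partial1 V D (x, h)))" if "x \<in> U" for x
    using lin_mapD[OF d1[OF that]] lin_mapD[OF bounded_lin_map_lin_map[OF cu(1)]]
    unfolding lin_map_def by auto
  have T3: "c_map l V U (op_space Y ?W) (\<lambda>x. restr Y (\<lambda>h. uncurry_op (partial1 V D (x, h))))"
    by (rule Suc.IH[OF nW T2 lin2])
  have q: "bounded_lin_map (op_space Y ?W) (op_space V (op_space Y W)) (swap_op V Y \<circ> conj_op Y (\<lambda>h. h) curry_op)"
    by (intro bounded_lin_map_compose[OF bounded_lin_map_conj_op[OF bounded_lin_map_id cu(2)]]
        bounded_lin_map_swap_op V Y W nW nO normed_op_space)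
  have "c_map l V U (op_space V (op_space Y W)) (\<lambda>x. swap_op V Y (restr Y (\<lambda>h. partial1 V D (x, h))))"
    by (rule c_map_compose[OF bounded_lin_map_id q V V normed_op_space[OF Y nW] normed_op_space[OF V nO(2)] _ Us Us _ T3])
      (auto simp: conj_op_def restr_def cong: if_cong)
  then show ?case
    unfolding c_map_Suc[OF V nO(2) Us]
    using f0 d2 by blast
qed

lemma c_map_op_of_linear_param:
  fixes V :: "'v::real_vector nspace" and X Y :: "'x::real_vector nspace" and W :: "'w::real_vector nspace"
  assumes V: "normed V" and X: "normed X" and Y: "normed Y" and W: "normed W"
    and YX: "compact_incl Y X" and U: "cone_domain V U"
    and \<Phi>: "c_map l (nsum V X) (U \<times> car X) W \<Phi>" and lin: "\<And>x. x \<in> U \<Longrightarrow> lin_map X W (\<lambda>h. \<Phi> (x, h))"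
  shows "c_map l V U (op_space Y W) (\<lambda>x. restr Y (\<lambda>h. \<Phi> (x, h)))"
proof -
  let ?W = "nimage leaf W :: ('v list \<Rightarrow> 'w) nspace"
  have Us: "U \<subseteq> car V" using cone_domain_subset[OF U] .
  note VX = normed_nsum[OF V X]
  have UX: "U \<times> car X \<subseteq> car (nsum V X)" using Us by auto
  have nW: "normed ?W" using lin_isometry_normed[OF lin_isometry_leaf W] .
  have b: "bounded_lin_map W ?W leaf" "bounded_lin_map ?W W unleaf"
    by (rule lin_isometry_imp_bounded, rule lin_isometry_leaf lin_isometry_unleaf)+
  have 1: "c_map l (nsum V X) (U \<times> car X) ?W (\<lambda>p. leaf (\<Phi> p))"
    by (rule c_map_compose[OF bounded_lin_map_id b(1) VX VX W nW _ UX UX _ \<Phi>]) simp_all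
  have 2: "lin_map X ?W (\<lambda>h. leaf (\<Phi> (x, h)))" if "x \<in> U" for x
    using lin_mapD[OF lin[OF that]] lin_mapD[OF bounded_lin_map_lin_map[OF b(1)]]
    unfolding lin_map_def by auto
  have 3: "c_map l V U (op_space Y ?W) (\<lambda>x. restr Y (\<lambda>h. leaf (\<Phi> (x, h))))"
    by (rule c_map_op_of_linear_param_coded[OF V X Y nW YX U 1 2])
  have q: "bounded_lin_map (op_space Y ?W) (op_space Y W) (conj_op Y (\<lambda>h. h) unleaf)"
    by (rule bounded_lin_map_conj_op[OF bounded_lin_map_id b(2) Y Y nW W])
  show ?thesis
    by (rule c_map_compose[OF bounded_lin_map_id q V V normed_op_space[OF Y nW] normed_op_space[OF Y W] _ Us Us _ 3])
      (auto simp: conj_op_def restr_def)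
qed

section \<open>Differentiability into a finer space\<close>

text \<open>
  The path \<open>t \<mapsto> f(x + t h)\<close> has derivative \<open>\<Phi>(x + t h, h)\<close> for the norm of \<open>W0\<close>, so its increment is
  controlled in \<open>W\<close> by \<open>path_increment_in_finer_space\<close> with \<open>p = \<Phi>(x, h)\<close>. The bound \<open>e |h|\<close> needs the compact
  inclusion of \<open>V\<close> in \<open>X\<close>: continuity of \<open>\<Phi>\<close> on \<open>U \<times> X\<close> alone gives no rate in \<open>h\<close>.
\<close>

lemma first_order_at_finer_target:
  assumes V: "normed V" and X: "normed X" and W: "normed W" and W0: "normed W0"
    and cp: "ncomplete W" and inc: "bounded_lin_map W W0 (\<lambda>x. x)" and VX: "compact_incl V X"
    and U: "cone_domain V U" and f: "\<And>y. y \<in> U \<Longrightarrow> f y \<in> car W"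
    and \<Phi>: "c0_map (nsum V X) (U \<times> car X) W \<Phi>" and lin: "\<And>x. x \<in> U \<Longrightarrow> lin_map X W (\<lambda>h. \<Phi> (x, h))"
    and D: "\<And>x. x \<in> U \<Longrightarrow> first_order_at V W0 U f x (\<lambda>h. \<Phi> (x, h))" and x: "x \<in> U"
  shows "first_order_at V W U f x (\<lambda>h. \<Phi> (x, h))"
proof (rule first_order_atI[OF V W f x])
  have Us: "U \<subseteq> car V" using cone_domain_subset[OF U] .
  have sub: "h \<in> car X" if "h \<in> car V" for h
    using lin_mapD(1)[OF bounded_lin_map_lin_map[OF compact_incl_bounded[OF VX]]] that .
  have \<Phi>i: "\<Phi> (y, h) \<in> car W" if "y \<in> U" "h \<in> car V" for y h
    using lin_mapD(1)[OF lin] that sub by blast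
  show "\<Phi> (x, h) \<in> car W" if "h \<in> car V" for h using \<Phi>i x that by blast
  fix e :: real assume "e > 0"
  obtain d1 where d1: "d1 > 0" "\<And>y h. y \<in> U \<Longrightarrow> nrm V (y - x) < d1 \<Longrightarrow> h \<in> car V \<Longrightarrow>
      nrm W (\<Phi> (y, h) - \<Phi> (x, h)) \<le> e * nrm V h"
    using compact_incl_uniform[OF V X V W VX Us \<Phi> lin x \<open>e > 0\<close>] by blast
  obtain d2 where d2: "d2 > 0"
      "\<And>y t. y \<in> U \<Longrightarrow> nrm V (y - x) < d2 \<Longrightarrow> t \<in> {0..1} \<Longrightarrow> x + t *\<^sub>R (y - x) \<in> U"
    using cone_domain_segment[OF V U x] by blast
  show "\<exists>d>0. \<forall>h\<in>car V. nrm V h < d \<longrightarrow> x + h \<in> U \<longrightarrow> nrm W (f (x + h) - f x - \<Phi> (x, h)) \<le> e * nrm V h"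
  proof (intro exI[of _ "min d1 d2"] conjI ballI impI)
    show "min d1 d2 > 0" using d1(1) d2(1) by simp
    fix h assume h: "h \<in> car V" "nrm V h < min d1 d2" "x + h \<in> U"
    have nh: "nrm V h \<ge> 0" using normedD(5)[OF V h(1)] .
    have seg: "x + t *\<^sub>R h \<in> U" "nrm V (x + t *\<^sub>R h - x) < d1" if t: "t \<in> {0..1}" for t
    proof -
      show "x + t *\<^sub>R h \<in> U" using d2(2)[OF h(3) _ t] h(2) by simp
      have "t * nrm V h \<le> 1 * nrm V h" using t nh by (intro mult_right_mono) auto
      then show "nrm V (x + t *\<^sub>R h - x) < d1" using h t by (simp add: normedD(7)[OF V h(1)])
    qed
    let ?g = "\<lambda>t. \<Phi> (x + t *\<^sub>R h, h)"
    have "f (x + 1 *\<^sub>R h) - f (x + 0 *\<^sub>R h) \<in> car W \<and>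
        nrm W (f (x + 1 *\<^sub>R h) - f (x + 0 *\<^sub>R h) - \<Phi> (x, h)) \<le> e * nrm V h"
    proof (rule path_increment_in_finer_space[OF W0 W cp inc, where g = ?g])
      show "path_deriv W0 (\<lambda>t. f (x + t *\<^sub>R h)) ?g 0 1"
        by (rule path_deriv_of_first_order[OF V W0 h(1) seg(1), where A = "\<lambda>t k. \<Phi> (x + t *\<^sub>R h, k)"])
          (auto simp del: atLeastAtMost_iff intro!: D seg(1) lin_mapD(3)[OF lin] sub h(1))
      show "path_cont W ?g"
        unfolding path_cont_def
      proof (intro ballI allI impI)
        fix s r :: real assume s: "s \<in> {0..1}" and "r > 0"
        have "\<exists>d>0. \<forall>p\<in>U \<times> car X. p \<in> car (nsum V X) \<longrightarrow> nrm (nsum V X) (p - (x + s *\<^sub>R h, h)) < d \<longrightarrow>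
            nrm W (\<Phi> p - ?g s) < r"
          by (rule c0_mapD(2)[OF \<Phi> normed_nsum[OF V X] W]) (use seg(1)[OF s] sub[OF h(1)] Us \<open>r > 0\<close> in auto)
        then obtain d where d: "d > 0" "\<And>p. p \<in> U \<times> car X \<Longrightarrow> p \<in> car (nsum V X) \<Longrightarrow>
            nrm (nsum V X) (p - (x + s *\<^sub>R h, h)) < d \<Longrightarrow> nrm W (\<Phi> p - ?g s) < r" by blast
        show "\<exists>d>0. \<forall>t\<in>{0..1}. \<bar>t - s\<bar> < d \<longrightarrow> nrm W (?g t - ?g s) < r"
        proof (intro exI[of _ "d / (nrm V h + 1)"] conjI ballI impI)
          show "d / (nrm V h + 1) > 0" using d(1) nh by simp
          fix t assume t: "t \<in> {0..1}" "\<bar>t - s\<bar> < d / (nrm V h + 1)"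
          have "\<bar>t - s\<bar> * nrm V h \<le> \<bar>t - s\<bar> * (nrm V h + 1)" by (simp add: mult_left_mono)
          also have "\<dots> < d" using t(2) nh by (simp add: pos_less_divide_eq)
          finally have "nrm V ((t - s) *\<^sub>R h) < d" by (simp add: normedD(7)[OF V h(1)])
          then have "nrm (nsum V X) ((x + t *\<^sub>R h, h) - (x + s *\<^sub>R h, h)) < d"
            by (simp add: nrm_0[OF X] scaleR_diff_left)
          then show "nrm W (?g t - ?g s) < r"
            using seg(1)[OF t(1)] sub[OF h(1)] Us by (intro d(2)) auto
        qed
      qed
      fix t :: real assume t: "t \<in> {0..1}"
      show "f (x + t *\<^sub>R h) \<in> car W0" using lin_mapD(1)[OF bounded_lin_map_lin_map[OF inc]] f seg(1)[OF t] by blast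
      show "?g t \<in> car W" using \<Phi>i seg(1)[OF t] h(1) by blast
      show "nrm W (?g t - \<Phi> (x, h)) \<le> e * nrm V h" by (rule d1(2)[OF seg[OF t] h(1)])
    qed (rule \<Phi>i[OF x h(1)])
    then show "nrm W (f (x + h) - f x - \<Phi> (x, h)) \<le> e * nrm V h" by simp
  qed
qed

section \<open>Sources and targets of sc-maps\<close>

lemma cone_domain_nsum:
  assumes V: "normed V" and X: "normed X" and U: "cone_domain V U"
  shows "cone_domain (nsum V X) (U \<times> car X)"
proof -
  obtain C where C: "generating_cone V C" "U \<subseteq> C"
      and d: "\<And>x. x \<in> U \<Longrightarrow> \<exists>d>0. \<forall>y\<in>C. nrm V (y - x) < d \<longrightarrow> y \<in> U"
    using U unfolding cone_domain_def by blast
  note cone = generating_coneD[OF C(1)] and n = normedD[OF X]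
  have "generating_cone (nsum V X) (C \<times> car X)"
    unfolding generating_cone_def
  proof (intro conjI ballI allI impI)
    fix p assume "p \<in> car (nsum V X)"
    then obtain v k where p: "p = (v, k)" "v \<in> car V" "k \<in> car X" by auto
    obtain a b where "a \<in> C" "b \<in> C" "v = a - b" using cone(4)[OF p(2)] by blast
    then show "\<exists>q\<in>C \<times> car X. \<exists>r\<in>C \<times> car X. p = q - r"
      using p n(1) by (intro bexI[of _ "(a, k)"] bexI[of _ "(b, 0)"]) auto
  qed (use cone(1-3) n in auto)
  moreover have "\<exists>d>0. \<forall>q\<in>C \<times> car X. nrm (nsum V X) (q - p) < d \<longrightarrow> q \<in> U \<times> car X" if p: "p \<in> U \<times> car X" for p
  proof -
    obtain x k where p': "p = (x, k)" "x \<in> U" "k \<in> car X" using p by auto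
    obtain d where "d > 0" "\<And>y. y \<in> C \<Longrightarrow> nrm V (y - x) < d \<Longrightarrow> y \<in> U" using d[OF p'(2)] by blast
    moreover have "nrm V (y - x) \<le> nrm (nsum V X) ((y, j) - p)" if "j \<in> car X" for y j
      using n(5)[OF n(3)[OF that p'(3)]] by (simp add: p'(1))
    ultimately show ?thesis by (intro exI[of _ d]) (auto intro: le_less_trans)
  qed
  moreover have "U \<times> car X \<subseteq> C \<times> car X" using C(2) by blast
  ultimately show ?thesis unfolding cone_domain_def by blast
qed

lemma bounded_incl_nsum:
  assumes Y: "normed Y" and Y': "normed Y'"
    and b: "bounded_lin_map Y X (\<lambda>x. x)" and b': "bounded_lin_map Y' X' (\<lambda>x. x)"
  shows "bounded_lin_map (nsum Y Y') (nsum X X') (\<lambda>x. x)"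
proof -
  obtain K where K: "K > 0" "\<And>x. x \<in> car Y \<Longrightarrow> nrm X x \<le> K * nrm Y x" using bounded_lin_mapE[OF b Y] by blast
  obtain L where L: "L > 0" "\<And>x. x \<in> car Y' \<Longrightarrow> nrm X' x \<le> L * nrm Y' x" using bounded_lin_mapE[OF b' Y'] by blast
  have "nrm X x + nrm X' y \<le> max K L * (nrm Y x + nrm Y' y)" if xy: "x \<in> car Y" "y \<in> car Y'" for x y
  proof -
    have "K * nrm Y x \<le> max K L * nrm Y x" "L * nrm Y' y \<le> max K L * nrm Y' y"
      using normedD(5)[OF Y xy(1)] normedD(5)[OF Y' xy(2)] by (auto intro!: mult_right_mono)
    then show ?thesis using K(2)[OF xy(1)] L(2)[OF xy(2)] by (simp add: distrib_left)
  qed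
  moreover have "car Y \<subseteq> car X" "car Y' \<subseteq> car X'"
    using lin_mapD(1)[OF bounded_lin_map_lin_map] b b' by blast+
  ultimately show ?thesis
    unfolding bounded_lin_map_def lin_map_def by (auto intro!: exI[of _ "max K L"])
qed

lemma nlim_subseq: "nlim V \<sigma> l \<Longrightarrow> strict_mono r \<Longrightarrow> nlim V (\<sigma> \<circ> r) l"
  unfolding nlim_def using LIMSEQ_subseq_LIMSEQ by (fastforce simp: o_def)

lemma nlim_nsum:
  assumes "nlim V (fst \<circ> \<sigma>) l" "nlim W (snd \<circ> \<sigma>) k" shows "nlim (nsum V W) \<sigma> (l, k)"
proof -
  have "nrm (nsum V W) (\<sigma> n - (l, k)) = nrm V (fst (\<sigma> n) - l) + nrm W (snd (\<sigma> n) - k)" for n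
    by (cases "\<sigma> n") simp
  moreover have "(\<lambda>n. nrm V (fst (\<sigma> n) - l) + nrm W (snd (\<sigma> n) - k)) \<longlonglongrightarrow> 0 + 0"
    using assms unfolding nlim_def by (intro tendsto_add) auto
  ultimately show ?thesis using assms by (auto simp: nlim_def mem_Times_iff)
qed

lemma compact_incl_nsum:
  assumes Y: "normed Y" and Y': "normed Y'" and c: "compact_incl Y X" and c': "compact_incl Y' X'"
  shows "compact_incl (nsum Y Y') (nsum X X')"
  unfolding compact_incl_def
proof (intro conjI allI impI)
  show "bounded_lin_map (nsum Y Y') (nsum X X') (\<lambda>x. x)"
    by (rule bounded_incl_nsum[OF Y Y' compact_incl_bounded[OF c] compact_incl_bounded[OF c']])
  fix \<sigma> :: "nat \<Rightarrow> 'a \<times> 'b" assume \<sigma>: "\<forall>n. \<sigma> n \<in> car (nsum Y Y') \<and> nrm (nsum Y Y') (\<sigma> n) \<le> 1"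
  have *: "fst (\<sigma> n) \<in> car Y" "snd (\<sigma> n) \<in> car Y'" "nrm Y (fst (\<sigma> n)) \<le> 1" "nrm Y' (snd (\<sigma> n)) \<le> 1" for n
  proof -
    obtain a b where ab: "\<sigma> n = (a, b)" by (cases "\<sigma> n")
    then have "a \<in> car Y" "b \<in> car Y'" "nrm Y a + nrm Y' b \<le> 1" using spec[OF \<sigma>, of n] by auto
    then show "fst (\<sigma> n) \<in> car Y" "snd (\<sigma> n) \<in> car Y'" "nrm Y (fst (\<sigma> n)) \<le> 1" "nrm Y' (snd (\<sigma> n)) \<le> 1"
      using normedD(5)[OF Y, of a] normedD(5)[OF Y', of b] by (simp_all add: ab)
  qed
  obtain r l where r: "strict_mono (r :: nat \<Rightarrow> nat)" "nlim X ((fst \<circ> \<sigma>) \<circ> r) l"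
    using compact_inclE[OF c, of "fst \<circ> \<sigma>"] * by auto
  obtain s k where s: "strict_mono (s :: nat \<Rightarrow> nat)" "nlim X' ((snd \<circ> \<sigma> \<circ> r) \<circ> s) k"
    using compact_inclE[OF c', of "snd \<circ> \<sigma> \<circ> r"] * by auto
  have "nlim (nsum X X') (\<sigma> \<circ> (r \<circ> s)) (l, k)"
    using nlim_subseq[OF r(2) s(1)] s(2) by (intro nlim_nsum) (simp_all add: o_assoc)
  then show "\<exists>r::nat \<Rightarrow> nat. \<exists>l. strict_mono r \<and> nlim (nsum X X') (\<sigma> \<circ> r) l"
    using strict_mono_o[OF r(1) s(1)] by blast
qed

lemma ncomplete_nsum:
  assumes V: "normed V" and W: "normed W" and "ncomplete V" "ncomplete W"
  shows "ncomplete (nsum V W)"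
  unfolding ncomplete_def
proof (intro allI impI, elim conjE)
  fix \<sigma> :: "nat \<Rightarrow> 'a \<times> 'b"
  assume \<sigma>: "\<forall>n. \<sigma> n \<in> car (nsum V W)"
    and cau: "\<forall>e>0. \<exists>N. \<forall>i\<ge>N. \<forall>j\<ge>N. nrm (nsum V W) (\<sigma> i - \<sigma> j) < e"
  have car: "fst (\<sigma> n) \<in> car V" "snd (\<sigma> n) \<in> car W" for n using spec[OF \<sigma>, of n] by auto
  have le: "nrm V (fst (\<sigma> i) - fst (\<sigma> j)) \<le> nrm (nsum V W) (\<sigma> i - \<sigma> j)"
      "nrm W (snd (\<sigma> i) - snd (\<sigma> j)) \<le> nrm (nsum V W) (\<sigma> i - \<sigma> j)" for i j
    using normedD(5)[OF V normedD(3)[OF V car(1)[of i] car(1)[of j]]]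
      normedD(5)[OF W normedD(3)[OF W car(2)[of i] car(2)[of j]]]
    by (cases "\<sigma> i"; cases "\<sigma> j"; simp)+
  have "\<exists>l. nlim V (fst \<circ> \<sigma>) l"
    by (rule assms(3)[unfolded ncomplete_def, rule_format]) (use car cau le(1) in \<open>auto, meson le_less_trans\<close>)
  moreover have "\<exists>l. nlim W (snd \<circ> \<sigma>) l"
    by (rule assms(4)[unfolded ncomplete_def, rule_format]) (use car cau le(2) in \<open>auto, meson le_less_trans\<close>)
  ultimately show "\<exists>l. nlim (nsum V W) \<sigma> l" using nlim_nsum by blast
qed

lemma nlim_isometry:
  assumes i: "lin_isometry V V' \<phi>" and V: "normed V" and "nlim V \<sigma> l"
  shows "nlim V' (\<phi> \<circ> \<sigma>) (\<phi> l)"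
proof -
  have l: "lin_map V V' \<phi>" and nr: "\<And>x. x \<in> car V \<Longrightarrow> nrm V' (\<phi> x) = nrm V x"
    using i by (auto simp: lin_isometry_def)
  have "nrm V' (\<phi> (\<sigma> n) - \<phi> l) = nrm V (\<sigma> n - l)" for n
    using assms(3) nr normedD(3)[OF V] lin_map_diff[OF l V] unfolding nlim_def by metis
  then show ?thesis using assms(3) lin_mapD(1)[OF l] by (auto simp: nlim_def)
qed

lemma ncomplete_isometry:
  assumes i: "lin_isometry V V' \<phi>" and V: "normed V" and c: "ncomplete V"
  shows "ncomplete V'"
  unfolding ncomplete_def
proof (intro allI impI, elim conjE)
  fix \<sigma> :: "nat \<Rightarrow> 'b" assume \<sigma>: "\<forall>n. \<sigma> n \<in> car V'"
    and cau: "\<forall>e>0. \<exists>N. \<forall>i\<ge>N. \<forall>j\<ge>N. nrm V' (\<sigma> i - \<sigma> j) < e"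
  let ?g = "inv_into (car V) \<phi>"
  have V': "normed V'" using lin_isometry_normed[OF i V] .
  have i': "lin_isometry V' V ?g" using lin_isometry_inv[OF i V] .
  have l: "lin_map V' V ?g" and nr: "\<And>x. x \<in> car V' \<Longrightarrow> nrm V (?g x) = nrm V' x"
    using i' by (auto simp: lin_isometry_def)
  have "nrm V (?g (\<sigma> i) - ?g (\<sigma> j)) = nrm V' (\<sigma> i - \<sigma> j)" for i j
    using \<sigma> nr normedD(3)[OF V'] lin_map_diff[OF l V'] by metis
  then have "\<exists>l. nlim V (?g \<circ> \<sigma>) l"
    using cau \<sigma> lin_mapD(1)[OF l] by (intro c[unfolded ncomplete_def, rule_format]) auto
  then obtain l where "nlim V (?g \<circ> \<sigma>) l" by blast
  then have "nlim V' (\<phi> \<circ> (?g \<circ> \<sigma>)) (\<phi> l)" by (rule nlim_isometry[OF i V])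
  moreover have "\<phi> \<circ> (?g \<circ> \<sigma>) = \<sigma>"
    using \<sigma> i by (auto simp: lin_isometry_def bij_betw_def f_inv_into_f)
  ultimately show "\<exists>l. nlim V' \<sigma> l" by auto
qed

lemma bounded_incl_isometry:
  assumes iY: "lin_isometry Y Y' \<phi>" and iX: "lin_isometry X X' \<phi>" and Y: "normed Y" and X: "normed X"
    and b: "bounded_lin_map Y X (\<lambda>x. x)"
  shows "bounded_lin_map Y' X' (\<lambda>x. x)"
  by (rule lin_isometry_bounded_lin_map[OF iY iX Y X b]) simp

lemma compact_incl_isometry:
  assumes iY: "lin_isometry Y Y' \<phi>" and iX: "lin_isometry X X' \<phi>" and Y: "normed Y" and X: "normed X"
    and c: "compact_incl Y X"
  shows "compact_incl Y' X'"
  unfolding compact_incl_def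
proof (intro conjI allI impI)
  show "bounded_lin_map Y' X' (\<lambda>x. x)"
    by (rule bounded_incl_isometry[OF iY iX Y X compact_incl_bounded[OF c]])
  fix \<sigma> :: "nat \<Rightarrow> 'b" assume \<sigma>: "\<forall>n. \<sigma> n \<in> car Y' \<and> nrm Y' (\<sigma> n) \<le> 1"
  let ?g = "inv_into (car Y) \<phi>"
  have g: "?g (\<sigma> n) \<in> car Y" "nrm Y (?g (\<sigma> n)) \<le> 1" "\<phi> (?g (\<sigma> n)) = \<sigma> n" for n
    using spec[OF \<sigma>, of n] lin_isometry_inv[OF iY Y] iY
    by (auto simp: lin_isometry_def bij_betw_def lin_map_def f_inv_into_f)
  obtain r l where r: "strict_mono (r :: nat \<Rightarrow> nat)" "nlim X ((?g \<circ> \<sigma>) \<circ> r) l"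
    using compact_inclE[OF c, of "?g \<circ> \<sigma>"] g by auto
  have "nlim X' (\<phi> \<circ> ((?g \<circ> \<sigma>) \<circ> r)) (\<phi> l)" by (rule nlim_isometry[OF iX X r(2)])
  moreover have "\<phi> \<circ> ((?g \<circ> \<sigma>) \<circ> r) = \<sigma> \<circ> r" by (simp add: fun_eq_iff g)
  ultimately show "\<exists>r::nat \<Rightarrow> nat. \<exists>l. strict_mono r \<and> nlim X' (\<sigma> \<circ> r) l" using r(1) by auto
qed

lemma cone_domain_isometry:
  assumes i: "lin_isometry V V' \<phi>" and V: "normed V" and U: "cone_domain V U"
  shows "cone_domain V' (\<phi> ` U)"
proof -
  obtain C where C: "generating_cone V C" "U \<subseteq> C"
      and d: "\<And>x. x \<in> U \<Longrightarrow> \<exists>d>0. \<forall>y\<in>C. nrm V (y - x) < d \<longrightarrow> y \<in> U"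
    using U unfolding cone_domain_def by blast
  note cone = generating_coneD[OF C(1)]
  have l: "lin_map V V' \<phi>" and nr: "\<And>x. x \<in> car V \<Longrightarrow> nrm V' (\<phi> x) = nrm V x"
    and car: "car V' = \<phi> ` car V"
    using i by (auto simp: lin_isometry_def bij_betw_def)
  have CV: "x \<in> car V" if "x \<in> C" for x using cone(1) that by blast
  have "generating_cone V' (\<phi> ` C)"
    unfolding generating_cone_def
  proof (intro conjI ballI allI impI)
    show "\<phi> ` C \<subseteq> car V'" using cone(1) car by blast
    fix p assume "p \<in> \<phi> ` C"
    then obtain x where x: "x \<in> C" "p = \<phi> x" by blast
    show "c *\<^sub>R p \<in> \<phi> ` C" if "c \<ge> 0" for c
      using lin_mapD(3)[OF l CV[OF x(1)], of c] cone(3)[OF that x(1)] x(2) by (metis imageI)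
    fix q assume "q \<in> \<phi> ` C"
    then obtain y where y: "y \<in> C" "q = \<phi> y" by blast
    show "p + q \<in> \<phi> ` C"
      using lin_mapD(2)[OF l CV[OF x(1)] CV[OF y(1)]] cone(2)[OF x(1) y(1)] x(2) y(2) by (metis imageI)
  next
    fix p assume "p \<in> car V'"
    then obtain v where v: "v \<in> car V" "p = \<phi> v" using car by blast
    obtain a b where "a \<in> C" "b \<in> C" "v = a - b" using cone(4)[OF v(1)] by blast
    then show "\<exists>a\<in>\<phi> ` C. \<exists>b\<in>\<phi> ` C. p = a - b" using lin_map_diff[OF l V CV CV] v(2) by blast
  qed
  moreover have "\<exists>d>0. \<forall>q\<in>\<phi> ` C. nrm V' (q - p) < d \<longrightarrow> q \<in> \<phi> ` U" if p: "p \<in> \<phi> ` U" for p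
  proof -
    obtain x where x: "x \<in> U" "p = \<phi> x" using p by blast
    obtain d where d: "d > 0" "\<And>y. y \<in> C \<Longrightarrow> nrm V (y - x) < d \<Longrightarrow> y \<in> U" using d[OF x(1)] by blast
    have "nrm V' (\<phi> y - p) = nrm V (y - x)" if "y \<in> C" for y
      using nr[OF normedD(3)[OF V CV[OF that] CV]] lin_map_diff[OF l V CV[OF that] CV] x C(2) by auto
    then show ?thesis using d by (intro exI[of _ d]) auto
  qed
  moreover have "\<phi> ` U \<subseteq> \<phi> ` C" using C(2) by blast
  ultimately show ?thesis unfolding cone_domain_def by blast
qed

text \<open>
  What the induction uses of \<open>(E, U)\<close> and of \<open>F\<close>. Domains need compact inclusions and targets complete
  levels; both properties persist under passage to the tangent and under the coding isometries.
\<close>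

definition sc_source :: "'a::real_vector sc_space \<Rightarrow> 'a set \<Rightarrow> bool" where
  "sc_source E U \<longleftrightarrow> U \<subseteq> car (E 0) \<and> (\<forall>m. normed (E m) \<and> compact_incl (E (Suc m)) (E m) \<and>
     cone_domain (E m) (U \<inter> car (E m)))"

definition sc_target :: "'a::real_vector sc_space \<Rightarrow> bool" where
  "sc_target F \<longleftrightarrow> (\<forall>m. normed (F m) \<and> ncomplete (F m) \<and> bounded_lin_map (F (Suc m)) (F m) (\<lambda>x. x))"

lemma sc_source_bounded: "sc_source E U \<Longrightarrow> bounded_lin_map (E (Suc m)) (E m) (\<lambda>x. x)"
  by (simp add: sc_source_def compact_incl_bounded)

lemma sc_normedI:
  assumes "\<And>m. normed (E m)" "\<And>m. bounded_lin_map (E (Suc m)) (E m) (\<lambda>x. x)"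
  shows "sc_normed E"
  unfolding sc_normed_def using assms lin_mapD(1)[OF bounded_lin_map_lin_map] by blast

lemma sc_source_sc_normed: "sc_source E U \<Longrightarrow> sc_normed E"
  using sc_source_bounded by (intro sc_normedI) (auto simp: sc_source_def)

lemma bounded_incl_levels:
  assumes "\<And>m. normed (E m)" "\<And>m. bounded_lin_map (E (Suc m)) (E m) (\<lambda>x. x)"
  shows "bounded_lin_map (E (i + j)) (E i) (\<lambda>x. x)"
proof (induction j)
  case 0 then show ?case by (simp add: bounded_lin_map_id)
next
  case (Suc j)
  then show ?case using bounded_lin_map_compose[OF assms(2) Suc assms(1,1)] by (simp add: o_def)
qed

lemma tangent_level: "tangent E m = nsum (E (Suc m)) (E m)"
  by (simp add: tangent_def sc_sum_def sc_shift_def)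

text \<open>
  Intersecting with a level of \<open>TE\<close> gives \<open>U\<^sub>m\<^sub>+\<^sub>1 \<times> E\<^sub>m\<close>, a domain of the form that the results on
  parameter-dependent linear maps require.
\<close>

lemma tangent_set_level:
  assumes "sc_normed E"
  shows "tangent_set E U \<inter> car (tangent E m) = (U \<inter> car (E (Suc m))) \<times> car (E m)"
proof -
  have "car (E (Suc m)) \<subseteq> car (E 1)" "car (E m) \<subseteq> car (E 0)"
  proof -
    show "car (E m) \<subseteq> car (E 0)" using sc_normed_car[OF assms] .
    show "car (E (Suc m)) \<subseteq> car (E 1)"
      by (induction m) (use assms in \<open>auto simp: sc_normed_def\<close>)
  qed
  then show ?thesis by (auto simp: tangent_set_def tangent_level)
qed

lemma sc_source_tangent:
  assumes "sc_source E U" shows "sc_source (tangent E) (tangent_set E U)"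
  unfolding sc_source_def tangent_set_level[OF sc_source_sc_normed[OF assms]]
  using assms tangent_set_subset[OF sc_source_sc_normed[OF assms]]
  by (auto simp only: sc_source_def tangent_level intro!: normed_nsum compact_incl_nsum cone_domain_nsum)

lemma sc_target_tangent: "sc_target F \<Longrightarrow> sc_target (tangent F)"
  by (auto simp only: sc_target_def tangent_level intro!: normed_nsum ncomplete_nsum bounded_incl_nsum)

lemma sc_source_isometry:
  assumes i: "sc_isometry E E' \<phi>" and s: "sc_source E U" shows "sc_source E' (\<phi> ` U)"
  unfolding sc_source_def
proof (intro conjI allI)
  have U: "U \<subseteq> car (E 0)" and n: "\<And>m. normed (E m)" and c: "\<And>m. compact_incl (E (Suc m)) (E m)"
    and d: "\<And>m. cone_domain (E m) (U \<inter> car (E m))" using s by (auto simp: sc_source_def)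
  have li: "\<And>m. lin_isometry (E m) (E' m) \<phi>" using i by (simp add: sc_isometry_def)
  show "\<phi> ` U \<subseteq> car (E' 0)" using U sc_isometry_car[OF i] by blast
  fix m
  show "normed (E' m)" using lin_isometry_normed[OF li n] .
  show "compact_incl (E' (Suc m)) (E' m)" by (rule compact_incl_isometry[OF li li n n c])
  have "\<phi> ` U \<inter> car (E' m) = \<phi> ` (U \<inter> car (E m))"
    using inj_on_image_Int[OF sc_isometry_inj[OF i] U sc_normed_car[OF sc_source_sc_normed[OF s]]]
      sc_isometry_car[OF i] by simp
  then show "cone_domain (E' m) (\<phi> ` U \<inter> car (E' m))" using cone_domain_isometry[OF li n d] by simp
qed

lemma sc_target_isometry:
  assumes i: "sc_isometry F F' \<phi>" and s: "sc_target F" shows "sc_target F'"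
proof -
  have n: "\<And>m. normed (F m)" and c: "\<And>m. ncomplete (F m)"
    and b: "\<And>m. bounded_lin_map (F (Suc m)) (F m) (\<lambda>x. x)" using s by (auto simp: sc_target_def)
  have li: "\<And>m. lin_isometry (F m) (F' m) \<phi>" using i by (simp add: sc_isometry_def)
  show ?thesis
    unfolding sc_target_def
    using lin_isometry_normed[OF li n] ncomplete_isometry[OF li n c] bounded_incl_isometry[OF li li n n b] by blast
qed

section \<open>The induction on the sc-degree\<close>

lemma first_order_at_mono:
  assumes V: "normed V" and V1: "normed V1" and W: "normed W" and b: "bounded_lin_map V V1 (\<lambda>x. x)"
    and fo: "first_order_at V1 W U1 f x A" and U: "U \<subseteq> U1" and x: "x \<in> U"
    and f: "\<And>y. y \<in> U \<Longrightarrow> f y \<in> car W" and A: "lin_map V W A"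
  shows "first_order_at V W U f x A"
proof (rule first_order_atI[OF V W f x])
  show "A h \<in> car W" if "h \<in> car V" for h using lin_mapD(1)[OF A that] .
  fix e :: real assume "e > 0"
  obtain K where K: "K > 0" "\<And>x. x \<in> car V \<Longrightarrow> nrm V1 x \<le> K * nrm V x" using bounded_lin_mapE[OF b V] by blast
  have sub: "h \<in> car V1" if "h \<in> car V" for h using lin_mapD(1)[OF bounded_lin_map_lin_map[OF b]] that .
  have "e / K > 0" using \<open>e > 0\<close> K(1) by simp
  then obtain d where d: "d > 0" "\<And>h. h \<in> car V1 \<Longrightarrow> nrm V1 h < d \<Longrightarrow> x + h \<in> U1 \<Longrightarrow>
      nrm W (f (x + h) - f x - A h) \<le> e / K * nrm V1 h"
    using first_order_atD[OF fo V1 W lin_map_0[OF A V]] by blast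
  show "\<exists>d>0. \<forall>h\<in>car V. nrm V h < d \<longrightarrow> x + h \<in> U \<longrightarrow> nrm W (f (x + h) - f x - A h) \<le> e * nrm V h"
  proof (intro exI[of _ "d / K"] conjI ballI impI)
    show "d / K > 0" using d K by simp
    fix h assume h: "h \<in> car V" "nrm V h < d / K" "x + h \<in> U"
    have "nrm V1 h < d" using K(2)[OF h(1)] h(2) K(1) by (simp add: field_simps)
    then have "nrm W (f (x + h) - f x - A h) \<le> e / K * nrm V1 h" using d(2) sub h U by blast
    also have "\<dots> \<le> e / K * (K * nrm V h)" using K(2)[OF h(1)] \<open>e / K > 0\<close> by (intro mult_left_mono) auto
    finally show "nrm W (f (x + h) - f x - A h) \<le> e * nrm V h" using K(1) by simp
  qed
qed

lemma first_order_at_restr: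
  "normed V \<Longrightarrow> first_order_at V W U f x A \<Longrightarrow> first_order_at V W U f x (restr V A)"
  by (simp add: first_order_at_iff)

lemma sc0_map_imp_c0_map:
  assumes "sc0_map E U F f" "normed (E m)" "normed (F m)"
  shows "c0_map (E m) (U \<inter> car (E m)) (F m) f"
proof -
  have "c0_map (E m) U (F m) f" using assms(1) by (simp add: sc0_map_def c0_map_def)
  then show ?thesis using assms(2,3) by (simp add: c0_map_iff)
qed

text \<open>
  The core of the induction step, with \<open>V = Y = E\<^sub>m\<^sub>+\<^sub>l\<^sub>+\<^sub>1\<close>, \<open>X = E\<^sub>m\<^sub>+\<^sub>l\<close> and \<open>W = F\<^sub>m\<close>. The derivative of \<open>f\<close> at \<open>x\<close> is
  the restriction of \<open>Df x\<close> to \<open>V\<close>: it is a derivative into \<open>F\<^sub>0\<close> by assumption, into \<open>F\<^sub>m\<close> by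
  \<open>first_order_at_finer_target\<close>, and depends on \<open>x\<close> in a \<open>C\<^sup>l\<close> way by \<open>c_map_op_of_linear_param\<close>.
\<close>

lemma c_map_of_tangent_c_map:
  assumes E: "sc_source E U" and F: "sc_target F" and f: "sc0_map E U F f"
    and Df: "sc_derivative E U F f Df"
    and T: "c_map l (tangent E (m + l)) (tangent_set E U \<inter> car (tangent E (m + l))) (tangent F m) (tangent_map f Df)"
  shows "c_map (Suc l) (E (m + Suc l)) (U \<inter> car (E (m + Suc l))) (F m) f"
proof -
  have nE: "normed (E i)" for i using E by (simp add: sc_source_def)
  have nF: "normed (F i)" and bF: "bounded_lin_map (F (Suc i)) (F i) (\<lambda>x. x)" and cF: "ncomplete (F i)" for i
    using F by (auto simp: sc_target_def)
  have bE: "bounded_lin_map (E (Suc i)) (E i) (\<lambda>x. x)" for i using sc_source_bounded[OF E] .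
  have sE: "sc_normed E" using sc_source_sc_normed[OF E] .
  let ?V = "E (Suc (m + l))" and ?X = "E (m + l)" and ?W = "F m"
  let ?U = "U \<inter> car ?V"
  have c: "compact_incl ?V ?X" and cU: "cone_domain ?V ?U" using E by (auto simp: sc_source_def)
  have b1: "bounded_lin_map ?V (E 1) (\<lambda>x. x)" using bounded_incl_levels[where E = E, OF nE bE, of 1 "m + l"] by simp
  have bm: "bounded_lin_map ?V (E m) (\<lambda>x. x)" using bounded_incl_levels[where E = E, OF nE bE, of m "Suc l"] by simp
  have bF0: "bounded_lin_map ?W (F 0) (\<lambda>x. x)" using bounded_incl_levels[where E = F, OF nF bF, of 0 m] by simp
  have U1: "?U \<subseteq> U \<inter> car (E 1)" using lin_mapD(1)[OF bounded_lin_map_lin_map[OF b1]] by blast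
  have X0: "car ?X \<subseteq> car (E 0)" and V0: "car ?V \<subseteq> car (E 0)" by (rule sc_normed_car[OF sE])+
  have nT: "normed (nsum ?V ?X)" "normed (nsum (F (Suc m)) ?W)" using normed_nsum nE nF by blast+
  let ?\<Phi> = "\<lambda>(x, h). Df x h"
  have bsnd: "bounded_lin_map (nsum (F (Suc m)) ?W) ?W snd"
    unfolding bounded_lin_map_def lin_map_def using normedD(5)[OF nF] by (auto intro!: exI[of _ 1])
  have T': "c_map l (nsum ?V ?X) (?U \<times> car ?X) (nsum (F (Suc m)) ?W) (tangent_map f Df)"
    using T unfolding tangent_set_level[OF sE] by (simp only: tangent_level)
  have \<Phi>l: "c_map l (nsum ?V ?X) (?U \<times> car ?X) ?W ?\<Phi>"
    by (rule c_map_compose[OF bounded_lin_map_id bsnd nT(1,1,2) nF _ _ _ _ T']) (auto simp: tangent_map_def)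
  have \<Phi>0: "c0_map (nsum ?V ?X) (?U \<times> car ?X) ?W ?\<Phi>"
    by (rule c_map_imp_c0_map[OF nT(1) nF _ \<Phi>l]) auto
  have lin: "lin_map ?X ?W (\<lambda>h. ?\<Phi> (x, h))" if x: "x \<in> ?U" for x
  proof -
    have l0: "lin_map (E 0) (F 0) (Df x)"
      using Df U1 x by (auto simp: sc_derivative_def bounded_lin_map_def)
    have "Df x h \<in> car ?W" if "h \<in> car ?X" for h
      using c0_mapD(1)[OF \<Phi>0 nT(1) nF, of "(x, h)"] x that by auto
    then show ?thesis
      using lin_mapD(2,3)[OF l0] subsetD[OF X0] unfolding lin_map_def by simp
  qed
  have f0: "c0_map ?V ?U ?W f"
    by (rule c0_map_compose[OF bm bounded_lin_map_id nE nE nF nF _ _ sc0_map_imp_c0_map[OF f nE nF]])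
      (use lin_mapD(1)[OF bounded_lin_map_lin_map[OF bm]] in auto)
  have fW: "f x \<in> car ?W" if "x \<in> ?U" for x using c0_mapD(1)[OF f0 nE nF] that by blast
  have fo0: "first_order_at ?V (F 0) ?U f x (\<lambda>h. ?\<Phi> (x, h))" if x: "x \<in> ?U" for x
  proof (rule first_order_at_mono[OF nE nE nF b1 _ _ x])
    have "bounded_lin_map (E 0) (F 0) (Df x)" and fo: "first_order_at (E 1) (F 0) U f x (Df x)"
      using Df U1 x unfolding sc_derivative_def by blast+
    then have l0: "lin_map (E 0) (F 0) (Df x)" by (intro bounded_lin_map_lin_map)
    show "lin_map ?V (F 0) (\<lambda>h. ?\<Phi> (x, h))"
      using lin_mapD[OF l0] subsetD[OF V0] unfolding lin_map_def by simp
    show "first_order_at (E 1) (F 0) U f x (\<lambda>h. ?\<Phi> (x, h))" using fo by simp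
    show "f y \<in> car (F 0)" if "y \<in> ?U" for y
      using lin_mapD(1)[OF bounded_lin_map_lin_map[OF bF0] fW[OF that]] .
  qed blast
  have op: "c_map l ?V ?U (op_space ?V ?W) (\<lambda>x. restr ?V (\<lambda>h. ?\<Phi> (x, h)))"
    by (rule c_map_op_of_linear_param[OF nE nE nE nF c cU \<Phi>l lin])
  have "frechet_derivative_on ?V ?U ?W f (\<lambda>x. restr ?V (\<lambda>h. ?\<Phi> (x, h)))"
    unfolding frechet_derivative_on_def
  proof (intro ballI conjI)
    fix x assume x: "x \<in> ?U"
    show "restr ?V (\<lambda>h. ?\<Phi> (x, h)) \<in> car (op_space ?V ?W)"
      using c0_mapD(1)[OF c_map_imp_c0_map[OF nE normed_op_space[OF nE nF] _ op] nE normed_op_space[OF nE nF] x] x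
      by blast
    show "first_order_at ?V ?W ?U f x (restr ?V (\<lambda>h. ?\<Phi> (x, h)))"
      by (rule first_order_at_restr[OF nE first_order_at_finer_target[OF nE nE nF nF cF bF0 c cU fW \<Phi>0 lin fo0 x]])
  qed
  then have "c_map (Suc l) ?V ?U ?W f"
    using f0 op c_map_Suc[OF nE nF, of ?U] by blast
  then show ?thesis by simp
qed

lemma sc_map_coded_imp_c_map:
  fixes E :: "(bool list \<Rightarrow> 'a::real_vector) sc_space" and F :: "(bool list \<Rightarrow> 'b::real_vector) sc_space"
  assumes "sc_source E U" "sc_target F" "sc_map_coded k E U F f" "l \<le> k"
  shows "c_map l (E (m + l)) (U \<inter> car (E (m + l))) (F m) f"
  using assms
proof (induction k arbitrary: E U F f l m)
  case 0
  then have "sc0_map E U F f" "l = 0" "normed (E m)" "normed (F m)" by (auto simp: sc_source_def sc_target_def)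
  then show ?case using sc0_map_imp_c0_map c_map_0 by fastforce
next
  case (Suc k)
  note E = Suc.prems(1) and F = Suc.prems(2)
  have sE: "sc_normed E" using sc_source_sc_normed[OF E] .
  obtain Df where f: "sc0_map E U F f" and Df: "sc_derivative E U F f Df"
    and T: "sc_map_coded k (nimage node \<circ> tangent E) (node ` tangent_set E U) (nimage node \<circ> tangent F)
          (node \<circ> tangent_map f Df \<circ> unnode)"
    using Suc.prems(3) by auto
  show ?case
  proof (cases l)
    case 0
    have "normed (E m)" "normed (F m)" using E F by (auto simp: sc_source_def sc_target_def)
    then show ?thesis using sc0_map_imp_c0_map[OF f] c_map_0 0 by fastforce
  next
    case (Suc l')
    let ?TE = "tangent E (m + l')" and ?TF = "tangent F m"
    let ?TU = "tangent_set E U \<inter> car ?TE"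
    have TE: "sc_source (tangent E) (tangent_set E U)" and TF: "sc_target (tangent F)"
      using sc_source_tangent[OF E] sc_target_tangent[OF F] .
    have n: "normed ?TE" "normed ?TF" using TE TF by (auto simp: sc_source_def sc_target_def)
    have IH: "c_map l' ((nimage node \<circ> tangent E) (m + l')) (node ` tangent_set E U \<inter> car ((nimage node \<circ> tangent E) (m + l')))
        ((nimage node \<circ> tangent F) m) (node \<circ> tangent_map f Df \<circ> unnode)"
      by (rule Suc.IH[OF sc_source_isometry[OF sc_isometry_node TE] sc_target_isometry[OF sc_isometry_node TF] T])
        (use Suc.prems(4) Suc in simp)
    have li: "lin_isometry ?TE (nimage node ?TE) node" "lin_isometry (nimage node ?TF) ?TF unnode"
      by (simp_all add: lin_isometry_nimage lin_isometry_nimage_inv linear_node inj_node unnode_linear)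
    have n': "normed (nimage node ?TE)" "normed (nimage node ?TF)"
      using lin_isometry_normed[OF lin_isometry_nimage[OF linear_node inj_node]] n by blast+
    have "c_map l' ?TE ?TU ?TF (tangent_map f Df)"
      by (rule c_map_compose[OF lin_isometry_imp_bounded[OF li(1)] lin_isometry_imp_bounded[OF li(2)] n'(1) n(1) n'(2) n(2)
            _ _ _ _ IH[unfolded o_apply]]) (auto simp: nimage_def)
    then show ?thesis unfolding Suc by (rule c_map_of_tangent_c_map[OF E F f Df])
  qed
qed

section \<open>sc-Banach spaces and partial quadrants\<close>

lemma compact_lin_map_imp_compact_incl:
  assumes Y: "normed Y" and X: "normed X" and c: "compact_lin_map Y X (\<lambda>x. x)"
  shows "compact_incl Y X"
proof -
  interpret Metric_space "car X" "ndist X" by (rule metric_normed[OF X])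
  let ?B = "{x \<in> car Y. nrm Y x \<le> 1}" let ?K = "ntop X closure_of ?B"
  have l: "lin_map Y X (\<lambda>x. x)" and K: "compactin (ntop X) ?K" using c by (auto simp: compact_lin_map_def)
  have BX: "?B \<subseteq> car X" using lin_mapD(1)[OF l] by blast
  have BK: "?B \<subseteq> ?K" using closure_of_subset[of ?B "ntop X"] BX by (simp add: topspace_ntop[OF X])
  obtain a r where ar: "?K \<subseteq> mcball a r" using compactin_imp_mbounded[OF K] unfolding mbounded_def by blast
  have "nrm X h \<le> r + ndist X a 0" if h: "h \<in> ?B" for h
  proof -
    have "h \<in> mcball a r" using h BK ar by blast
    then have "a \<in> car X" "h \<in> car X" "ndist X a h \<le> r" by auto
    then have "ndist X h 0 \<le> r + ndist X a 0"
      using triangle[of h a 0] normedD(1)[OF X] commute[of h a] by simp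
    then show ?thesis using \<open>h \<in> car X\<close> normedD(1)[OF X] by (simp add: ndist_def)
  qed
  then have bB: "\<And>h. h \<in> car Y \<Longrightarrow> nrm Y h \<le> 1 \<Longrightarrow> nrm X h \<le> r + ndist X a 0" by blast
  have "nrm X h \<le> (r + ndist X a 0) * nrm Y h" if h: "h \<in> car Y" for h
  proof (cases "h = 0")
    case True then show ?thesis by (simp add: nrm_0 X Y)
  next
    case False
    then have p: "nrm Y h > 0" using normedD(5,6)[OF Y h] by linarith
    have "nrm X ((1 / nrm Y h) *\<^sub>R h) \<le> r + ndist X a 0"
      using p by (intro bB normedD(4)[OF Y h]) (simp add: normedD(7)[OF Y h])
    then show ?thesis using p by (simp add: normedD(7)[OF X lin_mapD(1)[OF l h]] field_simps)
  qed
  then have "bounded_lin_map Y X (\<lambda>x. x)" using l unfolding bounded_lin_map_def by blast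
  moreover have "\<exists>r::nat \<Rightarrow> nat. \<exists>l. strict_mono r \<and> nlim X (\<sigma> \<circ> r) l"
    if \<sigma>: "\<forall>n. \<sigma> n \<in> car Y \<and> nrm Y (\<sigma> n) \<le> 1" for \<sigma>
  proof -
    have "range \<sigma> \<subseteq> ?K" using \<sigma> BK by blast
    then obtain k r where kr: "strict_mono (r :: nat \<Rightarrow> nat)" "limitin (ntop X) (\<sigma> \<circ> r) k sequentially"
      using K unfolding compactin_sequentially by blast
    have sX: "\<sigma> n \<in> car X" for n using \<sigma> lin_mapD(1)[OF l] by blast
    have k: "k \<in> car X" and lim: "\<And>e. e > 0 \<Longrightarrow> \<exists>N. \<forall>n\<ge>N. ndist X ((\<sigma> \<circ> r) n) k < e"
      using kr(2) unfolding limit_metric_sequentially by blast+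
    have nn: "nrm X (\<sigma> (r n) - k) \<ge> 0" for n using normedD(3,5)[OF X] sX k by blast
    have "(\<lambda>n. nrm X ((\<sigma> \<circ> r) n - k)) \<longlonglongrightarrow> 0"
      unfolding LIMSEQ_def dist_real_def using lim sX k nn by (simp add: ndist_def)
    then show ?thesis using kr(1) k sX by (auto simp: nlim_def)
  qed
  ultimately show ?thesis unfolding compact_incl_def by blast
qed

lemma banach_space_imp_ncomplete:
  assumes "banach_space V" shows "ncomplete V"
  unfolding ncomplete_def
proof (intro allI impI, elim conjE)
  have V: "normed V" using assms by (simp add: banach_space_def)
  interpret Metric_space "car V" "ndist V" by (rule metric_normed[OF V])
  fix \<sigma> :: "nat \<Rightarrow> 'a" assume \<sigma>: "\<forall>n. \<sigma> n \<in> car V" and cau: "\<forall>e>0. \<exists>N. \<forall>i\<ge>N. \<forall>j\<ge>N. nrm V (\<sigma> i - \<sigma> j) < e"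
  then have "MCauchy \<sigma>" unfolding MCauchy_def ndist_def by (auto simp: image_subset_iff)
  then obtain l where l: "limitin (ntop V) \<sigma> l sequentially"
    using assms unfolding banach_space_def mcomplete_def by blast
  then have lV: "l \<in> car V" and lim: "\<And>e. e > 0 \<Longrightarrow> \<exists>N. \<forall>n\<ge>N. ndist V (\<sigma> n) l < e"
    unfolding limit_metric_sequentially by blast+
  have nn: "nrm V (\<sigma> n - l) \<ge> 0" for n using normedD(3,5)[OF V] \<sigma> lV by blast
  have "(\<lambda>n. nrm V (\<sigma> n - l)) \<longlonglongrightarrow> 0"
    unfolding LIMSEQ_def dist_real_def using lim \<sigma> lV nn by (simp add: ndist_def)
  then show "\<exists>l. nlim V \<sigma> l" using \<sigma> lV by (auto simp: nlim_def)
qed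

lemma sc_banachD:
  assumes "sc_banach E"
  shows "banach_space (E m)" "normed (E m)" "compact_incl (E (Suc m)) (E m)"
proof -
  have B: "banach_space (E i)" for i using assms by (simp add: sc_banach_def)
  have n: "normed (E i)" for i using B by (simp add: banach_space_def)
  show "banach_space (E m)" "normed (E m)" by (fact B, fact n)
  show "compact_incl (E (Suc m)) (E m)"
    using assms by (intro compact_lin_map_imp_compact_incl n) (simp add: sc_banach_def)
qed

lemma sc_banach_imp_sc_target: "sc_banach F \<Longrightarrow> sc_target F"
  unfolding sc_target_def using sc_banachD compact_incl_bounded banach_space_imp_ncomplete by blast

text \<open>
  \<open>C\<close> is the preimage of \<open>[0, \<infinity>)\<^sup>n \<oplus> W\<close> under \<open>T\<close>. A vector of \<open>\<real>\<^sup>n \<oplus> W\<close> is the difference of two elements of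
  this cone through the positive and negative parts of its coordinates, and as the inverse of \<open>T\<close> preserves
  levels, the decomposition can be made inside each \<open>E\<^sub>m\<close>.
\<close>

lemma generating_cone_partial_quadrant:
  assumes E: "sc_banach E" and q: "partial_quadrant E C"
  shows "generating_cone (E m) (C \<inter> car (E m))"
proof -
  obtain W :: "'a sc_space" and n T where W: "sc_banach W" and iso: "sc_iso E (sc_sum (sc_Rn n) W) T"
    and TC: "T ` C = {v \<in> car (sc_Rn n 0). \<forall>i. 0 \<le> v i} \<times> car (W 0)" and cl: "closedin (ntop (E 0)) C"
    using q unfolding partial_quadrant_def by blast
  let ?Q = "{v \<in> car (sc_Rn n 0). \<forall>i. 0 \<le> v i} \<times> car (W 0)"
  let ?G = "sc_sum (sc_Rn n) W" and ?g = "inv_into (car (E 0)) T"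
  have nE: "normed (E i)" and nW: "normed (W i)" for i using sc_banachD(2) E W by blast+
  have C0: "C \<subseteq> car (E 0)" using closedin_subset[OF cl] topspace_ntop[OF nE] by simp
  have sE: "sc_normed E" and sW: "sc_normed W" using sc_banach_imp_sc_normed E W by blast+
  have m0: "x \<in> car (E m) \<Longrightarrow> x \<in> car (E 0)" for x using sc_normed_car[OF sE] by blast
  have bij: "bij_betw T (car (E 0)) (car (?G 0))" and l: "lin_map (E 0) (?G 0) T"
    and cT: "continuous_map (ntop (E m)) (ntop (?G m)) T" and cg: "continuous_map (ntop (?G m)) (ntop (E m)) ?g"
    using iso by (auto simp: sc_iso_def sc_operator_def)
  have R: "car (sc_Rn n i) = {v. \<forall>j\<ge>n. v j = 0}" for i by (simp add: sc_Rn_def)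
  have carG: "car (?G i) = {v. \<forall>j\<ge>n. v j = 0} \<times> car (W i)" for i by (simp add: sc_sum_def R)
  have inj: "x = y" if "T x = T y" "x \<in> car (E 0)" "y \<in> car (E 0)" for x y
    using bij that by (auto simp: bij_betw_def inj_on_def)
  have memC: "x \<in> C \<longleftrightarrow> T x \<in> ?Q" if x: "x \<in> car (E 0)" for x
  proof
    assume "T x \<in> ?Q"
    then have "T x \<in> T ` C" by (simp only: TC)
    then obtain c where c: "c \<in> C" "T x = T c" by (rule imageE)
    then have "x = c" using inj[of x c] x subsetD[OF C0] by simp
    then show "x \<in> C" using c(1) by simp
  next
    assume "x \<in> C"
    then have "T x \<in> T ` C" by (rule imageI)
    then show "T x \<in> ?Q" by (simp only: TC)
  qed
  have Tg: "T (?g p) = p" if "p \<in> car (?G 0)" for p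
    using bij_betw_inv_into_right[OF bij that] .
  \<comment> \<open>needed to know that a continuous map from level \<open>m\<close> to level \<open>m\<close> respects the carriers\<close>
  have nR: "normed (sc_Rn n m)"
  proof -
    have "L2_set v {..<n} = 0 \<longleftrightarrow> v = 0" if "\<forall>j\<ge>n. v j = 0" for v
      using that by (auto simp: L2_set_eq_0_iff fun_eq_iff) (metis not_le lessThan_iff)
    moreover have "subspace {v::nat \<Rightarrow> real. \<forall>i\<ge>n. v i = 0}"
      by (auto simp: subspace_def scaleR_fun_def)
    moreover have "L2_set (c *\<^sub>R v) {..<n} = \<bar>c\<bar> * L2_set v {..<n}" for c and v :: "nat \<Rightarrow> real"
      using L2_set_right_distrib[of "\<bar>c\<bar>" v "{..<n}"]
      by (simp add: scaleR_fun_def L2_set_def power_mult_distrib)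
    moreover have "L2_set (v + w) {..<n} \<le> L2_set v {..<n} + L2_set w {..<n}" for v w
      using L2_set_triangle_ineq[of v w "{..<n}"] by (simp add: plus_fun_def)
    ultimately show ?thesis unfolding normed_def sc_Rn_def by (auto simp: L2_set_nonneg)
  qed
  have nG: "normed (?G m)" using normed_nsum[OF nR nW] by (simp add: sc_sum_def)
  have Tm: "T x \<in> car (?G m)" if "x \<in> car (E m)" for x
    using cT that unfolding continuous_map_def by (auto simp: topspace_ntop nE nG Pi_iff)
  have gm: "?g p \<in> car (E m)" if "p \<in> car (?G m)" for p
    using cg that unfolding continuous_map_def by (auto simp: topspace_ntop nE nG Pi_iff)
  have Wm: "w \<in> car (W m) \<Longrightarrow> w \<in> car (W 0)" for w using sc_normed_car[OF sW] by blast
  have Q: "p \<in> ?Q \<longleftrightarrow> (\<forall>i\<ge>n. fst p i = 0) \<and> (\<forall>i. 0 \<le> fst p i) \<and> snd p \<in> car (W 0)" for p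
    by (cases p) (auto simp: R)
  show ?thesis
    unfolding generating_cone_def
  proof (intro conjI ballI allI impI)
    fix x assume x: "x \<in> C \<inter> car (E m)"
    show "c *\<^sub>R x \<in> C \<inter> car (E m)" if "c \<ge> 0" for c
      using x that memC[of x] memC[of "c *\<^sub>R x"] lin_mapD(3)[OF l, of x c] m0 normedD(4)[OF nE] normedD(4)[OF nW]
      by (simp add: Q scaleR_fun_def)
    fix y assume y: "y \<in> C \<inter> car (E m)"
    show "x + y \<in> C \<inter> car (E m)"
      using x y memC[of x] memC[of y] memC[of "x + y"] lin_mapD(2)[OF l, of x y] m0 normedD(2)[OF nE] normedD(2)[OF nW]
      by (simp add: Q plus_fun_def)
  next
    fix v assume v: "v \<in> car (E m)"
    obtain p w where pw: "T v = (p, w)" by (cases "T v")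
    have p: "\<forall>i\<ge>n. p i = 0" "w \<in> car (W m)" using Tm[OF v] unfolding pw carG by auto
    define a where "a = ?g (\<lambda>i. max (p i) 0, w)"
    define b where "b = ?g (\<lambda>i. max (- p i) 0, 0)"
    have in_m: "(\<lambda>i. max (p i) 0, w) \<in> car (?G m)" "(\<lambda>i. max (- p i) 0, 0) \<in> car (?G m)"
      using p normedD(1)[OF nW] by (auto simp: carG)
    have in_0: "(\<lambda>i. max (p i) 0, w) \<in> car (?G 0)" "(\<lambda>i. max (- p i) 0, 0) \<in> car (?G 0)"
      using p Wm normedD(1)[OF nW] by (auto simp: carG)
    have ab: "a \<in> car (E m)" "b \<in> car (E m)" unfolding a_def b_def using gm in_m by blast+
    have Tab: "T a = (\<lambda>i. max (p i) 0, w)" "T b = (\<lambda>i. max (- p i) 0, 0)"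
      unfolding a_def b_def using Tg in_0 by blast+
    have C: "a \<in> C" "b \<in> C"
      using memC[OF m0[OF ab(1)]] memC[OF m0[OF ab(2)]] p Wm normedD(1)[OF nW] by (auto simp: Q Tab)
    have "T (a - b) = T v"
      using lin_map_diff[OF l nE m0[OF ab(1)] m0[OF ab(2)]] by (auto simp: Tab pw fun_eq_iff)
    then have "a - b = v" using inj m0 v normedD(3)[OF nE] ab by blast
    then show "\<exists>a\<in>C \<inter> car (E m). \<exists>b\<in>C \<inter> car (E m). v = a - b" using C ab by blast
  qed blast
qed

lemma sc_source_partial_quadrant:
  assumes E: "sc_banach E" and q: "partial_quadrant E C" and U: "openin (subtopology (ntop (E 0)) C) U"
  shows "sc_source E U"
proof -
  have n: "normed (E m)" and c: "compact_incl (E (Suc m)) (E m)" for m using sc_banachD[OF E] by blast+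
  interpret Metric_space "car (E 0)" "ndist (E 0)" by (rule metric_normed[OF n])
  obtain S where S: "openin (ntop (E 0)) S" "U = S \<inter> C" using U unfolding openin_subtopology by blast
  have U0: "U \<subseteq> car (E 0)" using openin_subset[OF S(1)] S(2) topspace_ntop[OF n, of 0] by blast
  have "cone_domain (E m) (U \<inter> car (E m))" for m
    unfolding cone_domain_def
  proof (intro exI[of _ "C \<inter> car (E m)"] conjI ballI)
    show "generating_cone (E m) (C \<inter> car (E m))" by (rule generating_cone_partial_quadrant[OF E q])
    show "U \<inter> car (E m) \<subseteq> C \<inter> car (E m)" using S(2) by blast
    fix x assume x: "x \<in> U \<inter> car (E m)"
    then obtain r where r: "r > 0" "mball x r \<subseteq> S" using S unfolding openin_mtopology by blast
    have b: "bounded_lin_map (E m) (E 0) (\<lambda>x. x)"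
      using bounded_incl_levels[where E = E, OF n compact_incl_bounded[OF c], of 0 m] by simp
    obtain K where K: "K > 0" "\<And>x. x \<in> car (E m) \<Longrightarrow> nrm (E 0) x \<le> K * nrm (E m) x"
      using bounded_lin_mapE[OF b n] by blast
    show "\<exists>d>0. \<forall>y\<in>C \<inter> car (E m). nrm (E m) (y - x) < d \<longrightarrow> y \<in> U \<inter> car (E m)"
    proof (intro exI[of _ "r / K"] conjI ballI impI)
      show "r / K > 0" using r K by simp
      fix y assume y: "y \<in> C \<inter> car (E m)" "nrm (E m) (y - x) < r / K"
      have xy: "x \<in> car (E 0)" "y \<in> car (E 0)"
        using x y lin_mapD(1)[OF bounded_lin_map_lin_map[OF b]] by auto
      have "nrm (E 0) (y - x) < r"
        using K(2)[of "y - x"] normedD(3)[OF n] x y K(1) by (auto simp: field_simps)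
      then have "y \<in> mball x r" using xy nrm_minus_commute[OF n xy] by (simp add: ndist_def)
      then show "y \<in> U \<inter> car (E m)" using r(2) S(2) y by blast
    qed
  qed
  then show ?thesis unfolding sc_source_def using U0 n c by blast
qed

theorem proposition1p10:
  fixes E :: "'a::real_vector sc_space" and F :: "'b::real_vector sc_space"
    and C U :: "'a set" and f :: "'a \<Rightarrow> 'b" and k :: nat
  assumes "sc_banach E" and "sc_banach F"
    and "partial_quadrant E C"
    and "openin (subtopology (ntop (E 0)) C) U"
    and "sc_map k E U F f"
  shows "\<forall>l m. l \<le> k \<longrightarrow> c_map l (E (m + l)) (U \<inter> car (E (m + l))) (F m) f"
proof (intro allI impI)
  fix l m assume "l \<le> k"
  have E: "sc_source E U" using sc_source_partial_quadrant[OF assms(1,3,4)] .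
  have F: "sc_target F" using sc_banach_imp_sc_target[OF assms(2)] .
  let ?E = "nimage leaf \<circ> E :: (bool list \<Rightarrow> 'a) sc_space" and ?F = "nimage leaf \<circ> F :: (bool list \<Rightarrow> 'b) sc_space"
  have n: "normed (E (m + l))" "normed (F m)" using E F by (auto simp: sc_source_def sc_target_def)
  have n': "normed (?E (m + l))" "normed (?F m)"
    using lin_isometry_normed[OF lin_isometry_leaf] n by (auto simp: o_def)
  have leaf: "bounded_lin_map (E (m + l)) (?E (m + l)) leaf" "bounded_lin_map (?F m) (F m) unleaf"
    by (simp_all add: lin_isometry_imp_bounded lin_isometry_leaf lin_isometry_unleaf)
  have "c_map l (?E (m + l)) (leaf ` U \<inter> car (?E (m + l))) (?F m) (leaf \<circ> f \<circ> unleaf)"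
    using assms(5) unfolding sc_map_def
    by (intro sc_map_coded_imp_c_map[OF sc_source_isometry[OF sc_isometry_leaf E]
          sc_target_isometry[OF sc_isometry_leaf F] _ \<open>l \<le> k\<close>])
  then show "c_map l (E (m + l)) (U \<inter> car (E (m + l))) (F m) f"
    by (rule c_map_compose[OF leaf n'(1) n(1) n'(2) n(2), rotated 4]) (auto simp: nimage_def)
qed

end
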